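(* Let $\mathcal{H}$ be a real Hilbert space, let $\Phi:\mathcal{H}\to\mathbb{R}\cup\{+\infty\}$ be a convex lower semicontinuous proper function, let $\lambda>0$ and set $\mu=\frac{1}{\lambda}$. Let $\varepsilon:\mathbb{R}_+\to\mathbb{R}_+$ be a nonnegative locally integrable function, and let $(x_0,\upsilon_0)\in\mathcal{H}\times\mathcal{H}$ satisfy $\upsilon_0\in\partial\Phi(x_0)$. Then: (i) there exists a unique strong global solution $(x(\cdot),\upsilon(\cdot)):[0,+\infty[\to\mathcal{H}\times\mathcal{H}$ of the Cauchy problem $$\upsilon(t)\in\partial\Phi(x(t)),\qquad \lambda\dot x(t)+\dot\upsilon(t)+\upsilon(t)+\varepsilon(t)x(t)=0,\qquad x(0)=x_0,\ \upsilon(0)=\upsilon_0;$$ (ii) this solution can be represented, for every $t\in[0,+\infty[$, as $$x(t)=\mathrm{prox}_{\mu\Phi}(y(t)),\qquad \upsilon(t)=\nabla\Phi_\mu(y(t)),$$ where $y(\cdot):[0,+\infty[\to\mathcal{H}$ is the unique strong global solution of the Cauchy problem $$\dot y(t)+\mu\nabla\Phi_\mu(y(t))+\mu\varepsilon(t)\,\mathrm{prox}_{\mu\Phi}(y(t))=0,\qquad y(0)=x_0+\mu\upsilon_0.$$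
   Context: $\partial\Phi$ denotes the convex subdifferential. $\mathrm{prox}_{\mu\Phi}=(I+\mu\partial\Phi)^{-1}$ is the proximal mapping (resolvent of $\partial\Phi$ of index $\mu$), and $\nabla\Phi_\mu=\frac{1}{\mu}(I-(I+\mu\partial\Phi)^{-1})$ is the gradient of the Moreau envelope $\Phi_\mu(y)=\inf_{x\in\mathcal{H}}\{\Phi(x)+\frac{1}{2\mu}\|y-x\|^2\}$ (Yosida approximation of $\partial\Phi$). A pair $(x(\cdot),\upsilon(\cdot))$ is a strong global solution of the first Cauchy problem iff: $x,\upsilon:[0,+\infty[\to\mathcal{H}$ are absolutely continuous on each interval $[0,b]$, $0<b<+\infty$; $\upsilon(t)\in\partial\Phi(x(t))$ for all $t\ge 0$; the differential equation holds for almost every $t\ge0$; and $x(0)=x_0$, $\upsilon(0)=\upsilon_0$. A strong global solution of the $y$-problem is a function absolutely continuous on each bounded interval $[0,b]$, satisfying the equation for almost every $t$ and the initial condition. *)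

theory Defs
  imports "HOL-Analysis.Analysis"
begin

definition proper_fun :: "('a \<Rightarrow> ereal) \<Rightarrow> bool" where
  "proper_fun \<Phi> \<longleftrightarrow> (\<forall>x. \<Phi> x \<noteq> -\<infinity>) \<and> (\<exists>x. \<Phi> x \<noteq> \<infinity>)"

definition convex_fun :: "('a::real_vector \<Rightarrow> ereal) \<Rightarrow> bool" where
  "convex_fun \<Phi> \<longleftrightarrow> (\<forall>x y t. 0 < t \<and> t < 1 \<longrightarrow>
      \<Phi> ((1 - t) *\<^sub>R x + t *\<^sub>R y) \<le> ereal (1 - t) * \<Phi> x + ereal t * \<Phi> y)"

definition lsc_fun :: "('a::topological_space \<Rightarrow> ereal) \<Rightarrow> bool" where
  "lsc_fun \<Phi> \<longleftrightarrow> (\<forall>x c. c < \<Phi> x \<longrightarrow> (\<forall>\<^sub>F y in nhds x. c < \<Phi> y))"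

definition subdiff :: "('a::real_inner \<Rightarrow> ereal) \<Rightarrow> 'a \<Rightarrow> 'a set" where
  "subdiff \<Phi> x = {v. \<bar>\<Phi> x\<bar> \<noteq> \<infinity> \<and> (\<forall>z. \<Phi> x + ereal (v \<bullet> (z - x)) \<le> \<Phi> z)}"

text \<open>Proximal mapping = resolvent (I + mu subdiff)^(-1):
  prox y is the point x with y \<in> x + mu * subdiff x.\<close>
definition prox :: "real \<Rightarrow> ('a::real_inner \<Rightarrow> ereal) \<Rightarrow> 'a \<Rightarrow> 'a" where
  "prox mu \<Phi> y = (THE x. (1 / mu) *\<^sub>R (y - x) \<in> subdiff \<Phi> x)"

text \<open>Gradient of the Moreau envelope (Yosida approximation).\<close>
definition moreau_grad :: "real \<Rightarrow> ('a::real_inner \<Rightarrow> ereal) \<Rightarrow> 'a \<Rightarrow> 'a" where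
  "moreau_grad mu \<Phi> y = (1 / mu) *\<^sub>R (y - prox mu \<Phi> y)"

definition abs_cont_on :: "(real \<Rightarrow> 'a::real_normed_vector) \<Rightarrow> real \<Rightarrow> real \<Rightarrow> bool" where
  "abs_cont_on f a b \<longleftrightarrow> (\<forall>e>0. \<exists>d>0. \<forall>(n::nat) (s::nat \<Rightarrow> real) (t::nat \<Rightarrow> real).
      (\<forall>k<n. a \<le> s k \<and> s k \<le> t k \<and> t k \<le> b) \<and>
      (\<forall>i<n. \<forall>j<n. i \<noteq> j \<longrightarrow> t i \<le> s j \<or> t j \<le> s i) \<and>
      (\<Sum>k<n. t k - s k) < d \<longrightarrow> (\<Sum>k<n. norm (f (t k) - f (s k))) < e)"

definition strong_sol_xv ::
  "('a::{real_inner,complete_space} \<Rightarrow> ereal) \<Rightarrow> real \<Rightarrow> (real \<Rightarrow> real) \<Rightarrow> 'a \<Rightarrow> 'a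
     \<Rightarrow> (real \<Rightarrow> 'a) \<Rightarrow> (real \<Rightarrow> 'a) \<Rightarrow> bool" where
  "strong_sol_xv \<Phi> lam \<epsilon> x0 v0 x v \<longleftrightarrow>
     (\<forall>b>0. abs_cont_on x 0 b \<and> abs_cont_on v 0 b) \<and>
     (\<forall>t\<ge>0. v t \<in> subdiff \<Phi> (x t)) \<and>
     (AE t in lborel. 0 \<le> t \<longrightarrow>
        (\<exists>x' v'. (x has_vector_derivative x') (at t within {0..}) \<and>
                 (v has_vector_derivative v') (at t within {0..}) \<and>
                 lam *\<^sub>R x' + v' + v t + \<epsilon> t *\<^sub>R x t = 0)) \<and>
     x 0 = x0 \<and> v 0 = v0"

definition strong_sol_y ::
  "('a::{real_inner,complete_space} \<Rightarrow> ereal) \<Rightarrow> real \<Rightarrow> (real \<Rightarrow> real) \<Rightarrow> 'a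
     \<Rightarrow> (real \<Rightarrow> 'a) \<Rightarrow> bool" where
  "strong_sol_y \<Phi> mu \<epsilon> y0 y \<longleftrightarrow>
     (\<forall>b>0. abs_cont_on y 0 b) \<and>
     (AE t in lborel. 0 \<le> t \<longrightarrow>
        (\<exists>y'. (y has_vector_derivative y') (at t within {0..}) \<and>
              y' + mu *\<^sub>R moreau_grad mu \<Phi> (y t)
                 + (mu * \<epsilon> t) *\<^sub>R prox mu \<Phi> (y t) = 0)) \<and>
     y 0 = y0"

end

theory Submission
  imports Defs
begin

text \<open>Minty's parametrization \<open>y = x + mu v\<close> of the graph of the subdifferential turns the
  differential inclusion into the ordinary differential equation
  \<open>y' = J y - y - mu \<epsilon>(t) J y\<close> with \<open>J = prox mu \<Phi>\<close>; both \<open>J\<close> and \<open>I - J\<close> are nonexpansive, so its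
  right-hand side is Lipschitz in \<open>y\<close> with the locally integrable constant \<open>(1 + mu) (1 + \<epsilon>(t))\<close>, and
  the Picard map is a contraction in a norm weighted by the exponential of
  \<open>clock t = t + \<integral>\<^sub>0\<^sup>t \<epsilon>\<close>. Both \<open>x = J y\<close> and \<open>v = (y - x) / mu\<close> are Lipschitz with respect to the clock,
  so a change of time reduces their differentiability almost everywhere to that of Lipschitz
  curves in a Hilbert space, which is proved by \<open>L\<^sup>2\<close> martingale convergence of the difference
  quotients along dyadic meshes.\<close>

section \<open>The proximal mapping\<close>

text \<open>The solution concept asks for derivatives of \<open>x\<close> and \<open>v\<close>
  separately, whereas the equation only controls \<open>lam x + v\<close>, a multiple of
  \<open>y\<close>. Since \<open>J\<close> is merely Lipschitz, differentiability of
  \<open>x = J y\<close> cannot come from a chain rule, and in infinite dimension it cannot be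
  checked coordinatewise. The Hilbert structure matters here: in a general Banach space a Lipschitz
  curve can be nowhere differentiable. As \<open>\<epsilon>\<close> is only integrable, the
  right-hand side is not continuous in time, so the equation is solved in integral form. Going from
  there to a strong solution takes a differentiation theorem for the primitive of
  \<open>\<epsilon>\<close> times a continuous curve; going back, for uniqueness, takes the
  fundamental theorem of calculus for absolutely continuous curves. Uniqueness of the pair is no
  separate problem: \<open>x + mu v\<close> of any solution pair solves the equation for
  \<open>y\<close>, and \<open>J\<close> recovers the pair from it.\<close>

lemma subdiff_monotone:
  fixes x y :: "'a::real_inner"
  assumes "v \<in> subdiff \<Phi> x" "w \<in> subdiff \<Phi> y"
  shows "0 \<le> (v - w) \<bullet> (x - y)"
proof -
  obtain a b where ab: "\<Phi> x = ereal a" "\<Phi> y = ereal b"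
    using assms by (auto simp: subdiff_def)
  have "\<Phi> x + ereal (v \<bullet> (y - x)) \<le> \<Phi> y" "\<Phi> y + ereal (w \<bullet> (x - y)) \<le> \<Phi> x"
    using assms by (auto simp: subdiff_def)
  then show ?thesis
    by (simp add: ab inner_diff_left inner_diff_right)
qed

text \<open>Monotonicity applied to the subgradients \<open>(y - p) / mu\<close> and
  \<open>(z - q) / mu\<close>. This one inequality yields uniqueness of the resolvent and the
  Lipschitz bounds for both \<open>J\<close> and \<open>I - J\<close>.\<close>

lemma resolvent_firmly_nonexpansive:
  fixes y z :: "'a::real_inner"
  assumes "mu > 0" "(1 / mu) *\<^sub>R (y - p) \<in> subdiff \<Phi> p" "(1 / mu) *\<^sub>R (z - q) \<in> subdiff \<Phi> q"
  shows "(norm (p - q))\<^sup>2 \<le> (y - z) \<bullet> (p - q)"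
proof -
  have "0 \<le> ((1 / mu) *\<^sub>R (y - p) - (1 / mu) *\<^sub>R (z - q)) \<bullet> (p - q)"
    using assms by (intro subdiff_monotone)
  also have "\<dots> = (1 / mu) * (((y - z) - (p - q)) \<bullet> (p - q))"
    by (simp add: algebra_simps flip: scaleR_diff_right)
  finally show ?thesis
    using \<open>mu > 0\<close> by (simp add: zero_le_divide_iff inner_diff_left power2_norm_eq_inner)
qed

lemma resolvent_unique:
  fixes y :: "'a::real_inner"
  assumes "mu > 0" "(1 / mu) *\<^sub>R (y - p) \<in> subdiff \<Phi> p" "(1 / mu) *\<^sub>R (y - q) \<in> subdiff \<Phi> q"
  shows "p = q"
  using resolvent_firmly_nonexpansive[OF assms] by simp

lemma parallelogram_midpoint:
  fixes a b :: "'a::real_inner"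
  shows "(norm ((1/2) *\<^sub>R (a + b)))\<^sup>2 = (norm a)\<^sup>2 / 2 + (norm b)\<^sup>2 / 2 - (norm (a - b))\<^sup>2 / 4"
  by (simp add: power2_norm_eq_inner inner_add_left inner_add_right inner_diff_left inner_diff_right
      inner_commute field_simps)

lemma norm_add_scaleR_power2:
  fixes a b :: "'a::real_inner"
  shows "(norm (a + c *\<^sub>R b))\<^sup>2 = (norm a)\<^sup>2 + 2 * c * (a \<bullet> b) + c\<^sup>2 * (norm b)\<^sup>2"
  unfolding power2_norm_eq_inner
  by (simp add: inner_add_left inner_add_right inner_commute power2_eq_square algebra_simps)

lemma convex_real_of_ereal:
  assumes "proper_fun \<Phi>" "convex_fun \<Phi>" "\<Phi> a \<noteq> \<infinity>" "\<Phi> b \<noteq> \<infinity>" "0 < s" "s < 1"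
  shows "\<Phi> ((1 - s) *\<^sub>R a + s *\<^sub>R b) \<noteq> \<infinity>"
    "real_of_ereal (\<Phi> ((1 - s) *\<^sub>R a + s *\<^sub>R b))
      \<le> (1 - s) * real_of_ereal (\<Phi> a) + s * real_of_ereal (\<Phi> b)"
proof -
  obtain u v where uv: "\<Phi> a = ereal u" "\<Phi> b = ereal v"
    using assms unfolding proper_fun_def by (metis ereal_cases)
  have "\<Phi> ((1 - s) *\<^sub>R a + s *\<^sub>R b) \<le> ereal ((1 - s) * u + s * v)"
    using assms unfolding convex_fun_def by (metis uv times_ereal.simps(1) plus_ereal.simps(1))
  moreover have "\<Phi> ((1 - s) *\<^sub>R a + s *\<^sub>R b) \<noteq> -\<infinity>"
    using assms unfolding proper_fun_def by blast
  ultimately show "\<Phi> ((1 - s) *\<^sub>R a + s *\<^sub>R b) \<noteq> \<infinity>"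
    "real_of_ereal (\<Phi> ((1 - s) *\<^sub>R a + s *\<^sub>R b))
      \<le> (1 - s) * real_of_ereal (\<Phi> a) + s * real_of_ereal (\<Phi> b)"
    by (cases "\<Phi> ((1 - s) *\<^sub>R a + s *\<^sub>R b)"; auto simp: uv)+
qed

text \<open>A minimizing sequence controls only the sum of \<open>\<Phi>\<close> and the quadratic
  term, so convergence is assumed for the sum, and \<open>g\<close> is subtracted again before lower
  semicontinuity is used.\<close>

lemma lsc_real_limit:
  assumes "proper_fun \<Phi>" "lsc_fun \<Phi>" "z \<longlonglongrightarrow> l" "\<And>n::nat. \<Phi> (z n) \<noteq> \<infinity>"
    "(\<lambda>n. real_of_ereal (\<Phi> (z n)) + g n) \<longlonglongrightarrow> c" "g \<longlonglongrightarrow> d"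
  shows "\<Phi> l \<noteq> \<infinity>" "real_of_ereal (\<Phi> l) + d \<le> c"
proof -
  have *: "\<Phi> l \<le> ereal (c - d)"
  proof (rule ccontr)
    assume "\<not> \<Phi> l \<le> ereal (c - d)"
    then have "ereal (c - d) < \<Phi> l" by simp
    then obtain r where r: "c - d < r" "ereal r < \<Phi> l"
      using ereal_dense2 by fastforce
    then have "\<forall>\<^sub>F y in nhds l. ereal r < \<Phi> y"
      using assms(2) unfolding lsc_fun_def by blast
    then have "\<forall>\<^sub>F n in sequentially. ereal r < \<Phi> (z n)"
      using assms(3) by (rule eventually_compose_filterlim)
    then have "\<forall>\<^sub>F n in sequentially. r \<le> real_of_ereal (\<Phi> (z n)) + g n - g n"
    proof eventually_elim
      case (elim n)
      then show ?case using assms(4)[of n] by (cases "\<Phi> (z n)") auto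
    qed
    moreover have "(\<lambda>n. real_of_ereal (\<Phi> (z n)) + g n - g n) \<longlonglongrightarrow> c - d"
      using assms by (intro tendsto_intros)
    ultimately have "r \<le> c - d"
      by (intro tendsto_lowerbound[OF _ _ trivial_limit_sequentially])
    then show False using r by simp
  qed
  then show "\<Phi> l \<noteq> \<infinity>" by auto
  have "\<Phi> l \<noteq> -\<infinity>" using assms unfolding proper_fun_def by blast
  with * show "real_of_ereal (\<Phi> l) + d \<le> c"
    by (cases "\<Phi> l") auto
qed

text \<open>Division by \<open>s\<close> and the limit at 0 from the right. It extracts the
  first-order optimality condition from minimality along a segment, without differentiating
  \<open>\<Phi>\<close>.\<close>

lemma le_of_quadratic_perturbation:
  fixes a c :: real
  assumes "\<And>s. 0 < s \<Longrightarrow> s < 1 \<Longrightarrow> 0 \<le> s * a + s\<^sup>2 * c"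
  shows "0 \<le> a"
proof (rule tendsto_lowerbound)
  show "((\<lambda>s. a + s * c) \<longlongrightarrow> a) (at_right 0)"
    by (auto intro!: tendsto_eq_intros)
  have "\<forall>\<^sub>F s in at_right 0. s < (1::real)" "\<forall>\<^sub>F s in at_right 0. (0::real) < s"
    by (auto simp: eventually_at_right_less intro: order_tendstoD)
  then show "\<forall>\<^sub>F s in at_right 0. 0 \<le> a + s * c"
  proof eventually_elim
    case (elim s)
    have "0 \<le> s * (a + s * c)"
      using assms[of s] elim by (simp add: power2_eq_square algebra_simps)
    then show ?case using elim by (simp add: zero_le_mult_iff)
  qed
qed simp

text \<open>A minimizing sequence of \<open>\<Phi> + |y - \<cdot>|\<^sup>2 / (2 mu)\<close> is Cauchy by strong convexity; the
  subgradient at \<open>x0\<close> supplies the affine minorant that bounds this function from below.\<close>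

lemma resolvent_exists:
  fixes \<Phi> :: "'a::{real_inner,complete_space} \<Rightarrow> ereal"
  assumes pr: "proper_fun \<Phi>" and cv: "convex_fun \<Phi>" and ls: "lsc_fun \<Phi>"
    and mu: "mu > 0" and v0: "v0 \<in> subdiff \<Phi> x0"
  shows "\<exists>p. (1 / mu) *\<^sub>R (y - p) \<in> subdiff \<Phi> p"
proof -
  define \<phi> where "\<phi> = (\<lambda>x. real_of_ereal (\<Phi> x))"
  define D where "D = {x. \<Phi> x \<noteq> \<infinity>}"
  define q where "q = (\<lambda>x. \<phi> x + (norm (y - x))\<^sup>2 / (2 * mu))"
  define m where "m = Inf (q ` D)"
  have \<Phi>: "\<Phi> x = ereal (\<phi> x)" if "x \<in> D" for x
    using pr that unfolding proper_fun_def D_def \<phi>_def by (cases "\<Phi> x") auto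
  have x0: "x0 \<in> D" using v0 by (auto simp: subdiff_def D_def)
  have minor: "\<phi> x0 + v0 \<bullet> (x - x0) \<le> \<phi> x" if "x \<in> D" for x
    using v0 \<Phi>[OF that] \<Phi>[OF x0] unfolding subdiff_def
    by simp (metis ereal_less_eq(3) plus_ereal.simps(1))
  have low: "\<phi> x0 + v0 \<bullet> (y - x0) - mu / 2 * (norm v0)\<^sup>2 \<le> q x" if "x \<in> D" for x
  proof -
    \<comment> \<open>Completing the square:
      \<open>v0 \<bullet> x + |y - x|\<^sup>2 / (2 mu)\<close> is smallest at
      \<open>x = y - mu v0\<close>, which produces the constant
      \<open>mu / 2 * |v0|\<^sup>2\<close>.\<close>
    have "0 \<le> (norm ((y - x) + (- mu) *\<^sub>R v0))\<^sup>2 / (2 * mu)"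
      using mu by simp
    also have "\<dots> = (norm (y - x))\<^sup>2 / (2 * mu) - (y - x) \<bullet> v0 + mu / 2 * (norm v0)\<^sup>2"
      unfolding norm_add_scaleR_power2 using mu by (simp add: field_simps power2_eq_square)
    finally have "0 \<le> (norm (y - x))\<^sup>2 / (2 * mu) - (y - x) \<bullet> v0 + mu / 2 * (norm v0)\<^sup>2" .
    moreover have "(y - x) \<bullet> v0 = v0 \<bullet> (y - x0) - v0 \<bullet> (x - x0)"
      by (simp add: inner_diff_right inner_diff_left inner_commute)
    ultimately show ?thesis using minor[OF that] unfolding q_def by linarith
  qed
  then have bdd: "bdd_below (q ` D)" by (intro bdd_belowI2)
  have m_le: "m \<le> q x" if "x \<in> D" for x
    unfolding m_def using bdd that by (intro cINF_lower)
  have "\<exists>x\<in>D. q x < m + 1 / Suc n" for n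
    using cInf_lessD[of "q ` D" "m + 1 / Suc n"] x0 unfolding m_def by auto
  then obtain z where z: "\<And>n. z n \<in> D" "\<And>n. q (z n) < m + 1 / Suc n" by metis
  \<comment> \<open>The value at the midpoint of \<open>a\<close> and \<open>b\<close> is not below
    \<open>m\<close>, so the gap left by the parallelogram identity is at most the mean excess of
    \<open>q a\<close> and \<open>q b\<close> over \<open>m\<close>.\<close>
  have close: "(norm (a - b))\<^sup>2 \<le> 4 * mu * ((q a - m) + (q b - m))" if "a \<in> D" "b \<in> D" for a b
  proof -
    let ?c = "(1 - 1/2) *\<^sub>R a + (1/2) *\<^sub>R b"
    have c: "?c \<in> D" "\<phi> ?c \<le> (1 - 1/2) * \<phi> a + 1/2 * \<phi> b"
      using convex_real_of_ereal[OF pr cv, of a b "1/2"] that by (auto simp: D_def \<phi>_def)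
    have "y - ?c = (1/2) *\<^sub>R ((y - a) + (y - b))"
      by (simp add: algebra_simps flip: scaleR_2 scaleR_add_right)
    then have "(norm (y - ?c))\<^sup>2 = (norm (y - a))\<^sup>2 / 2 + (norm (y - b))\<^sup>2 / 2 - (norm (a - b))\<^sup>2 / 4"
      by (simp only: parallelogram_midpoint) (simp add: norm_minus_commute)
    then have "q ?c = \<phi> ?c + ((norm (y - a))\<^sup>2 / 2 + (norm (y - b))\<^sup>2 / 2 - (norm (a - b))\<^sup>2 / 4) / (2 * mu)"
      by (simp only: q_def)
    also have "\<dots> \<le> q a / 2 + q b / 2 - (norm (a - b))\<^sup>2 / (8 * mu)"
      using c mu unfolding q_def by (simp add: add_divide_distrib diff_divide_distrib)
    finally have "(norm (a - b))\<^sup>2 / (8 * mu) \<le> ((q a - m) + (q b - m)) / 2"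
      using m_le[OF c(1)] by argo
    then show ?thesis using mu by (simp add: field_simps)
  qed
  have "Cauchy z"
  proof (rule metric_CauchyI)
    fix e :: real assume e: "e > 0"
    \<comment> \<open>The factor is \<open>4 * mu\<close> from \<open>close\<close> times two
      excesses, each below \<open>1 / Suc M\<close>.\<close>
    have "(\<lambda>n. 8 * mu * (1 / Suc n)) \<longlonglongrightarrow> 8 * mu * 0"
      using LIMSEQ_inverse_real_of_nat by (intro tendsto_intros) (simp add: inverse_eq_divide)
    then have "\<forall>\<^sub>F n in sequentially. 8 * mu * (1 / Suc n) < e\<^sup>2"
      using e by (intro order_tendstoD) auto
    then obtain M where M: "8 * mu * (1 / Suc M) < e\<^sup>2"
      by (auto simp: eventually_sequentially)
    show "\<exists>M. \<forall>i\<ge>M. \<forall>n\<ge>M. dist (z i) (z n) < e"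
    proof (intro exI allI impI)
      fix i n assume "M \<le> i" "M \<le> n"
      then have "1 / Suc i \<le> 1 / Suc M" "1 / Suc n \<le> 1 / Suc M"
        by (auto simp: field_simps)
      then have "(q (z i) - m) + (q (z n) - m) \<le> 2 * (1 / Suc M)"
        using z(2)[of i] z(2)[of n] by linarith
      then have "4 * mu * ((q (z i) - m) + (q (z n) - m)) \<le> 4 * mu * (2 * (1 / Suc M))"
        using mu by (intro mult_left_mono) auto
      then have "(norm (z i - z n))\<^sup>2 < e\<^sup>2"
        using close[OF z(1) z(1), of i n] M by simp
      then show "dist (z i) (z n) < e"
        using e by (simp add: dist_norm power_less_imp_less_base)
    qed
  qed
  then obtain p where p: "z \<longlonglongrightarrow> p" using Cauchy_convergent convergent_def by blast
  have "(q \<circ> z) \<longlonglongrightarrow> m"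
  proof (rule tendsto_sandwich[where f = "\<lambda>_. m" and h = "\<lambda>n. m + 1 / real (Suc n)"])
    show "(\<lambda>n. m + 1 / Suc n) \<longlonglongrightarrow> m"
      using tendsto_add[OF tendsto_const LIMSEQ_inverse_real_of_nat, of m]
      by (simp add: inverse_eq_divide)
    show "\<forall>\<^sub>F n in sequentially. m \<le> (q \<circ> z) n" "\<forall>\<^sub>F n in sequentially. (q \<circ> z) n \<le> m + 1 / Suc n"
      using z m_le by (auto intro: less_imp_le always_eventually)
  qed simp
  then have "(\<lambda>n. real_of_ereal (\<Phi> (z n)) + (norm (y - z n))\<^sup>2 / (2 * mu)) \<longlonglongrightarrow> m"
    by (simp add: q_def \<phi>_def o_def)
  moreover have "(\<lambda>n. (norm (y - z n))\<^sup>2 / (2 * mu)) \<longlonglongrightarrow> (norm (y - p))\<^sup>2 / (2 * mu)"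
    using p mu by (intro tendsto_intros) auto
  ultimately have pD: "p \<in> D" and qp: "q p \<le> m"
    using lsc_real_limit[OF pr ls p] z(1) by (auto simp: D_def q_def \<phi>_def)
  have "\<phi> p + ((1 / mu) *\<^sub>R (y - p)) \<bullet> (w - p) \<le> \<phi> w" if w: "w \<in> D" for w
  proof -
    \<comment> \<open>Compares \<open>p\<close> with the point \<open>(1 - s) p + s w\<close>:
      convexity bounds \<open>\<phi>\<close> there by the chord, and the square contributes a term
      linear in \<open>s\<close> and a remainder of order \<open>s\<^sup>2\<close>.\<close>
    have "0 \<le> s * (\<phi> w - \<phi> p - (y - p) \<bullet> (w - p) / mu) + s\<^sup>2 * ((norm (w - p))\<^sup>2 / (2 * mu))"
      if s: "0 < s" "s < 1" for s
    proof -
      let ?c = "(1 - s) *\<^sub>R p + s *\<^sub>R w"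
      have c: "?c \<in> D" "\<phi> ?c \<le> (1 - s) * \<phi> p + s * \<phi> w"
        using convex_real_of_ereal[OF pr cv, of p w s] pD w s by (auto simp: D_def \<phi>_def)
      have "y - ?c = (y - p) + (- s) *\<^sub>R (w - p)" by (simp add: algebra_simps)
      then have "(norm (y - ?c))\<^sup>2 = (norm (y - p))\<^sup>2 + 2 * (- s) * ((y - p) \<bullet> (w - p)) + (- s)\<^sup>2 * (norm (w - p))\<^sup>2"
        by (simp only: norm_add_scaleR_power2)
      then have "q ?c = \<phi> ?c + ((norm (y - p))\<^sup>2 + 2 * (- s) * ((y - p) \<bullet> (w - p)) + (- s)\<^sup>2 * (norm (w - p))\<^sup>2) / (2 * mu)"
        by (simp only: q_def)
      moreover have "q p \<le> q ?c" using qp m_le[OF c(1)] by linarith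
      ultimately show ?thesis
        using c(2) unfolding q_def
        by (simp add: add_divide_distrib diff_divide_distrib algebra_simps)
    qed
    then have "0 \<le> \<phi> w - \<phi> p - (y - p) \<bullet> (w - p) / mu"
      by (rule le_of_quadratic_perturbation)
    then show ?thesis by simp
  qed
  moreover have "\<Phi> p + ereal (((1 / mu) *\<^sub>R (y - p)) \<bullet> (w - p)) \<le> \<Phi> w"
    if "\<And>w. w \<in> D \<Longrightarrow> \<phi> p + ((1 / mu) *\<^sub>R (y - p)) \<bullet> (w - p) \<le> \<phi> w" for w
  proof (cases "w \<in> D")
    case True
    then show ?thesis using that \<Phi>[OF True] \<Phi>[OF pD] by simp
  next
    case False
    then show ?thesis by (simp add: D_def)
  qed
  moreover have "\<bar>\<Phi> p\<bar> \<noteq> \<infinity>" using \<Phi>[OF pD] by simp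
  ultimately have "(1 / mu) *\<^sub>R (y - p) \<in> subdiff \<Phi> p"
    unfolding subdiff_def by blast
  then show ?thesis ..
qed

text \<open>\<open>resolvent_exists\<close> and \<open>resolvent_unique\<close> together make the
  \<open>THE\<close> in \<open>prox\<close> meaningful; after unfolding, \<open>moreau_grad\<close>
  is exactly the subgradient in its specification.\<close>

lemma prox_subdiff:
  fixes \<Phi> :: "'a::{real_inner,complete_space} \<Rightarrow> ereal"
  assumes "proper_fun \<Phi>" "convex_fun \<Phi>" "lsc_fun \<Phi>" "mu > 0" "v0 \<in> subdiff \<Phi> x0"
  shows "moreau_grad mu \<Phi> y \<in> subdiff \<Phi> (prox mu \<Phi> y)"
  unfolding moreau_grad_def prox_def
  by (rule theI') (use resolvent_exists[OF assms] resolvent_unique[OF \<open>mu > 0\<close>] in blast)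

text \<open>The inverse of Minty's parametrization. It provides the initial values and turns any
  solution pair into a solution of the equation for \<open>y\<close>.\<close>

lemma prox_eqI:
  fixes x :: "'a::real_inner"
  assumes "mu > 0" "v \<in> subdiff \<Phi> x"
  shows "prox mu \<Phi> (x + mu *\<^sub>R v) = x" "moreau_grad mu \<Phi> (x + mu *\<^sub>R v) = v"
proof -
  show *: "prox mu \<Phi> (x + mu *\<^sub>R v) = x"
    unfolding prox_def using assms
    by (intro the_equality) (auto intro: resolvent_unique[OF \<open>mu > 0\<close>])
  show "moreau_grad mu \<Phi> (x + mu *\<^sub>R v) = v"
    unfolding moreau_grad_def * using assms by simp
qed

text \<open>The first bound is firm nonexpansiveness with Cauchy-Schwarz. For the second, with
  \<open>a = y - z\<close> and \<open>p\<close> the difference of the proximal points, \<open>|a -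
  p|\<^sup>2 = |a|\<^sup>2 - 2 (a \<bullet> p) + |p|\<^sup>2\<close> and
  \<open>0 \<le> |p|\<^sup>2 \<le> a \<bullet> p\<close>.\<close>

lemma prox_nonexpansive:
  fixes \<Phi> :: "'a::{real_inner,complete_space} \<Rightarrow> ereal"
  assumes "proper_fun \<Phi>" "convex_fun \<Phi>" "lsc_fun \<Phi>" "mu > 0" "v0 \<in> subdiff \<Phi> x0"
  shows "norm (prox mu \<Phi> y - prox mu \<Phi> z) \<le> norm (y - z)"
    and "norm ((y - prox mu \<Phi> y) - (z - prox mu \<Phi> z)) \<le> norm (y - z)"
proof -
  let ?p = "prox mu \<Phi> y - prox mu \<Phi> z"
  have firm: "(norm ?p)\<^sup>2 \<le> (y - z) \<bullet> ?p"
    using resolvent_firmly_nonexpansive[OF \<open>mu > 0\<close>] prox_subdiff[OF assms]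
    unfolding moreau_grad_def by blast
  also have "\<dots> \<le> norm (y - z) * norm ?p"
    by (rule norm_cauchy_schwarz)
  finally show "norm ?p \<le> norm (y - z)"
    by (cases "norm ?p = 0") (auto simp: power2_eq_square)
  have "(norm ((y - z) + (-1) *\<^sub>R ?p))\<^sup>2 \<le> (norm (y - z))\<^sup>2"
    unfolding norm_add_scaleR_power2 using firm order_trans[OF zero_le_power2 firm] by simp
  then have "norm ((y - z) + (-1) *\<^sub>R ?p) \<le> norm (y - z)"
    using norm_ge_zero power2_le_imp_le by blast
  moreover have "(y - z) + (-1) *\<^sub>R ?p = (y - prox mu \<Phi> y) - (z - prox mu \<Phi> z)"
    by (simp add: algebra_simps)
  ultimately show "norm ((y - prox mu \<Phi> y) - (z - prox mu \<Phi> z)) \<le> norm (y - z)" by (simp only:)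
qed

section \<open>Absolutely continuous functions\<close>

text \<open>The solution concepts use \<open>AE\<close> over \<open>lborel\<close>, the integration
  theorems use negligible sets of the completed measure. A null set of the completion lies in a
  Borel null set, so one may pass back and forth with this and the next lemma.\<close>

lemma negligible_imp_AE_lborel:
  assumes "negligible N" "\<And>t. t \<notin> N \<Longrightarrow> P t"
  shows "AE t in lborel. P t"
proof -
  have "AE t in lebesgue. P t"
    using assms by (intro AE_I'[of N]) (auto simp: negligible_iff_null_sets)
  then show ?thesis
    by (simp add: AE_completion_iff)
qed

lemma AE_lborel_obtain_negligible:
  assumes "AE t in lborel. P t"
  obtains N where "negligible N" "\<And>t. t \<notin> N \<Longrightarrow> P t"
proof -
  obtain N where N: "\<And>t. t \<in> space lborel - N \<Longrightarrow> P t" "N \<in> null_sets lborel"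
    using AE_E3[OF assms] by blast
  show ?thesis
  proof (rule that)
    show "negligible N"
      using N(2) by (simp add: negligible_iff_null_sets null_sets_completionI)
    show "\<And>t. t \<notin> N \<Longrightarrow> P t"
      using N(1) by simp
  qed
qed

text \<open>In this form a derivative involves only norms of increments, which suits the gauge
  estimates and makes the later transfer along an isometry immediate.\<close>

lemma has_vector_derivative_iff_bound:
  fixes f :: "real \<Rightarrow> 'a::real_normed_vector"
  shows "(f has_vector_derivative D) (at t within S) \<longleftrightarrow>
    (\<forall>e>0. \<exists>d>0. \<forall>s\<in>S. \<bar>s - t\<bar> < d \<longrightarrow> norm (f s - f t - (s - t) *\<^sub>R D) \<le> e * \<bar>s - t\<bar>)"
  unfolding has_vector_derivative_def has_derivative_within_alt
  by (auto simp: bounded_linear_scaleR_left)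

text \<open>\<open>abs_cont_on\<close> numbers its intervals by \<open>{..<n}\<close>; a bijection
  admits arbitrary finite index sets, such as the tagged cells of a division.\<close>

lemma abs_cont_on_sum_finite:
  fixes f :: "real \<Rightarrow> 'a::real_normed_vector"
  assumes "abs_cont_on f a b" "e > 0"
  shows "\<exists>d>0. \<forall>(I::'i set) s t. finite I \<and> (\<forall>k\<in>I. a \<le> s k \<and> s k \<le> t k \<and> t k \<le> b) \<and>
      (\<forall>i\<in>I. \<forall>j\<in>I. i \<noteq> j \<longrightarrow> t i \<le> s j \<or> t j \<le> s i) \<and>
      (\<Sum>k\<in>I. t k - s k) < d \<longrightarrow> (\<Sum>k\<in>I. norm (f (t k) - f (s k))) < e"
proof -
  obtain d where d: "d > 0" and ac:
    "\<forall>(n::nat) s t. (\<forall>k<n. a \<le> s k \<and> s k \<le> t k \<and> t k \<le> b) \<and>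
      (\<forall>i<n. \<forall>j<n. i \<noteq> j \<longrightarrow> t i \<le> s j \<or> t j \<le> s i) \<and>
      (\<Sum>k<n. t k - s k) < d \<longrightarrow> (\<Sum>k<n. norm (f (t k) - f (s k))) < e"
    using assms(1)[unfolded abs_cont_on_def, rule_format, OF assms(2)] by blast
  show ?thesis
  proof (intro exI conjI allI impI)
    show "d > 0" by (rule d)
    fix I :: "'i set" and s t
    assume "finite I \<and> (\<forall>k\<in>I. a \<le> s k \<and> s k \<le> t k \<and> t k \<le> b) \<and>
      (\<forall>i\<in>I. \<forall>j\<in>I. i \<noteq> j \<longrightarrow> t i \<le> s j \<or> t j \<le> s i) \<and> (\<Sum>k\<in>I. t k - s k) < d"
    then have I: "finite I" "\<And>k. k \<in> I \<Longrightarrow> a \<le> s k \<and> s k \<le> t k \<and> t k \<le> b"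
      "\<And>i j. i \<in> I \<Longrightarrow> j \<in> I \<Longrightarrow> i \<noteq> j \<Longrightarrow> t i \<le> s j \<or> t j \<le> s i"
      "(\<Sum>k\<in>I. t k - s k) < d"
      by auto
    obtain h where h: "bij_betw h {..<card I} I"
      using I(1) by (metis ex_bij_betw_nat_finite atLeast0LessThan)
    have "(\<Sum>k<card I. norm (f ((t \<circ> h) k) - f ((s \<circ> h) k))) < e"
    proof (rule ac[rule_format], intro conjI)
      show "\<forall>k<card I. a \<le> (s \<circ> h) k \<and> (s \<circ> h) k \<le> (t \<circ> h) k \<and> (t \<circ> h) k \<le> b"
        using I(2) h by (auto simp: bij_betw_def)
      show "\<forall>i<card I. \<forall>j<card I. i \<noteq> j \<longrightarrow> (t \<circ> h) i \<le> (s \<circ> h) j \<or> (t \<circ> h) j \<le> (s \<circ> h) i"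
        using I(3) bij_betw_apply[OF h] bij_betw_imp_inj_on[OF h]
        by (metis comp_apply inj_on_eq_iff lessThan_iff)
      show "(\<Sum>k<card I. (t \<circ> h) k - (s \<circ> h) k) < d"
        using I(4) sum.reindex_bij_betw[OF h, of "\<lambda>k. t k - s k"] by simp
    qed
    then show "(\<Sum>k\<in>I. norm (f (t k) - f (s k))) < e"
      using sum.reindex_bij_betw[OF h, of "\<lambda>k. norm (f (t k) - f (s k))"] by simp
  qed
qed

lemma abs_cont_on_dominated:
  fixes f :: "real \<Rightarrow> 'a::real_normed_vector" and g :: "real \<Rightarrow> 'b::real_normed_vector"
  assumes "abs_cont_on g a b" "C \<ge> 0"
    and le: "\<And>s t. a \<le> s \<Longrightarrow> s \<le> t \<Longrightarrow> t \<le> b \<Longrightarrow> norm (f t - f s) \<le> C * norm (g t - g s)"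
  shows "abs_cont_on f a b"
  unfolding abs_cont_on_def
proof (intro allI impI)
  fix e :: real assume "e > 0"
  \<comment> \<open>\<open>C + 1\<close> also covers \<open>C = 0\<close> and makes the final bound
    \<open>C * (e / (C + 1)) < e\<close> strict.\<close>
  then have "e / (C + 1) > 0" using assms by simp
  then obtain d where d: "d > 0" and ac:
    "\<forall>(n::nat) s t. (\<forall>k<n. a \<le> s k \<and> s k \<le> t k \<and> t k \<le> b) \<and>
      (\<forall>i<n. \<forall>j<n. i \<noteq> j \<longrightarrow> t i \<le> s j \<or> t j \<le> s i) \<and>
      (\<Sum>k<n. t k - s k) < d \<longrightarrow> (\<Sum>k<n. norm (g (t k) - g (s k))) < e / (C + 1)"
    using assms(1)[unfolded abs_cont_on_def, rule_format, of "e / (C + 1)"] by blast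
  show "\<exists>d>0. \<forall>n s t. (\<forall>k<n. a \<le> s k \<and> s k \<le> t k \<and> t k \<le> b) \<and>
      (\<forall>i<n. \<forall>j<n. i \<noteq> j \<longrightarrow> t i \<le> s j \<or> t j \<le> s i) \<and>
      (\<Sum>k<n. t k - s k) < d \<longrightarrow> (\<Sum>k<n::nat. norm (f (t k) - f (s k))) < e"
  proof (intro exI conjI allI impI)
    fix n :: nat and s t :: "nat \<Rightarrow> real"
    assume *: "(\<forall>k<n. a \<le> s k \<and> s k \<le> t k \<and> t k \<le> b) \<and>
      (\<forall>i<n. \<forall>j<n. i \<noteq> j \<longrightarrow> t i \<le> s j \<or> t j \<le> s i) \<and> (\<Sum>k<n. t k - s k) < d"
    have "(\<Sum>k<n. norm (f (t k) - f (s k))) \<le> (\<Sum>k<n. C * norm (g (t k) - g (s k)))"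
      using * by (intro sum_mono le) auto
    also have "\<dots> = C * (\<Sum>k<n. norm (g (t k) - g (s k)))" by (simp add: sum_distrib_left)
    also have "\<dots> \<le> C * (e / (C + 1))"
      using ac[rule_format, OF *] assms by (intro mult_left_mono) auto
    also have "\<dots> < e" using assms \<open>e > 0\<close> by (simp add: field_simps)
    finally show "(\<Sum>k<n. norm (f (t k) - f (s k))) < e" .
  qed (rule d)
qed

lemma abs_cont_on_add:
  fixes f g :: "real \<Rightarrow> 'a::real_normed_vector"
  assumes "abs_cont_on f a b" "abs_cont_on g a b"
  shows "abs_cont_on (\<lambda>t. f t + g t) a b"
  unfolding abs_cont_on_def
proof (intro allI impI)
  fix e :: real assume "e > 0"
  let ?P = "\<lambda>d n s t. (\<forall>k<n. a \<le> s k \<and> s k \<le> t k \<and> t k \<le> b) \<and>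
      (\<forall>i<n. \<forall>j<n. i \<noteq> j \<longrightarrow> t i \<le> s j \<or> t j \<le> s i) \<and> (\<Sum>k<n::nat. t k - s k) < d"
  from \<open>e > 0\<close> have "e / 2 > 0" by simp
  then obtain d1 where d1: "d1 > 0" and ac1: "\<forall>n s t. ?P d1 n s t \<longrightarrow> (\<Sum>k<n. norm (f (t k) - f (s k))) < e / 2"
    using assms(1)[unfolded abs_cont_on_def, rule_format, of "e / 2"] by blast
  from \<open>e / 2 > 0\<close> obtain d2 where d2: "d2 > 0" and ac2: "\<forall>n s t. ?P d2 n s t \<longrightarrow> (\<Sum>k<n. norm (g (t k) - g (s k))) < e / 2"
    using assms(2)[unfolded abs_cont_on_def, rule_format, of "e / 2"] by blast
  show "\<exists>d>0. \<forall>n s t. ?P d n s t \<longrightarrow> (\<Sum>k<n. norm (f (t k) + g (t k) - (f (s k) + g (s k)))) < e"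
  proof (intro exI conjI allI impI)
    show "min d1 d2 > 0" using d1 d2 by simp
    fix n s t assume *: "?P (min d1 d2) n s t"
    have "(\<Sum>k<n. norm (f (t k) + g (t k) - (f (s k) + g (s k))))
      \<le> (\<Sum>k<n. norm (f (t k) - f (s k)) + norm (g (t k) - g (s k)))"
      by (intro sum_mono) (simp add: add_diff_add norm_triangle_ineq)
    also have "\<dots> < e"
      using ac1[rule_format, of n s t] ac2[rule_format, of n s t] * by (simp add: sum.distrib)
    finally show "(\<Sum>k<n. norm (f (t k) + g (t k) - (f (s k) + g (s k)))) < e" .
  qed
qed

lemma abs_cont_on_imp_continuous_on:
  fixes f :: "real \<Rightarrow> 'a::real_normed_vector"
  assumes "abs_cont_on f a b"
  shows "continuous_on {a..b} f"
  unfolding continuous_on_iff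
proof (intro ballI allI impI)
  fix x e :: real assume x: "x \<in> {a..b}" and "e > 0"
  obtain d where d: "d > 0" and small:
    "\<forall>(I::unit set) s t. finite I \<and> (\<forall>k\<in>I. a \<le> s k \<and> s k \<le> t k \<and> t k \<le> b) \<and>
      (\<forall>i\<in>I. \<forall>j\<in>I. i \<noteq> j \<longrightarrow> t i \<le> s j \<or> t j \<le> s i) \<and>
      (\<Sum>k\<in>I. t k - s k) < d \<longrightarrow> (\<Sum>k\<in>I. norm (f (t k) - f (s k))) < e"
    using abs_cont_on_sum_finite[OF assms \<open>e > 0\<close>] by blast
  \<comment> \<open>A single interval suffices: \<open>unit\<close> is the index type, and
    \<open>min\<close> and \<open>max\<close> put the endpoints in order.\<close>
  have "dist (f y) (f x) < e" if "y \<in> {a..b}" "dist y x < d" for y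
    using small[rule_format, of "UNIV" "\<lambda>_. min x y" "\<lambda>_. max x y"] x that
    by (cases "x \<le> y") (auto simp: dist_norm norm_minus_commute)
  then show "\<exists>d>0. \<forall>y\<in>{a..b}. dist y x < d \<longrightarrow> dist (f y) (f x) < e"
    using d by blast
qed

text \<open>Gauge argument: near a point of differentiability the gauge makes the increment of \<open>f\<close> close to
  its linear part, and the cells tagged in the exceptional set lie in an open set whose measure is
  below the modulus of absolute continuity.\<close>

theorem fundamental_theorem_of_calculus_abs_cont:
  fixes f :: "real \<Rightarrow> 'a::real_normed_vector"
  assumes ab: "a \<le> b" and ac: "abs_cont_on f a b" and N: "negligible N"
    and der: "\<And>t. t \<in> {a..b} - N \<Longrightarrow> (f has_vector_derivative f' t) (at t within {a..b})"
  shows "(f' has_integral (f b - f a)) {a..b}"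
proof -
  \<comment> \<open>With value 0 on \<open>N\<close>, the Riemann sum ignores the cells tagged
    there, and only the increments of \<open>f\<close> over them remain to be estimated.\<close>
  define g where "g = (\<lambda>t. if t \<in> N then 0 else f' t)"
  have "(g has_integral (f b - f a)) (cbox a b)"
    unfolding has_integral
  proof (intro allI impI)
    fix e :: real assume e: "e > 0"
    \<comment> \<open>Half of the error is spread over the length of the interval; the summand 1
      covers \<open>a = b\<close>.\<close>
    define e1 where "e1 = e / (2 * (b - a + 1))"
    have e1: "e1 > 0" using e ab by (simp add: e1_def)
    obtain d where d: "d > 0" and small:
      "\<forall>(I::(real \<times> real set) set) s t. finite I \<and> (\<forall>k\<in>I. a \<le> s k \<and> s k \<le> t k \<and> t k \<le> b) \<and>
        (\<forall>i\<in>I. \<forall>j\<in>I. i \<noteq> j \<longrightarrow> t i \<le> s j \<or> t j \<le> s i) \<and>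
        (\<Sum>k\<in>I. t k - s k) < d \<longrightarrow> (\<Sum>k\<in>I. norm (f (t k) - f (s k))) < e / 2"
      using abs_cont_on_sum_finite[OF ac half_gt_zero[OF e]] by blast
    have "N \<in> sets lebesgue" using N by (simp add: negligible_iff_null_sets null_setsD2)
    then obtain U where U: "open U" "N \<subseteq> U" "U - N \<in> lmeasurable" "emeasure lebesgue (U - N) < ennreal d"
      using sets_lebesgue_outer_open d by blast
    have UN: "U = (U - N) \<union> N" using U by blast
    have Nn: "N \<in> null_sets lebesgue" using N by (simp add: negligible_iff_null_sets)
    have Um: "U \<in> lmeasurable"
      using U(3) Nn UN by (metis negligible_iff_null_sets fmeasurable.Un negligible_imp_measurable)
    have "emeasure lebesgue U = emeasure lebesgue (U - N)"
      using Nn Um by (simp add: emeasure_Diff_null_set fmeasurableD)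
    then have "ennreal (measure lebesgue U) < ennreal d"
      using U(4) Um by (simp add: emeasure_eq_measure2)
    then have mU: "measure lebesgue U < d"
      using d by (simp add: ennreal_less_iff)
    define P where "P t r \<longleftrightarrow> r > 0 \<and> (t \<in> N \<longrightarrow> ball t r \<subseteq> U) \<and> (t \<in> {a..b} - N \<longrightarrow>
       (\<forall>s\<in>{a..b}. \<bar>s - t\<bar> < r \<longrightarrow> norm (f s - f t - (s - t) *\<^sub>R f' t) \<le> e1 * \<bar>s - t\<bar>))" for t r
    have "\<exists>r. P t r" for t
    proof -
      consider "t \<in> N" | "t \<in> {a..b} - N" | "t \<notin> N" "t \<notin> {a..b}" by blast
      then show ?thesis
      proof cases
        case 1
        then obtain r where "r > 0" "ball t r \<subseteq> U"
          using U(1,2) by (meson openE subsetD)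
        then show ?thesis using 1 by (intro exI[of _ r]) (simp add: P_def)
      next
        case 2
        then obtain r where "r > 0" "\<forall>s\<in>{a..b}. \<bar>s - t\<bar> < r \<longrightarrow> norm (f s - f t - (s - t) *\<^sub>R f' t) \<le> e1 * \<bar>s - t\<bar>"
          using der[OF 2, unfolded has_vector_derivative_iff_bound, rule_format, OF e1] by blast
        then show ?thesis using 2 by (intro exI[of _ r]) (simp add: P_def)
      next
        case 3
        then show ?thesis by (intro exI[of _ 1]) (auto simp: P_def)
      qed
    qed
    then obtain r where "\<And>t. P t (r t)" by metis
    note r = this[unfolded P_def]
    note r_pos = conjunct1[OF r] and r_U = conjunct1[OF conjunct2[OF r], rule_format]
      and r_der = conjunct2[OF conjunct2[OF r], rule_format]
    show "\<exists>\<gamma>. gauge \<gamma> \<and> (\<forall>\<D>. \<D> tagged_division_of cbox a b \<and> \<gamma> fine \<D> \<longrightarrow>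
        norm ((\<Sum>(x, k)\<in>\<D>. measure lborel k *\<^sub>R g x) - (f b - f a)) < e)"
    proof (intro exI[of _ "\<lambda>t. ball t (r t)"] conjI allI impI)
      show "gauge (\<lambda>t. ball t (r t))" using r_pos by (simp add: gauge_ball_dependent)
      fix p assume "p tagged_division_of cbox a b \<and> (\<lambda>t. ball t (r t)) fine p"
      then have p: "p tagged_division_of {a..b}" and fine: "(\<lambda>t. ball t (r t)) fine p" by auto
      note pD = tagged_division_ofD[OF p]
      have fin: "finite p" by (rule pD)
      have K: "K = {Inf K..Sup K}" "Inf K \<le> x" "x \<le> Sup K" "a \<le> Inf K" "Sup K \<le> b"
          "Inf K \<in> ball x (r x)" "Sup K \<in> ball x (r x)" "measure lborel K = Sup K - Inf K" "K \<subseteq> ball x (r x)"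
          if xK: "(x, K) \<in> p" for x K
      proof -
        obtain u v where uv: "K = {u..v}" using pD(4)[OF xK] by auto
        have x: "x \<in> K" "K \<subseteq> {a..b}" using pD xK by auto
        then have "u \<le> v" using uv by auto
        then have IS: "Inf K = u" "Sup K = v" using uv by auto
        show KK: "K \<subseteq> ball x (r x)" using fine xK by (auto simp: fine_def)
        show "K = {Inf K..Sup K}" "Inf K \<le> x" "x \<le> Sup K" "a \<le> Inf K" "Sup K \<le> b" "measure lborel K = Sup K - Inf K"
          using x uv \<open>u \<le> v\<close> unfolding IS by auto
        show "Inf K \<in> ball x (r x)" "Sup K \<in> ball x (r x)"
          using KK uv \<open>u \<le> v\<close> unfolding IS by auto
      qed
      have disj: "Sup K \<le> Inf L \<or> Sup L \<le> Inf K" if "(x, K) \<in> p" "(y, L) \<in> p" "(x, K) \<noteq> (y, L)"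
          "Inf K < Sup K" "Inf L < Sup L" for x K y L
      proof (rule ccontr)
        assume neg: "\<not> ?thesis"
        have "interior K \<inter> interior L = {}" using pD(5) that by blast
        then have "{Inf K<..<Sup K} \<inter> {Inf L<..<Sup L} = {}"
          by (subst (asm) K(1)[OF that(1)], subst (asm) K(1)[OF that(2)]) simp
        moreover have "(max (Inf K) (Inf L) + min (Sup K) (Sup L)) / 2
            \<in> {Inf K<..<Sup K} \<inter> {Inf L<..<Sup L}"
          using neg that(4,5) by (auto simp: min_def max_def)
        ultimately show False by blast
      qed
      \<comment> \<open>Degenerate cells are left out: having empty interior, they escape the
        disjointness argument, and the increments of \<open>f\<close> over them vanish
        anyway.\<close>
      define A where "A = {k \<in> p. fst k \<in> N \<and> Inf (snd k) < Sup (snd k)}"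
      have A: "A \<subseteq> p" "finite A" using fin by (auto simp: A_def)
      have "(\<Sum>k\<in>A. norm (f (Sup (snd k)) - f (Inf (snd k)))) < e / 2"
      proof (rule small[rule_format], intro conjI)
        show "finite A" by (rule A)
        show "\<forall>k\<in>A. a \<le> Inf (snd k) \<and> Inf (snd k) \<le> Sup (snd k) \<and> Sup (snd k) \<le> b"
          using K(4,5) by (auto simp: A_def)
        have disjA: "Sup (snd i) \<le> Inf (snd j) \<or> Sup (snd j) \<le> Inf (snd i)" if "i \<in> A" "j \<in> A" "i \<noteq> j" for i j
          using that disj[of "fst i" "snd i" "fst j" "snd j"] by (simp add: A_def)
        then show "\<forall>i\<in>A. \<forall>j\<in>A. i \<noteq> j \<longrightarrow> Sup (snd i) \<le> Inf (snd j) \<or> Sup (snd j) \<le> Inf (snd i)"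
          by blast
        have "(\<Sum>k\<in>A. Sup (snd k) - Inf (snd k)) = (\<Sum>k\<in>A. measure lebesgue {Inf (snd k)<..<Sup (snd k)})"
          by (intro sum.cong) (auto simp: A_def)
        also have "\<dots> = measure lebesgue (\<Union>k\<in>A. {Inf (snd k)<..<Sup (snd k)})"
        proof (rule measure_negligible_finite_Union_image[symmetric])
          have "{Inf (snd i)<..<Sup (snd i)} \<inter> {Inf (snd j)<..<Sup (snd j)} = {}"
            if "i \<in> A" "j \<in> A" "i \<noteq> j" for i j
            using disjA[OF that] by auto
          then show "pairwise (\<lambda>i j. negligible ({Inf (snd i)<..<Sup (snd i)} \<inter> {Inf (snd j)<..<Sup (snd j)})) A"
            by (simp add: pairwise_def)
        qed (use A in auto)
        also have "\<dots> \<le> measure lebesgue U"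
        proof (rule measure_mono_fmeasurable)
          show "(\<Union>k\<in>A. {Inf (snd k)<..<Sup (snd k)}) \<subseteq> U"
          proof (intro UN_least)
            fix k assume "k \<in> A"
            obtain x L where "k = (x, L)" by (cases k)
            with \<open>k \<in> A\<close> have k: "k = (x, L)" "(x, L) \<in> p" "x \<in> N" by (auto simp: A_def)
            have "{Inf L<..<Sup L} \<subseteq> L"
              by (subst (3) K(1)[OF k(2)]) auto
            then show "{Inf (snd k)<..<Sup (snd k)} \<subseteq> U" using r_U[OF k(3)] K(9)[OF k(2)] k by auto
          qed
          show "(\<Union>k\<in>A. {Inf (snd k)<..<Sup (snd k)}) \<in> sets lebesgue"
            using A by (intro sets.finite_UN) auto
        qed (rule Um)
        finally show "(\<Sum>k\<in>A. Sup (snd k) - Inf (snd k)) < d" using mU by simp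
      qed
      moreover have "(\<Sum>k\<in>p - A. norm (measure lborel (snd k) *\<^sub>R g (fst k) - (f (Sup (snd k)) - f (Inf (snd k)))))
          \<le> (\<Sum>k\<in>p - A. e1 * measure lborel (snd k))"
      proof (rule sum_mono)
        fix k assume k: "k \<in> p - A"
        obtain x L where kx: "k = (x, L)" by (cases k)
        then have xL: "(x, L) \<in> p" using k by simp
        note KL = K[OF xL]
        show "norm (measure lborel (snd k) *\<^sub>R g (fst k) - (f (Sup (snd k)) - f (Inf (snd k)))) \<le> e1 * measure lborel (snd k)"
        proof (cases "x \<in> N")
          case True
          then have "Sup L = Inf L" using k KL(2,3) unfolding kx A_def by force
          then show ?thesis using True KL(8) by (simp add: kx g_def)
        next
          case False
          then have xab: "x \<in> {a..b} - N" using KL(2-5) by auto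
          have "norm (f (Sup L) - f x - (Sup L - x) *\<^sub>R f' x) \<le> e1 * \<bar>Sup L - x\<bar>"
            using KL(2-7) by (intro r_der[OF xab]) (auto simp: dist_real_def)
          moreover have "norm (f (Inf L) - f x - (Inf L - x) *\<^sub>R f' x) \<le> e1 * \<bar>Inf L - x\<bar>"
            using KL(2-7) by (intro r_der[OF xab]) (auto simp: dist_real_def)
          \<comment> \<open>Straddle estimate: the tag lies between the endpoints, so the two
            one-sided errors have total weight \<open>|Inf L - x| + |Sup L - x|\<close>, the length
            of the cell.\<close>
          moreover have "measure lborel L *\<^sub>R g x - (f (Sup L) - f (Inf L))
            = (f (Inf L) - f x - (Inf L - x) *\<^sub>R f' x) - (f (Sup L) - f x - (Sup L - x) *\<^sub>R f' x)"
            unfolding KL(8) using False by (simp add: g_def algebra_simps)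
          ultimately have "norm (measure lborel L *\<^sub>R g x - (f (Sup L) - f (Inf L)))
              \<le> e1 * \<bar>Inf L - x\<bar> + e1 * \<bar>Sup L - x\<bar>"
            by (smt (verit) norm_triangle_ineq4)
          also have "\<dots> = e1 * measure lborel L" using KL(2,3) unfolding KL(8) by (simp add: algebra_simps)
          finally show ?thesis by (simp add: kx)
        qed
      qed
      moreover have "(\<Sum>k\<in>p - A. e1 * measure lborel (snd k)) \<le> e1 * (b - a)"
      proof -
        have "(\<Sum>k\<in>p - A. e1 * measure lborel (snd k)) \<le> (\<Sum>k\<in>p. e1 * measure lborel (snd k))"
          using fin e1 by (intro sum_mono2) auto
        also have "\<dots> = e1 * (\<Sum>(x, K)\<in>p. measure lborel K)"
          by (simp add: sum_distrib_left case_prod_unfold)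
        also have "(\<Sum>(x, K)\<in>p. measure lborel K) = b - a"
          using additive_content_tagged_division[of p a b] p ab by (simp add: case_prod_unfold)
        finally show ?thesis .
      qed
      moreover have "e1 * (b - a) < e / 2"
        using e ab by (simp add: e1_def field_simps)
      moreover have "(\<Sum>(x, k)\<in>p. measure lborel k *\<^sub>R g x) - (f b - f a)
        = (\<Sum>k\<in>p. measure lborel (snd k) *\<^sub>R g (fst k) - (f (Sup (snd k)) - f (Inf (snd k))))"
        using additive_tagged_division_1[OF ab p, of f] by (simp add: case_prod_unfold sum_subtractf)
      moreover have "\<dots> = (\<Sum>k\<in>A. measure lborel (snd k) *\<^sub>R g (fst k) - (f (Sup (snd k)) - f (Inf (snd k))))
          + (\<Sum>k\<in>p - A. measure lborel (snd k) *\<^sub>R g (fst k) - (f (Sup (snd k)) - f (Inf (snd k))))"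
        using sum.subset_diff[OF A(1) fin] by (simp add: add.commute)
      moreover have "(\<Sum>k\<in>A. measure lborel (snd k) *\<^sub>R g (fst k) - (f (Sup (snd k)) - f (Inf (snd k))))
          = - (\<Sum>k\<in>A. f (Sup (snd k)) - f (Inf (snd k)))"
        unfolding sum_negf[symmetric] by (intro sum.cong) (auto simp: A_def g_def)
      ultimately have *: "(\<Sum>(x, k)\<in>p. measure lborel k *\<^sub>R g x) - (f b - f a)
          = (\<Sum>k\<in>p - A. measure lborel (snd k) *\<^sub>R g (fst k) - (f (Sup (snd k)) - f (Inf (snd k))))
            - (\<Sum>k\<in>A. f (Sup (snd k)) - f (Inf (snd k)))"
        and less: "(\<Sum>k\<in>A. norm (f (Sup (snd k)) - f (Inf (snd k)))) < e / 2"
          "(\<Sum>k\<in>p - A. norm (measure lborel (snd k) *\<^sub>R g (fst k) - (f (Sup (snd k)) - f (Inf (snd k))))) < e / 2"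
        by simp_all
      have "norm ((\<Sum>(x, k)\<in>p. measure lborel k *\<^sub>R g x) - (f b - f a)) < e / 2 + e / 2"
        unfolding * by (intro le_less_trans[OF norm_triangle_ineq4] add_strict_mono
            le_less_trans[OF norm_sum] less)
      then show "norm ((\<Sum>(x, k)\<in>p. measure lborel k *\<^sub>R g x) - (f b - f a)) < e" by simp
    qed
  qed
  then have "(g has_integral (f b - f a)) {a..b}" by simp
  then show ?thesis
    by (rule has_integral_spike[OF N, rotated]) (simp add: g_def)
qed

section \<open>Integrals with a nonnegative weight\<close>

text \<open>The Riemann sums of \<open>f\<close> and \<open>h\<close> differ by at most the Riemann
  sum of \<open>w\<close>, so the Cauchy criterion passes from \<open>h\<close> to
  \<open>f\<close>.\<close>

lemma integrable_dominated_approx: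
  fixes f :: "real \<Rightarrow> 'b::banach"
  assumes approx: "\<And>e. e > 0 \<Longrightarrow> \<exists>h w. h integrable_on {a..b} \<and> w integrable_on {a..b} \<and>
      (\<forall>x\<in>{a..b}. norm (f x - h x) \<le> w x) \<and> integral {a..b} w \<le> e"
  shows "f integrable_on {a..b}"
proof -
  have "f integrable_on cbox a b"
    unfolding integrable_Cauchy
  proof (intro allI impI)
    fix e :: real assume "e > 0"
    \<comment> \<open>Three errors of \<open>e / 6\<close> (Riemann sum of \<open>h\<close>, Riemann
      sum of \<open>w\<close>, integral of \<open>w\<close>) give \<open>e / 2\<close> for each
      division, and two divisions are compared.\<close>
    then have e6: "e / 6 > 0" by simp
    obtain h w where h: "h integrable_on {a..b}" and w: "w integrable_on {a..b}"
      and le: "\<forall>x\<in>{a..b}. norm (f x - h x) \<le> w x" and small: "integral {a..b} w \<le> e / 6"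
      using approx[OF e6] by blast
    have hi: "(h has_integral integral {a..b} h) (cbox a b)" and wi: "(w has_integral integral {a..b} w) (cbox a b)"
      using h w by (simp_all add: integrable_integral)
    obtain d1 where d1: "gauge d1" and fine1: "\<forall>p. p tagged_division_of (cbox a b) \<and> d1 fine p \<longrightarrow>
        norm ((\<Sum>(x, k)\<in>p. measure lborel k *\<^sub>R h x) - integral {a..b} h) < e / 6"
      using hi[unfolded has_integral, rule_format, OF e6] by blast
    obtain d2 where d2: "gauge d2" and fine2: "\<forall>p. p tagged_division_of (cbox a b) \<and> d2 fine p \<longrightarrow>
        norm ((\<Sum>(x, k)\<in>p. measure lborel k *\<^sub>R w x) - integral {a..b} w) < e / 6"
      using wi[unfolded has_integral, rule_format, OF e6] by blast
    have sum: "norm ((\<Sum>(x, k)\<in>p. measure lborel k *\<^sub>R f x) - integral {a..b} h) < e / 2"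
      if p: "p tagged_division_of (cbox a b)" "(\<lambda>x. d1 x \<inter> d2 x) fine p" for p
    proof -
      have fine: "d1 fine p" "d2 fine p" using p(2) by (auto simp: fine_Int)
      have "norm ((\<Sum>(x, k)\<in>p. measure lborel k *\<^sub>R f x) - (\<Sum>(x, k)\<in>p. measure lborel k *\<^sub>R h x))
          \<le> (\<Sum>(x, k)\<in>p. measure lborel k *\<^sub>R w x)"
        unfolding sum_subtractf[symmetric]
      proof (rule sum_norm_le)
        fix z assume z: "z \<in> p"
        obtain x k where xk: "z = (x, k)" by (cases z)
        have "x \<in> {a..b}" using tag_in_interval[OF p(1), of x k] z xk by simp
        then show "norm ((case z of (x, k) \<Rightarrow> measure lborel k *\<^sub>R f x) - (case z of (x, k) \<Rightarrow> measure lborel k *\<^sub>R h x))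
            \<le> (case z of (x, k) \<Rightarrow> measure lborel k *\<^sub>R w x)"
          using le by (simp add: xk mult_left_mono flip: scaleR_diff_right)
      qed
      moreover have "norm ((\<Sum>(x, k)\<in>p. measure lborel k *\<^sub>R f x) - integral {a..b} h)
        \<le> norm ((\<Sum>(x, k)\<in>p. measure lborel k *\<^sub>R f x) - (\<Sum>(x, k)\<in>p. measure lborel k *\<^sub>R h x))
          + norm ((\<Sum>(x, k)\<in>p. measure lborel k *\<^sub>R h x) - integral {a..b} h)"
        using norm_triangle_ineq[of "(\<Sum>(x, k)\<in>p. measure lborel k *\<^sub>R f x) - (\<Sum>(x, k)\<in>p. measure lborel k *\<^sub>R h x)"
            "(\<Sum>(x, k)\<in>p. measure lborel k *\<^sub>R h x) - integral {a..b} h"] by simp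
      moreover have "(\<Sum>(x, k)\<in>p. measure lborel k *\<^sub>R w x) < integral {a..b} w + e / 6"
        using fine2[rule_format, OF conjI[OF p(1) fine(2)]] unfolding real_norm_def abs_less_iff by linarith
      ultimately show ?thesis
        using fine1[rule_format, OF conjI[OF p(1) fine(1)]] small by linarith
    qed
    show "\<exists>\<gamma>. gauge \<gamma> \<and> (\<forall>p q. p tagged_division_of (cbox a b) \<and> \<gamma> fine p \<and>
        q tagged_division_of (cbox a b) \<and> \<gamma> fine q \<longrightarrow>
        norm ((\<Sum>(x, k)\<in>p. measure lborel k *\<^sub>R f x) - (\<Sum>(x, k)\<in>q. measure lborel k *\<^sub>R f x)) < e)"
    proof (intro exI conjI allI impI)
      show "gauge (\<lambda>x. d1 x \<inter> d2 x)" using d1 d2 by (rule gauge_Int)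
      fix p q assume "p tagged_division_of (cbox a b) \<and> (\<lambda>x. d1 x \<inter> d2 x) fine p \<and>
        q tagged_division_of (cbox a b) \<and> (\<lambda>x. d1 x \<inter> d2 x) fine q"
      then have "norm (((\<Sum>(x, k)\<in>p. measure lborel k *\<^sub>R f x) - integral {a..b} h)
          - ((\<Sum>(x, k)\<in>q. measure lborel k *\<^sub>R f x) - integral {a..b} h)) < e / 2 + e / 2"
        by (intro le_less_trans[OF norm_triangle_ineq4] add_strict_mono sum) auto
      then show "norm ((\<Sum>(x, k)\<in>p. measure lborel k *\<^sub>R f x) - (\<Sum>(x, k)\<in>q. measure lborel k *\<^sub>R f x)) < e"
        by simp
    qed
  qed
  then show ?thesis by simp
qed

text \<open>Only finitely many mesh cells of width \<open>1 / N\<close> meet \<open>{a..b}\<close>,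
  and on each of them the integrand is the scalar \<open>w\<close> times a fixed vector.\<close>

lemma integrable_weighted_step:
  fixes \<phi> :: "int \<Rightarrow> 'b::banach" and w :: "real \<Rightarrow> real"
  assumes w: "w integrable_on {a..b}" and N: "N > 0"
  shows "(\<lambda>t. w t *\<^sub>R \<phi> \<lfloor>N * t\<rfloor>) integrable_on {a..b}"
proof -
  let ?J = "{\<lfloor>N * a\<rfloor>..\<lfloor>N * b\<rfloor>}"
  have "(\<lambda>t. if \<lfloor>N * t\<rfloor> = j then w t else 0) integrable_on {a..b}" for j
  proof -
    have "w integrable_on {max a (j / N)..min b ((j + 1) / N)}"
      using w by (rule integrable_subinterval_real) auto
    then have "w integrable_on {t. \<lfloor>N * t\<rfloor> = j} \<inter> {a..b}"
    proof (rule integrable_spike_set)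
      have *: "\<lfloor>N * t\<rfloor> = j \<longleftrightarrow> j / N \<le> t \<and> t < (j + 1) / N" for t
        using N by (simp add: floor_eq_iff field_simps)
      \<comment> \<open>The cell is half-open and the interval of integration closed; they differ at
        most in the right endpoint.\<close>
      have "{max a (j / N)..min b ((j + 1) / N)} - {t. \<lfloor>N * t\<rfloor> = j} \<inter> {a..b} \<subseteq> {(j + 1) / N}"
        unfolding * by auto
      then show "negligible {x \<in> {max a (j / N)..min b ((j + 1) / N)} - {t. \<lfloor>N * t\<rfloor> = j} \<inter> {a..b}. w x \<noteq> 0}"
        by (intro negligible_subset[OF negligible_sing[of "(j + 1) / N"]]) blast
      have "{t. \<lfloor>N * t\<rfloor> = j} \<inter> {a..b} - {max a (j / N)..min b ((j + 1) / N)} = {}"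
        unfolding * by auto
      then show "negligible {x \<in> {t. \<lfloor>N * t\<rfloor> = j} \<inter> {a..b} - {max a (j / N)..min b ((j + 1) / N)}. w x \<noteq> 0}"
        by (metis (no_types, lifting) Collect_empty_eq empty_iff negligible_empty)
    qed
    then show ?thesis
      by (simp add: integrable_restrict_Int[of "{t. \<lfloor>N * t\<rfloor> = j}" w, simplified])
  qed
  then have "(\<lambda>t. (if \<lfloor>N * t\<rfloor> = j then w t else 0) *\<^sub>R \<phi> j) integrable_on {a..b}" for j
    using integrable_linear[OF _ bounded_linear_scaleR_left, of _ "{a..b}" "\<phi> j"] by (simp add: o_def)
  then have "(\<lambda>t. \<Sum>j\<in>?J. (if \<lfloor>N * t\<rfloor> = j then w t else 0) *\<^sub>R \<phi> j) integrable_on {a..b}"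
    by (intro integrable_sum) auto
  then show ?thesis
  proof (rule integrable_eq)
    fix t assume "t \<in> {a..b}"
    then have "\<lfloor>N * t\<rfloor> \<in> ?J" using N by (auto intro!: floor_mono mult_left_mono)
    moreover have "(\<Sum>j\<in>?J. (if \<lfloor>N * t\<rfloor> = j then w t else 0) *\<^sub>R \<phi> j)
        = (\<Sum>j\<in>?J. if \<lfloor>N * t\<rfloor> = j then w t *\<^sub>R \<phi> j else 0)"
      by (intro sum.cong) auto
    ultimately show "(\<Sum>j\<in>?J. (if \<lfloor>N * t\<rfloor> = j then w t else 0) *\<^sub>R \<phi> j) = w t *\<^sub>R \<phi> \<lfloor>N * t\<rfloor>"
      by (simp add: sum.delta')
  qed
qed

text \<open>By uniform continuity \<open>g\<close> may be replaced by its values at mesh points with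
  error at most \<open>c\<close>; the product with \<open>w\<close> then changes by at most
  \<open>c * w\<close>, whose integral is small.\<close>

lemma integrable_weighted_continuous:
  fixes g :: "real \<Rightarrow> 'b::banach" and w :: "real \<Rightarrow> real"
  assumes w: "w integrable_on {a..b}" and pos: "\<And>t. t \<in> {a..b} \<Longrightarrow> 0 \<le> w t"
    and g: "continuous_on {a..b} g"
  shows "(\<lambda>t. w t *\<^sub>R g t) integrable_on {a..b}"
proof (rule integrable_dominated_approx)
  fix e :: real assume e: "e > 0"
  define I where "I = integral {a..b} w"
  have I: "I \<ge> 0" unfolding I_def using w pos by (intro integral_nonneg) auto
  define c where "c = e / (I + 1)"
  have c: "c > 0" "c * I \<le> e" using e I by (auto simp: c_def field_simps)
  obtain d where d: "d > 0" "\<And>s t. s \<in> {a..b} \<Longrightarrow> t \<in> {a..b} \<Longrightarrow> dist t s < d \<Longrightarrow> dist (g t) (g s) < c"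
    using compact_uniformly_continuous[OF g] c(1) unfolding uniformly_continuous_on_def by auto
  \<comment> \<open>Mesh width \<open>d / 2\<close>, so a point and the mesh point to its left are
    closer than \<open>d\<close>.\<close>
  define N where "N = 2 / d"
  have N: "N > 0" using d by (simp add: N_def)
  \<comment> \<open>The mesh point to the left of \<open>t\<close> can lie before \<open>a\<close>,
    hence the \<open>max\<close>.\<close>
  define h where "h = (\<lambda>t. g (max a (\<lfloor>N * t\<rfloor> / N)))"
  have gh: "norm (g t - h t) \<le> c" if t: "t \<in> {a..b}" for t
  proof -
    have "\<lfloor>N * t\<rfloor> / N \<le> N * t / N" "(N * t - 1) / N \<le> \<lfloor>N * t\<rfloor> / N"
      using N by (intro divide_right_mono; linarith)+
    then have "\<lfloor>N * t\<rfloor> / N \<le> t" "t - 1 / N \<le> \<lfloor>N * t\<rfloor> / N"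
      using N by (simp_all add: diff_divide_distrib)
    then have "max a (\<lfloor>N * t\<rfloor> / N) \<in> {a..b}" "dist t (max a (\<lfloor>N * t\<rfloor> / N)) < d"
      using t d(1) by (auto simp: dist_real_def N_def)
    then show ?thesis using d(2) t unfolding h_def dist_norm by (meson less_imp_le)
  qed
  show "\<exists>h v. h integrable_on {a..b} \<and> v integrable_on {a..b} \<and>
      (\<forall>x\<in>{a..b}. norm (w x *\<^sub>R g x - h x) \<le> v x) \<and> integral {a..b} v \<le> e"
  proof (intro exI conjI ballI)
    show "(\<lambda>t. w t *\<^sub>R h t) integrable_on {a..b}"
      unfolding h_def using integrable_weighted_step[OF w N, of "\<lambda>j. g (max a (j / N))"] by simp
    show "(\<lambda>t. c * w t) integrable_on {a..b}" using integrable_cmul[OF w, of c] by simp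
    show "norm (w x *\<^sub>R g x - w x *\<^sub>R h x) \<le> c * w x" if "x \<in> {a..b}" for x
      using mult_left_mono[OF gh[OF that] pos[OF that]] pos[OF that]
      by (simp add: mult.commute flip: scaleR_diff_right)
    show "integral {a..b} (\<lambda>t. c * w t) \<le> e" using c(2) by (simp add: I_def)
  qed
qed

lemma sum_integral_disjoint_le:
  fixes h :: "real \<Rightarrow> real"
  assumes h: "h integrable_on {a..b}" and pos: "\<And>t. t \<in> {a..b} \<Longrightarrow> 0 \<le> h t" and "finite I"
    and st: "\<And>k. k \<in> I \<Longrightarrow> a \<le> s k \<and> s k \<le> t k \<and> t k \<le> b"
    and disj: "\<And>i j. i \<in> I \<Longrightarrow> j \<in> I \<Longrightarrow> i \<noteq> j \<Longrightarrow> t i \<le> s j \<or> t j \<le> s i"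
  shows "(\<Sum>k\<in>I. integral {s k..t k} h) \<le> integral {a..b} h"
proof -
  \<comment> \<open>The open intervals are disjoint as sets even when the closed ones touch, so the
    sum of the cut-off functions stays below \<open>h\<close>.\<close>
  let ?f = "\<lambda>k x. if x \<in> {s k<..<t k} then h x else 0"
  have sub: "{s k<..<t k} \<inter> {a..b} = {s k<..<t k}" if "k \<in> I" for k
    using st[OF that] by auto
  have int: "?f k integrable_on {a..b}" if "k \<in> I" for k
  proof -
    have "h integrable_on {s k<..<t k}"
      unfolding integrable_on_open_interval_real
      using h st[OF that] by (intro integrable_subinterval_real[OF h]) auto
    then show ?thesis
      using integrable_restrict_Int[of "{s k<..<t k}" h "{a..b}"] sub[OF that] by simp
  qed
  have "integral {s k..t k} h = integral {a..b} (?f k)" if "k \<in> I" for k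
    using integral_restrict_Int[of "{a..b}" "{s k<..<t k}" h] sub[OF that]
    by (simp add: integral_open_interval_real)
  then have "(\<Sum>k\<in>I. integral {s k..t k} h) = (\<Sum>k\<in>I. integral {a..b} (?f k))"
    by (intro sum.cong) auto
  also have "\<dots> = integral {a..b} (\<lambda>x. \<Sum>k\<in>I. ?f k x)"
    using int \<open>finite I\<close> by (intro integral_sum[symmetric]) auto
  also have "\<dots> \<le> integral {a..b} h"
  proof (rule integral_le)
    show "(\<lambda>x. \<Sum>k\<in>I. ?f k x) integrable_on {a..b}"
      using int \<open>finite I\<close> by (intro integrable_sum) auto
    fix x assume x: "x \<in> {a..b}"
    show "(\<Sum>k\<in>I. ?f k x) \<le> h x"
    proof (cases "\<exists>i\<in>I. x \<in> {s i<..<t i}")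
      case True
      then obtain i where i: "i \<in> I" "x \<in> {s i<..<t i}" by blast
      have "(\<Sum>k\<in>I. ?f k x) = (\<Sum>k\<in>I. if k = i then h x else 0)"
      proof (rule sum.cong)
        fix k assume k: "k \<in> I"
        have "x \<notin> {s k<..<t k}" if "k \<noteq> i"
          using disj[OF k i(1) that] i(2) by auto
        then show "?f k x = (if k = i then h x else 0)" using i(2) by auto
      qed simp
      also have "\<dots> = h x" using i(1) \<open>finite I\<close> by simp
      finally show ?thesis by simp
    next
      case False
      then have "(\<Sum>k\<in>I. ?f k x) = 0" by (intro sum.neutral) auto
      then show ?thesis using pos[OF x] by simp
    qed
  qed (rule h)
  finally show ?thesis .
qed

text \<open>Truncating \<open>w\<close> at a high level \<open>n\<close> changes its integral by less than \<open>e / 2\<close>, and the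
  truncated function contributes at most \<open>n\<close> times the total length of the intervals.\<close>

lemma abs_cont_on_integral:
  fixes w :: "real \<Rightarrow> real"
  assumes w: "w integrable_on {a..b}" and pos: "\<And>t. t \<in> {a..b} \<Longrightarrow> 0 \<le> w t"
  shows "abs_cont_on (\<lambda>t. integral {a..t} w) a b"
  unfolding abs_cont_on_def
proof (intro allI impI)
  fix e :: real assume e: "e > 0"
  let ?w = "\<lambda>n x. min (w x) (real n)"
  have wn: "?w n integrable_on {a..b}" for n
  proof -
    have "w absolutely_integrable_on {a..b}"
      using w pos by (rule nonnegative_absolutely_integrable_1)
    then have "?w n absolutely_integrable_on {a..b}"
      by (intro absolutely_integrable_min_1) simp_all
    then show ?thesis by (rule set_lebesgue_integral_eq_integral(1))
  qed
  have "(\<lambda>n. integral {a..b} (?w n)) \<longlonglongrightarrow> integral {a..b} w"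
  proof (rule monotone_convergence_increasing[THEN conjunct2])
    show "(\<lambda>n. ?w n x) \<longlonglongrightarrow> w x" for x
    proof (rule tendsto_eventually)
      obtain m where "w x \<le> real m" using real_arch_simple by blast
      then show "\<forall>\<^sub>F n in sequentially. ?w n x = w x"
        by (intro eventually_sequentiallyI[of m]) (auto simp: min_def)
    qed
    have "\<bar>integral {a..b} (?w n)\<bar> \<le> integral {a..b} w" for n
    proof -
      have "0 \<le> integral {a..b} (?w n)" using wn pos by (intro integral_nonneg) auto
      moreover have "integral {a..b} (?w n) \<le> integral {a..b} w" using wn w by (intro integral_le) auto
      ultimately show ?thesis by simp
    qed
    then show "bounded (range (\<lambda>n. integral {a..b} (?w n)))"
      by (auto simp: bounded_iff)
  qed (use wn in \<open>auto simp: min_def\<close>)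
  then have "\<forall>\<^sub>F n in sequentially. integral {a..b} w - e / 2 < integral {a..b} (?w n)"
    using e by (intro order_tendstoD) auto
  then obtain n where "integral {a..b} w - e / 2 < integral {a..b} (?w n)"
    using eventually_happens by force
  then have n: "integral {a..b} w - integral {a..b} (?w n) < e / 2" by linarith
  show "\<exists>d>0. \<forall>m s t. (\<forall>k<m. a \<le> s k \<and> s k \<le> t k \<and> t k \<le> b) \<and>
      (\<forall>i<m. \<forall>j<m. i \<noteq> j \<longrightarrow> t i \<le> s j \<or> t j \<le> s i) \<and> (\<Sum>k<m. t k - s k) < d \<longrightarrow>
      (\<Sum>k<m::nat. norm (integral {a..t k} w - integral {a..s k} w)) < e"
  \<comment> \<open>For total length below this bound the truncated part contributes at most
    \<open>n * e / (2 (n + 1))\<close>, hence at most \<open>e / 2\<close>; the summand 1 covers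
    \<open>n = 0\<close>.\<close>
  proof (intro exI[of _ "e / (2 * (real n + 1))"] conjI allI impI)
    fix m s t assume *: "(\<forall>k<m. a \<le> s k \<and> s k \<le> t k \<and> t k \<le> b) \<and>
      (\<forall>i<m. \<forall>j<m. i \<noteq> j \<longrightarrow> t i \<le> s j \<or> t j \<le> s i) \<and> (\<Sum>k<m::nat. t k - s k) < e / (2 * (real n + 1))"
    have sub: "{s k..t k} \<subseteq> {a..b}" if "k < m" for k
      using * that by auto
    have wi: "w integrable_on {s k..t k}" "?w n integrable_on {s k..t k}" if "k < m" for k
      using sub[OF that] by (auto intro: integrable_subinterval_real[OF w] integrable_subinterval_real[OF wn])
    have "norm (integral {a..t k} w - integral {a..s k} w)
        \<le> integral {s k..t k} (\<lambda>x. w x - ?w n x) + real n * (t k - s k)" if k: "k < m" for k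
    proof -
      have "integral {a..s k} w + integral {s k..t k} w = integral {a..t k} w"
        using * k by (intro Henstock_Kurzweil_Integration.integral_combine integrable_subinterval_real[OF w]) auto
      moreover have "0 \<le> integral {s k..t k} w"
        using wi[OF k] pos sub[OF k] by (intro integral_nonneg) auto
      moreover have "integral {s k..t k} (?w n) \<le> integral {s k..t k} (\<lambda>_. real n)"
        using wi[OF k] by (intro integral_le) auto
      moreover have "integral {s k..t k} (\<lambda>x. w x - ?w n x) = integral {s k..t k} w - integral {s k..t k} (?w n)"
        using wi[OF k] by (intro integral_diff) auto
      ultimately show ?thesis using * k by (simp add: mult.commute)
    qed
    then have "(\<Sum>k<m. norm (integral {a..t k} w - integral {a..s k} w))
        \<le> (\<Sum>k<m. integral {s k..t k} (\<lambda>x. w x - ?w n x) + real n * (t k - s k))"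
      by (intro sum_mono) auto
    also have "\<dots> = (\<Sum>k<m. integral {s k..t k} (\<lambda>x. w x - ?w n x)) + real n * (\<Sum>k<m. t k - s k)"
      by (simp add: sum.distrib sum_distrib_left)
    also have "(\<Sum>k<m. integral {s k..t k} (\<lambda>x. w x - ?w n x)) \<le> integral {a..b} (\<lambda>x. w x - ?w n x)"
      using * by (intro sum_integral_disjoint_le integrable_diff w wn) auto
    also have "integral {a..b} (\<lambda>x. w x - ?w n x) < e / 2"
      using n w wn[of n] by (simp add: integral_diff)
    also have "real n * (\<Sum>k<m. t k - s k) \<le> e / 2"
    proof -
      have "real n * (\<Sum>k<m. t k - s k) \<le> real n * (e / (2 * (real n + 1)))"
        using * by (intro mult_left_mono) auto
      also have "\<dots> \<le> e / 2" using e by (simp add: field_simps)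
      finally show ?thesis .
    qed
    finally show "(\<Sum>k<m. norm (integral {a..t k} w - integral {a..s k} w)) < e" by simp
  qed (use e in auto)
qed

section \<open>Lebesgue differentiation of primitives of scalar functions\<close>

lemma lebesgue_right_average:
  fixes f :: "real \<Rightarrow> real"
  assumes f: "f integrable_on {a..b}"
  obtains N where "negligible N"
    "\<And>t e. t \<in> {a<..<b} \<Longrightarrow> t \<notin> N \<Longrightarrow> e > 0 \<Longrightarrow>
      \<exists>d>0. \<forall>h. 0 < h \<and> h < d \<longrightarrow> \<bar>integral {t..t + h} f - h * f t\<bar> \<le> e * h"
proof -
  let ?F = "\<lambda>x. if x \<in> {a..b} then f x else 0"
  have "?F integrable_on cbox c d" for c d
  proof -
    have "?F integrable_on UNIV" using f by (simp only: integrable_restrict_UNIV)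
    then show ?thesis by (rule integrable_on_subcbox) simp
  qed
  from integrable_ccontinuous_explicit[OF this] obtain N where N: "negligible N"
    "\<And>x e. x \<notin> N \<Longrightarrow> 0 < e \<Longrightarrow>
      \<exists>d>0. \<forall>h. 0 < h \<and> h < d \<longrightarrow> norm (integral (cbox x (x + h *\<^sub>R One)) ?F /\<^sub>R h ^ DIM(real) - ?F x) < e"
    by blast
  show ?thesis
  proof (rule that[OF N(1)])
    fix t e :: real assume t: "t \<in> {a<..<b}" "t \<notin> N" and e: "e > 0"
    obtain d where d: "d > 0" "\<And>h. 0 < h \<Longrightarrow> h < d \<Longrightarrow> norm (integral (cbox t (t + h *\<^sub>R One)) ?F /\<^sub>R h ^ DIM(real) - ?F t) < e"
      using N(2)[OF t(2) e] by blast
    show "\<exists>d>0. \<forall>h. 0 < h \<and> h < d \<longrightarrow> \<bar>integral {t..t + h} f - h * f t\<bar> \<le> e * h"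
    \<comment> \<open>The bound \<open>b - t\<close> keeps \<open>{t..t + h}\<close> inside
      \<open>{a..b}\<close>, where the extension by 0 agrees with \<open>f\<close>.\<close>
    proof (intro exI[of _ "min d (b - t)"] conjI allI impI)
      show "min d (b - t) > 0" using d t by auto
      fix h assume h: "0 < h \<and> h < min d (b - t)"
      have "integral {t..t + h} ?F = integral {t..t + h} f"
        using h t by (intro integral_cong) auto
      then have "\<bar>integral {t..t + h} f / h - f t\<bar> < e"
        using d(2)[of h] h t by (simp add: divide_inverse mult.commute)
      moreover have "integral {t..t + h} f - h * f t = h * (integral {t..t + h} f / h - f t)"
        using h by (simp add: field_simps)
      ultimately show "\<bar>integral {t..t + h} f - h * f t\<bar> \<le> e * h"
        using h by (simp add: abs_mult mult.commute)
    qed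
  qed
qed

text \<open>Right averages give only the right derivative. The left one is the right derivative for
  the reflected function \<open>f (- x)\<close>, whose exceptional set is reflected back.\<close>

lemma integral_has_vector_derivative_ae:
  fixes f :: "real \<Rightarrow> real"
  assumes f: "f integrable_on {a..b}"
  obtains N where "negligible N"
    "\<And>t. t \<in> {a<..<b} \<Longrightarrow> t \<notin> N \<Longrightarrow> ((\<lambda>u. integral {a..u} f) has_vector_derivative f t) (at t within {a..b})"
proof -
  obtain N1 where N1: "negligible N1"
    "\<And>t e. t \<in> {a<..<b} \<Longrightarrow> t \<notin> N1 \<Longrightarrow> e > 0 \<Longrightarrow>
      \<exists>d>0. \<forall>h. 0 < h \<and> h < d \<longrightarrow> \<bar>integral {t..t + h} f - h * f t\<bar> \<le> e * h"
    using lebesgue_right_average[OF f] by blast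
  have "(\<lambda>x. f (- x)) integrable_on {- b..- a}" using f by simp
  then obtain N2 where N2: "negligible N2"
    "\<And>t e. t \<in> {- b<..<- a} \<Longrightarrow> t \<notin> N2 \<Longrightarrow> e > 0 \<Longrightarrow>
      \<exists>d>0. \<forall>h. 0 < h \<and> h < d \<longrightarrow> \<bar>integral {t..t + h} (\<lambda>x. f (- x)) - h * f (- t)\<bar> \<le> e * h"
    using lebesgue_right_average[of "\<lambda>x. f (- x)" "- b" "- a"] by blast
  show ?thesis
  proof (rule that)
    show "negligible (N1 \<union> uminus ` N2)"
      using N1(1) N2(1) by (intro negligible_Un negligible_differentiable_image_negligible)
        (auto intro!: derivative_intros simp: differentiable_on_def)
    fix t assume t: "t \<in> {a<..<b}" "t \<notin> N1 \<union> uminus ` N2"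
    then have t': "- t \<in> {- b<..<- a}" "- t \<notin> N2" by (auto simp: image_iff) 
    show "((\<lambda>u. integral {a..u} f) has_vector_derivative f t) (at t within {a..b})"
      unfolding has_vector_derivative_def has_derivative_within_alt
    proof (intro conjI allI impI)
      fix e :: real assume e: "e > 0"
      obtain d1 where d1: "d1 > 0" "\<And>h. 0 < h \<Longrightarrow> h < d1 \<Longrightarrow> \<bar>integral {t..t + h} f - h * f t\<bar> \<le> e * h"
        using N1(2)[OF t(1) _ e] t(2) by blast
      obtain d2 where d2: "d2 > 0" "\<And>h. 0 < h \<Longrightarrow> h < d2 \<Longrightarrow>
          \<bar>integral {- t..- t + h} (\<lambda>x. f (- x)) - h * f (- (- t))\<bar> \<le> e * h"
        using N2(2)[OF t' e] by blast
      show "\<exists>d>0. \<forall>y\<in>{a..b}. norm (y - t) < d \<longrightarrow>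
          norm (integral {a..y} f - integral {a..t} f - (y - t) *\<^sub>R f t) \<le> e * norm (y - t)"
      proof (intro exI[of _ "min d1 d2"] conjI ballI impI)
        show "min d1 d2 > 0" using d1 d2 by simp
        fix y assume y: "y \<in> {a..b}" "norm (y - t) < min d1 d2"
        consider "y = t" | "y > t" | "y < t" by linarith
        then show "norm (integral {a..y} f - integral {a..t} f - (y - t) *\<^sub>R f t) \<le> e * norm (y - t)"
        proof cases
          case 2
          have "integral {a..t} f + integral {t..y} f = integral {a..y} f"
            using 2 t y by (intro Henstock_Kurzweil_Integration.integral_combine integrable_subinterval_real[OF f]) auto
          then show ?thesis using d1(2)[of "y - t"] 2 y by simp
        next
          case 3
          have "integral {a..y} f + integral {y..t} f = integral {a..t} f"
            using 3 t y by (intro Henstock_Kurzweil_Integration.integral_combine integrable_subinterval_real[OF f]) auto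
          moreover have "integral {- t..- y} (\<lambda>x. f (- x)) = integral {y..t} f"
            by simp
          moreover have "\<bar>integral {- t..- y} (\<lambda>x. f (- x)) - (t - y) * f t\<bar> \<le> e * (t - y)"
            using d2(2)[of "t - y"] 3 y by simp
          ultimately have "\<bar>integral {a..t} f - integral {a..y} f - (t - y) * f t\<bar> \<le> e * (t - y)"
            by (simp add: algebra_simps)
          moreover have "integral {a..y} f - integral {a..t} f - (y - t) * f t
              = - (integral {a..t} f - integral {a..y} f - (t - y) * f t)"
            by (simp add: algebra_simps)
          ultimately show ?thesis using 3 by (simp only: real_norm_def real_scaleR_def abs_minus_cancel) simp
        qed simp
      qed
    qed (rule bounded_linear_scaleR_left)
  qed
qed

section \<open>Lipschitz curves in a Hilbert space are differentiable almost everywhere\<close>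

lemma has_integral_step:
  fixes \<phi> :: "int \<Rightarrow> 'b::banach"
  assumes N: "(N::real) > 0"
  shows "((\<lambda>t. \<phi> \<lfloor>N * t\<rfloor>) has_integral ((1 / N) *\<^sub>R (\<Sum>k<n. \<phi> (int k)))) {0..n / N}"
proof (induction n)
  case 0
  then show ?case by (simp add: has_integral_refl)
next
  case (Suc n)
  have le: "0 \<le> n / N" "n / N \<le> Suc n / N" using N by (auto simp: divide_right_mono)
  have "((\<lambda>_. \<phi> (int n)) has_integral ((Suc n / N - n / N) *\<^sub>R \<phi> (int n))) {n / N..Suc n / N}"
    using has_integral_const_real[of "\<phi> (int n)" "n / N" "Suc n / N"] le by simp
  then have "((\<lambda>t. \<phi> \<lfloor>N * t\<rfloor>) has_integral ((Suc n / N - n / N) *\<^sub>R \<phi> (int n))) {n / N..Suc n / N}"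
  \<comment> \<open>At the right endpoint the floor has already jumped to
    \<open>n + 1\<close>.\<close>
  proof (rule has_integral_spike_finite[where S = "{Suc n / N}", rotated 2])
    fix t assume "t \<in> {n / N..Suc n / N} - {Suc n / N}"
    then have "real_of_int (int n) \<le> N * t" "N * t < real_of_int (int n) + 1"
      using N by (auto simp: field_simps)
    then have "\<lfloor>N * t\<rfloor> = int n" by (simp only: floor_eq_iff)
    then show "\<phi> \<lfloor>N * t\<rfloor> = \<phi> (int n)" by simp
  qed simp
  from has_integral_combine[OF le Suc.IH this]
  have "((\<lambda>t. \<phi> \<lfloor>N * t\<rfloor>) has_integral
      ((1 / N) *\<^sub>R (\<Sum>k<n. \<phi> (int k)) + (Suc n / N - n / N) *\<^sub>R \<phi> (int n))) {0..Suc n / N}" .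
  moreover have "Suc n / N - n / N = 1 / N" by (simp flip: diff_divide_distrib)
  ultimately show ?case by (simp only: sum.lessThan_Suc scaleR_add_right)
qed

text \<open>The difference quotient over the cell \<open>[j/N, (j+1)/N]\<close>. The integer index
  makes \<open>mesh_slope f N \<lfloor>N * t\<rfloor>\<close> a step function of \<open>t\<close>;
  for smooth \<open>f\<close> this is the conditional expectation of the derivative with respect to
  the mesh.\<close>

definition mesh_slope :: "(real \<Rightarrow> 'b::real_vector) \<Rightarrow> real \<Rightarrow> int \<Rightarrow> 'b" where
  "mesh_slope f N j = N *\<^sub>R (f ((j + 1) / N) - f (j / N))"

text \<open>The squared \<open>L2\<close> norm on \<open>[0, 1]\<close> of the step function of
  slopes, which has \<open>N\<close> cells of length \<open>1 / N\<close>.\<close>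

definition mesh_energy :: "(real \<Rightarrow> 'b::real_normed_vector) \<Rightarrow> nat \<Rightarrow> real" where
  "mesh_energy f N = (\<Sum>k<N. (norm (mesh_slope f N (int k)))\<^sup>2) / N"

lemma norm_mesh_slope_le:
  fixes f :: "real \<Rightarrow> 'b::real_normed_vector"
  assumes "\<And>s t. norm (f s - f t) \<le> L * \<bar>s - t\<bar>" "N > 0"
  shows "norm (mesh_slope f N j) \<le> L"
proof -
  have "norm (mesh_slope f N j) \<le> N * (L * \<bar>(j + 1) / N - j / N\<bar>)"
    unfolding mesh_slope_def using assms by (simp add: mult_left_mono)
  also have "(j + 1) / N - j / N = 1 / N" by (simp flip: diff_divide_distrib)
  finally show ?thesis using assms(2) by simp
qed

text \<open>Telescoping. The offset \<open>m\<close> serves for blocks of fine cells inside one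
  coarse cell, whose slope is thereby the mean of the fine slopes.\<close>

lemma sum_mesh_slope:
  fixes f :: "real \<Rightarrow> 'b::real_vector"
  assumes "N > 0"
  shows "(1 / N) *\<^sub>R (\<Sum>r<n. mesh_slope f N (int (m + r))) = f (real (m + n) / N) - f (real m / N)"
proof (induction n)
  case (Suc n)
  have "real_of_int (int (m + n)) + 1 = real (m + Suc n)" by simp
  then have "(1 / N) *\<^sub>R mesh_slope f N (int (m + n)) = f (real (m + Suc n) / N) - f (real (m + n) / N)"
    using assms unfolding mesh_slope_def by (simp only: of_int_of_nat_eq) simp
  then show ?case using Suc by (simp add: scaleR_add_right)
qed simp

text \<open>The variance identity, that is, Pythagoras for deviations from the mean: the cross term
  equals \<open>-2 p |m|\<^sup>2\<close>.\<close>

lemma sum_norm_diff_mean_power2: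
  fixes a :: "nat \<Rightarrow> 'b::real_inner"
  assumes "(\<Sum>r<p. a r) = real p *\<^sub>R m"
  shows "(\<Sum>r<p. (norm (a r - m))\<^sup>2) = (\<Sum>r<p. (norm (a r))\<^sup>2) - real p * (norm m)\<^sup>2"
proof -
  have "(\<Sum>r<p. (norm (a r - m))\<^sup>2) = (\<Sum>r<p. (norm (a r))\<^sup>2 - 2 * (a r \<bullet> m) + (norm m)\<^sup>2)"
    by (intro sum.cong) (simp_all add: power2_norm_eq_inner inner_diff_left inner_diff_right inner_commute)
  also have "\<dots> = (\<Sum>r<p. (norm (a r))\<^sup>2) - 2 * ((\<Sum>r<p. a r) \<bullet> m) + real p * (norm m)\<^sup>2"
    by (simp add: sum.distrib sum_subtractf inner_sum_left sum_distrib_left)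
  also have "\<dots> = (\<Sum>r<p. (norm (a r))\<^sup>2) - real p * (norm m)\<^sup>2"
    unfolding assms by (simp add: power2_norm_eq_inner)
  finally show ?thesis .
qed

text \<open>The slopes along refining meshes form a martingale; in a Hilbert space its increments are
  orthogonal, so their \<open>L\<^sup>2\<close> distance is the difference of the energies.\<close>

lemma has_integral_mesh_slope_diff:
  fixes f :: "real \<Rightarrow> 'b::real_inner"
  assumes N: "N > 0" and p: "p > (0::nat)"
  shows "((\<lambda>t. (norm (mesh_slope f (real (N * p)) \<lfloor>real (N * p) * t\<rfloor> - mesh_slope f (real N) \<lfloor>real N * t\<rfloor>))\<^sup>2)
     has_integral (mesh_energy f (N * p) - mesh_energy f N)) {0..1}"
proof -
  let ?M = "N * p"
  let ?q = "mesh_slope f (real ?M)" and ?m = "mesh_slope f (real N)"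
  have M: "real ?M > 0" using N p by simp
  define \<phi> where "\<phi> = (\<lambda>j. (norm (?q j - ?m (j div int p)))\<^sup>2)"
  have "\<phi> \<lfloor>real ?M * t\<rfloor> = (norm (?q \<lfloor>real ?M * t\<rfloor> - ?m \<lfloor>real N * t\<rfloor>))\<^sup>2" for t
  proof -
    \<comment> \<open>Integer division by \<open>p\<close> maps the index of a fine cell to that of
      the coarse cell containing it, so the difference depends on the fine index alone.\<close>
    have "\<lfloor>real ?M * t / real_of_int (int p)\<rfloor> = \<lfloor>real ?M * t\<rfloor> div int p"
      by (rule floor_divide_real_eq_div) simp
    then show ?thesis using p by (simp add: \<phi>_def)
  qed
  moreover have "((\<lambda>t. \<phi> \<lfloor>real ?M * t\<rfloor>) has_integral (1 / real ?M) *\<^sub>R (\<Sum>k<?M. \<phi> (int k))) {0..1}"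
    using has_integral_step[OF M, of \<phi> ?M] N p by simp
  moreover have "(\<Sum>k<?M. \<phi> (int k)) = (\<Sum>k<?M. (norm (?q (int k)))\<^sup>2) - real p * (\<Sum>k<N. (norm (?m (int k)))\<^sup>2)"
  proof -
    have block: "(\<Sum>k\<in>{j * p..<j * p + p}. \<phi> (int k))
        = (\<Sum>k\<in>{j * p..<j * p + p}. (norm (?q (int k)))\<^sup>2) - real p * (norm (?m (int j)))\<^sup>2" for j
    proof -
      have shift: "(\<Sum>k\<in>{j * p..<j * p + p}. h k) = (\<Sum>r<p. h (j * p + r))" for h :: "nat \<Rightarrow> real"
        using sum.shift_bounds_nat_ivl[of h 0 "j * p" p] by (simp add: lessThan_atLeast0 add.commute)
      have "int (j * p + r) div int p = int j" if "r < p" for r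
        using that by (simp flip: zdiv_int)
      then have "(\<Sum>k\<in>{j * p..<j * p + p}. \<phi> (int k)) = (\<Sum>r<p. (norm (?q (int (j * p + r)) - ?m (int j)))\<^sup>2)"
        unfolding shift by (intro sum.cong) (simp_all add: \<phi>_def)
      also have "\<dots> = (\<Sum>r<p. (norm (?q (int (j * p + r))))\<^sup>2) - real p * (norm (?m (int j)))\<^sup>2"
      proof (rule sum_norm_diff_mean_power2)
        have "(\<Sum>r<p. ?q (int (j * p + r))) = real ?M *\<^sub>R ((1 / real ?M) *\<^sub>R (\<Sum>r<p. ?q (int (j * p + r))))"
          using N p by simp
        also have "\<dots> = real ?M *\<^sub>R (f (real (j * p + p) / real ?M) - f (real (j * p) / real ?M))"
          unfolding sum_mesh_slope[OF M] ..
        also have "real (j * p + p) / real ?M = (real_of_int (int j) + 1) / real N"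
          using p N by (simp add: field_simps)
        also have "real (j * p) / real ?M = real_of_int (int j) / real N"
          using p N by (simp add: field_simps)
        finally show "(\<Sum>r<p. ?q (int (j * p + r))) = real p *\<^sub>R ?m (int j)"
          by (simp add: mesh_slope_def mult.commute)
      qed
      finally show ?thesis unfolding shift .
    qed
    have "(\<Sum>k<?M. \<phi> (int k)) = (\<Sum>j<N. \<Sum>k\<in>{j * p..<j * p + p}. \<phi> (int k))"
      by (simp only: sum.nat_group)
    also have "\<dots> = (\<Sum>j<N. \<Sum>k\<in>{j * p..<j * p + p}. (norm (?q (int k)))\<^sup>2) - real p * (\<Sum>j<N. (norm (?m (int j)))\<^sup>2)"
      unfolding block by (simp add: sum_subtractf sum_distrib_left)
    finally show ?thesis by (simp only: sum.nat_group)
  qed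
  moreover have "(1 / real ?M) *\<^sub>R ((\<Sum>k<?M. (norm (?q (int k)))\<^sup>2) - real p * (\<Sum>k<N. (norm (?m (int k)))\<^sup>2))
      = mesh_energy f ?M - mesh_energy f N"
    using p N unfolding mesh_energy_def by (simp add: diff_divide_distrib)
  ultimately show ?thesis by simp
qed

lemma mesh_energy_mono:
  fixes f :: "real \<Rightarrow> 'b::real_inner"
  assumes "N > 0" "p > (0::nat)"
  shows "mesh_energy f N \<le> mesh_energy f (N * p)"
proof -
  have "0 \<le> mesh_energy f (N * p) - mesh_energy f N"
    by (rule has_integral_nonneg[OF has_integral_mesh_slope_diff[OF assms]]) simp
  then show ?thesis by simp
qed

lemma mesh_energy_le:
  fixes f :: "real \<Rightarrow> 'b::real_normed_vector"
  assumes lip: "\<And>s t. norm (f s - f t) \<le> L * \<bar>s - t\<bar>" and "N > 0"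
  shows "mesh_energy f N \<le> L\<^sup>2"
proof -
  have "(\<Sum>k<N. (norm (mesh_slope f (real N) (int k)))\<^sup>2) \<le> (\<Sum>k<N. L\<^sup>2)"
    using norm_mesh_slope_le[OF lip] \<open>N > 0\<close> by (intro sum_mono power_mono) auto
  then show ?thesis using \<open>N > 0\<close> by (simp add: mesh_energy_def field_simps)
qed

text \<open>The nonnegative Lebesgue integral of the whole series is the finite sum of the
  \<open>I k\<close>, so the series converges almost everywhere; monotone convergence of gauge
  integrals then makes its sum integrable.\<close>

lemma beppo_levi_sums:
  fixes d :: "nat \<Rightarrow> real \<Rightarrow> real"
  assumes meas: "\<And>k. d k \<in> borel_measurable borel" and pos: "\<And>k t. 0 \<le> d k t"
    and int: "\<And>k. (d k has_integral I k) {a..b}" and sm: "summable I"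
  obtains N R where "negligible N" "R integrable_on {a..b}"
    "\<And>t. t \<in> {a..b} \<Longrightarrow> t \<notin> N \<Longrightarrow> (\<lambda>k. d k t) sums R t"
proof -
  have I: "0 \<le> I k" for k using has_integral_nonneg[OF int] pos by blast
  let ?F = "\<lambda>t. (\<Sum>k. ennreal (d k t) * indicator {a..b} t)"
  have "(\<integral>\<^sup>+t. ?F t \<partial>lborel) = (\<Sum>k. \<integral>\<^sup>+t. ennreal (d k t) * indicator {a..b} t \<partial>lborel)"
    using meas by (intro nn_integral_suminf) simp
  also have "\<dots> = (\<Sum>k. ennreal (I k))"
    using nn_integral_has_integral_lebesgue'[OF pos int] by simp
  also have "\<dots> = ennreal (\<Sum>k. I k)" using I sm by (intro suminf_ennreal2) auto
  finally have "(\<integral>\<^sup>+t. ?F t \<partial>lborel) \<noteq> \<infinity>" by simp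
  then have "AE t in lborel. ?F t \<noteq> \<infinity>"
    using meas by (intro nn_integral_PInf_AE) simp_all
  then obtain N where N: "negligible N" "\<And>t. t \<notin> N \<Longrightarrow> ?F t \<noteq> \<infinity>"
    using AE_lborel_obtain_negligible by blast
  have sd: "summable (\<lambda>k. d k t)" if "t \<in> {a..b}" "t \<notin> N" for t
    using N(2)[OF that(2)] that(1) pos by (intro summable_suminf_not_top) auto
  \<comment> \<open>Limit and partial sums are both set to 0 on \<open>N\<close>, so that
    convergence holds at every point of \<open>{a..b}\<close>.\<close>
  define R where "R = (\<lambda>t. if t \<in> N then 0 else \<Sum>k. d k t)"
  let ?P = "\<lambda>n t. if t \<in> N then 0 else \<Sum>k<n. d k t"
  have P: "(?P n has_integral (\<Sum>k<n. I k)) {a..b}" for n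
  proof (rule has_integral_spike[OF N(1)])
    show "((\<lambda>t. \<Sum>k<n. d k t) has_integral (\<Sum>k<n. I k)) {a..b}"
      using int by (intro has_integral_sum) auto
  qed simp
  have "R integrable_on {a..b}"
  proof (rule monotone_convergence_increasing[THEN conjunct1])
    show "?P n integrable_on {a..b}" for n using P by blast
    show "?P n t \<le> ?P (Suc n) t" for n t using pos by simp
    show "(\<lambda>n. ?P n t) \<longlonglongrightarrow> R t" if "t \<in> {a..b}" for t
      using sd[OF that] by (auto simp: R_def intro: summable_LIMSEQ)
    have "\<bar>integral {a..b} (?P n)\<bar> \<le> suminf I" for n
      using integral_unique[OF P] sum_le_suminf[OF sm, of "{..<n}"] I by (simp add: sum_nonneg)
    then show "bounded (range (\<lambda>n. integral {a..b} (?P n)))"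
      by (auto simp: bounded_iff)
  qed
  then show ?thesis
    using that[OF N(1)] sd by (simp add: R_def summable_sums)
qed


section \<open>Step functions on a mesh and convergence of their primitives\<close>

lemma isCont_step:
  fixes \<phi> :: "int \<Rightarrow> 'b::t2_space"
  assumes "(N::real) * t \<notin> \<int>"
  shows "isCont (\<lambda>s. \<phi> \<lfloor>N * s\<rfloor>) t"
proof -
  have "((\<lambda>s. N * s) \<longlongrightarrow> N * t) (at t)" by (intro tendsto_intros)
  then have "\<forall>\<^sub>F s in at t. \<lfloor>N * s\<rfloor> = \<lfloor>N * t\<rfloor>"
    using assms by (rule eventually_floor_eq)
  then have "\<forall>\<^sub>F s in at t. \<phi> \<lfloor>N * s\<rfloor> = \<phi> \<lfloor>N * t\<rfloor>"
    by eventually_elim simp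
  then show ?thesis unfolding isCont_def by (rule tendsto_eventually)
qed

lemma integrable_step:
  fixes \<phi> :: "int \<Rightarrow> 'b::banach"
  assumes "(N::real) > 0"
  shows "(\<lambda>t. \<phi> \<lfloor>N * t\<rfloor>) integrable_on {a..b}"
proof -
  have "(\<lambda>t. 1 *\<^sub>R \<phi> \<lfloor>N * t\<rfloor>) integrable_on {a..b}"
    by (rule integrable_weighted_step[OF integrable_continuous_real[OF continuous_on_const] assms])
  then show ?thesis by simp
qed

text \<open>At mesh points the integral of the slopes reproduces the increments of \<open>f\<close>
  exactly. The last mesh point before \<open>t\<close> is within \<open>1 / N\<close>, and from
  there to \<open>t\<close> the integral and \<open>f\<close> each change by at most
  \<open>L / N\<close>.\<close>

lemma integral_mesh_slope_tendsto:
  fixes f :: "real \<Rightarrow> 'b::banach"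
  assumes lip: "\<And>s t. norm (f s - f t) \<le> L * \<bar>s - t\<bar>" and M: "filterlim M at_top sequentially" "\<And>n. M n > (0::nat)"
    and t: "t \<ge> 0"
  shows "(\<lambda>n. integral {0..t} (\<lambda>u. mesh_slope f (M n) \<lfloor>M n * u\<rfloor>)) \<longlonglongrightarrow> f t - f 0"
proof -
  have L: "L \<ge> 0" using order_trans[OF norm_ge_zero lip[of 1 0]] by simp
  have bound: "norm (integral {0..t} (\<lambda>u. mesh_slope f N \<lfloor>real N * u\<rfloor>) - (f t - f 0)) \<le> 2 * L * (1 / N)"
    if N: "N > 0" for N :: nat
  proof -
    define k where "k = nat \<lfloor>N * t\<rfloor>"
    let ?g = "\<lambda>u. mesh_slope f N \<lfloor>real N * u\<rfloor>"
    have "0 \<le> N * t" using t by simp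
    then have "real k \<le> N * t" "N * t \<le> real k + 1"
      unfolding k_def by linarith+
    then have "real k / N \<le> N * t / N" "N * t / N \<le> (real k + 1) / N"
      by (intro divide_right_mono; simp)+
    then have kt: "real k / N \<le> t" "t - real k / N \<le> 1 / N" using N by (simp_all add: add_divide_distrib)
    have gint: "?g integrable_on {a..b}" for a b
      using integrable_step[of "real N" "mesh_slope f N"] N by simp
    have I1: "integral {0..k / N} ?g = f (k / N) - f 0"
      using integral_unique[OF has_integral_step[of N "mesh_slope f N" k]] sum_mesh_slope[of N f 0 k] N by simp
    have I2: "integral {0..k / N} ?g + integral {k / N..t} ?g = integral {0..t} ?g"
      using kt N by (intro Henstock_Kurzweil_Integration.integral_combine gint) auto
    have eq: "integral {0..t} ?g - (f t - f 0) = integral {k / N..t} ?g - (f t - f (k / N))"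
      unfolding I2[symmetric] I1 by simp
    have "norm (integral {k / N..t} ?g) \<le> integral {k / N..t} (\<lambda>_. L)"
      using norm_mesh_slope_le[OF lip] N by (intro integral_norm_bound_integral gint) auto
    moreover have "integral {k / N..t} (\<lambda>_. L) \<le> L * (1 / N)"
      using kt mult_left_mono[OF kt(2) L] by (simp add: mult.commute)
    moreover have "norm (f t - f (k / N)) \<le> L * (1 / N)"
      using lip[of t "k / N"] kt mult_left_mono[OF kt(2) L] by simp
    ultimately show ?thesis
      unfolding eq using norm_triangle_ineq4[of "integral {k / N..t} ?g" "f t - f (k / N)"] by linarith
  qed
  have "(\<lambda>n. integral {0..t} (\<lambda>u. mesh_slope f (M n) \<lfloor>M n * u\<rfloor>) - (f t - f 0)) \<longlonglongrightarrow> 0"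
  proof (rule Lim_null_comparison)
    show "\<forall>\<^sub>F n in sequentially. norm (integral {0..t} (\<lambda>u. mesh_slope f (M n) \<lfloor>M n * u\<rfloor>) - (f t - f 0)) \<le> 2 * L * (1 / M n)"
      using bound M(2) by (intro always_eventually) auto
    have "filterlim (\<lambda>n. real (M n)) at_top sequentially"
      using filterlim_compose[OF filterlim_real_sequentially M(1)] by simp
    then have "(\<lambda>n. 2 * L * (1 / real (M n))) \<longlonglongrightarrow> 2 * L * 0"
      by (intro tendsto_mult tendsto_const tendsto_divide_0[where c = 1] filterlim_at_top_imp_at_infinity)
    then show "(\<lambda>n. 2 * L * (1 / M n)) \<longlonglongrightarrow> 0" by simp
  qed
  then show ?thesis by (simp add: LIM_zero_iff)
qed

lemma negligible_countable:
  fixes S :: "'c::euclidean_space set"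
  assumes "countable S"
  shows "negligible S"
  unfolding negligible_iff_null_sets
  by (rule null_sets_completionI[OF countable_imp_null_set_lborel[OF assms]])

lemma integral_diff_Icc:
  fixes h :: "real \<Rightarrow> 'b::banach"
  assumes "a \<le> t" "t \<le> s" "h integrable_on {a..s}"
  shows "integral {a..s} h - integral {a..t} h = integral {t..s} h"
  unfolding Henstock_Kurzweil_Integration.integral_combine[OF assms, symmetric] by simp

text \<open>Along powers of 2 the energies increase and are bounded by \<open>L\<^sup>2\<close>,
  hence Cauchy. The rate \<open>(1/4) ^ k\<close> for squared norms is chosen so that the increments
  of the slopes have \<open>L1\<close> norms at most \<open>(1/2) ^ k\<close>.\<close>

lemma summable_mesh_refinement:
  fixes f :: "real \<Rightarrow> 'b::real_inner"
  assumes lip: "\<And>s t. norm (f s - f t) \<le> L * \<bar>s - t\<bar>"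
  obtains m :: "nat \<Rightarrow> nat" where "strict_mono m"
    "\<And>k. mesh_energy f (2 ^ m (Suc k)) - mesh_energy f (2 ^ m k) \<le> (1 / 4) ^ k"
proof -
  have mono: "mesh_energy f (2 ^ n) \<le> mesh_energy f (2 ^ n')" if "n \<le> n'" for n n'
    using mesh_energy_mono[of "2 ^ n" "2 ^ (n' - n)" f] that by (simp flip: power_add)
  have "convergent (\<lambda>n. mesh_energy f (2 ^ n))"
  proof (rule Bseq_mono_convergent)
    have "0 \<le> mesh_energy f N" for N by (simp add: mesh_energy_def sum_nonneg)
    then show "Bseq (\<lambda>n. mesh_energy f (2 ^ n))"
      using mesh_energy_le[OF lip] by (intro BseqI'[of _ "L\<^sup>2"]) simp
  qed (use mono in blast)
  then have Cau: "Cauchy (\<lambda>n. mesh_energy f (2 ^ n))" by (rule convergent_Cauchy)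
  have "\<exists>i. \<forall>n\<ge>i. \<forall>n'\<ge>i. norm (mesh_energy f (2 ^ n) - mesh_energy f (2 ^ n')) < (1 / 4) ^ k" for k
    using CauchyD[OF Cau, of "(1 / 4) ^ k"] by simp
  then obtain i where i: "\<And>k n n'. n \<ge> i k \<Longrightarrow> n' \<ge> i k \<Longrightarrow>
      norm (mesh_energy f (2 ^ n) - mesh_energy f (2 ^ n')) < (1 / 4) ^ k" by metis
  \<comment> \<open>The summand \<open>k\<close> forces strict growth, the partial sum forces
    \<open>i k \<le> m k\<close>.\<close>
  define m where "m = (\<lambda>k. k + (\<Sum>j\<le>k. i j))"
  have m: "i k \<le> m k" "m k < m (Suc k)" for k
    using member_le_sum[of k "{..k}" i] by (auto simp: m_def)
  show ?thesis
  proof (rule that)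
    show "strict_mono m" using m by (simp add: strict_mono_Suc_iff)
    show "mesh_energy f (2 ^ m (Suc k)) - mesh_energy f (2 ^ m k) \<le> (1 / 4) ^ k" for k
      using i[of k "m (Suc k)" "m k"] m[of k] by simp
  qed
qed

text \<open>Along the refining meshes the increments \<open>|g\<^sub>k\<^sub>+\<^sub>1 - g\<^sub>k|\<close> of the slopes have an integrable sum \<open>R\<close>.
  The error of \<open>\<integral> g\<^sub>k\<close> as an approximation of \<open>f\<close> is controlled by the primitive of the tail of \<open>R\<close>,
  a real function, so Lebesgue differentiation is only needed for \<open>R\<close>.\<close>

lemma lipschitz_differentiable_ae_unit:
  fixes f :: "real \<Rightarrow> 'b::{real_inner,banach}"
  assumes lip: "\<And>s t. norm (f s - f t) \<le> L * \<bar>s - t\<bar>"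
  obtains N where "negligible N"
    "\<And>t. t \<in> {0<..<1} \<Longrightarrow> t \<notin> N \<Longrightarrow> \<exists>D. (f has_vector_derivative D) (at t within {0..1})"
proof -
  obtain m where m: "strict_mono m"
    "\<And>k. mesh_energy f (2 ^ m (Suc k)) - mesh_energy f (2 ^ m k) \<le> (1 / 4) ^ k"
    using summable_mesh_refinement[OF lip] by blast
  define M where "M = (\<lambda>k. (2::nat) ^ m k)"
  have M0: "M k > 0" "real (M k) > 0" for k by (simp_all add: M_def)
  have Minf: "filterlim M at_top sequentially"
    unfolding M_def by (rule filterlim_at_top_mono[OF filterlim_subseq[OF m(1)]])
      (auto intro!: always_eventually less_imp_le less_exp)
  define g where "g = (\<lambda>k (t::real). mesh_slope f (M k) \<lfloor>real (M k) * t\<rfloor>)"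
  define d where "d = (\<lambda>k (t::real). norm (g (Suc k) t - g k t))"
  have g_int: "g k integrable_on {a..b}" for k a b
    unfolding g_def by (intro integrable_step M0)
  have refine: "M (Suc k) = M k * 2 ^ (m (Suc k) - m k)" for k
    using strict_mono_less_eq[OF m(1), of k "Suc k"] by (simp add: M_def flip: power_add)
  \<comment> \<open>Both slopes are functions of the index in the finer mesh; hence the increment is
    a step function, Borel measurable and integrable.\<close>
  have d_step: "\<exists>\<psi>. d k = (\<lambda>t. \<psi> \<lfloor>real (M (Suc k)) * t\<rfloor>)" for k
  proof -
    define p where "p = int (2 ^ (m (Suc k) - m k))"
    have p: "p > 0" by (simp add: p_def)
    have "real (M (Suc k)) = real (M k) * real_of_int p" by (simp add: refine[of k] p_def)
    then have "real (M k) * t = real (M (Suc k)) * t / real_of_int p" for t using p by simp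
    then have "\<lfloor>real (M k) * t\<rfloor> = \<lfloor>real (M (Suc k)) * t\<rfloor> div p" for t
      using p by (simp only: floor_divide_real_eq_div less_imp_le)
    then show ?thesis
      by (intro exI[of _ "\<lambda>j. norm (mesh_slope f (M (Suc k)) j - mesh_slope f (M k) (j div p))"])
        (simp add: d_def g_def)
  qed
  have d_meas: "d k \<in> borel_measurable borel" for k
  proof -
    obtain \<psi> where "d k = (\<lambda>t. \<psi> \<lfloor>real (M (Suc k)) * t\<rfloor>)" using d_step by blast
    moreover have "(\<lambda>t. \<psi> \<lfloor>real (M (Suc k)) * t\<rfloor>) \<in> borel_measurable borel"
      by (rule measurable_compose[of "\<lambda>t. \<lfloor>real (M (Suc k)) * t\<rfloor>" borel "count_space UNIV"]) simp_all
    ultimately show ?thesis by simp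
  qed
  have d_int: "d k integrable_on {a..b}" for k a b
    using d_step[of k] M0(2)[of "Suc k"] integrable_step by metis
  have d_le: "integral {0..1} (d k) \<le> (1 / 2) ^ k" for k
  proof -
    have sq: "((\<lambda>t. (d k t)\<^sup>2) has_integral (mesh_energy f (M (Suc k)) - mesh_energy f (M k))) {0..1}"
      using has_integral_mesh_slope_diff[OF M0(1)[of k], of "2 ^ (m (Suc k) - m k)" f]
      unfolding d_def g_def refine[of k, symmetric] by simp
    have "integral {0..1} (d k) \<le> integral {0..1} (\<lambda>t. (1 / 2) * (1 / 2) ^ k + (1 / 2 * 2 ^ k) * (d k t)\<^sup>2)"
    proof (intro integral_le d_int)
      show "(\<lambda>t. (1 / 2) * (1 / 2) ^ k + (1 / 2 * 2 ^ k) * (d k t)\<^sup>2) integrable_on {0..1}"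
        using sq by (intro integrable_add integrable_on_const integrable_on_mult_right) auto
      fix t
      \<comment> \<open>Young's inequality with weight \<open>2 ^ k\<close> in place of
        Cauchy-Schwarz; against the energy bound \<open>(1/4) ^ k\<close> each of the two terms
        contributes half of \<open>(1/2) ^ k\<close>.\<close>
      have "0 \<le> (1 / 2) * (1 / 2) ^ k * (1 - 2 ^ k * d k t)\<^sup>2" by simp
      also have "\<dots> = (1 / 2) * (1 / 2) ^ k - d k t + (1 / 2 * 2 ^ k) * (d k t)\<^sup>2"
        by (simp add: power2_eq_square algebra_simps power_one_over)
      finally show "d k t \<le> (1 / 2) * (1 / 2) ^ k + (1 / 2 * 2 ^ k) * (d k t)\<^sup>2" by simp
    qed
    also have "\<dots> = (1 / 2) * (1 / 2) ^ k + (1 / 2 * 2 ^ k) * (mesh_energy f (M (Suc k)) - mesh_energy f (M k))"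
    proof (rule integral_unique)
      show "((\<lambda>t. (1 / 2) * (1 / 2) ^ k + (1 / 2 * 2 ^ k) * (d k t)\<^sup>2) has_integral
          (1 / 2) * (1 / 2) ^ k + (1 / 2 * 2 ^ k) * (mesh_energy f (M (Suc k)) - mesh_energy f (M k))) {0..1}"
      proof (rule has_integral_add)
        show "((\<lambda>t::real. (1 / 2) * (1 / 2) ^ k) has_integral ((1 / 2) * (1 / 2) ^ k :: real)) {0..1}"
          using has_integral_const_real[of "(1 / 2) * (1 / 2) ^ k :: real" 0 1] by simp
      qed (rule has_integral_mult_right[OF sq])
    qed
    also have "\<dots> \<le> (1 / 2) * (1 / 2) ^ k + (1 / 2 * 2 ^ k) * (1 / 4) ^ k"
      using m(2)[of k] by (intro add_left_mono mult_left_mono) (auto simp: M_def)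
    also have "\<dots> = (1 / 2) ^ k"
    proof -
      have "(2::real) ^ k * (1 / 4) ^ k = (1 / 2) ^ k" by (simp flip: power_mult_distrib)
      then show ?thesis by (simp add: mult.assoc)
    qed
    finally show ?thesis .
  qed
  have "summable (\<lambda>k. integral {0..1} (d k))"
  proof (rule summable_comparison_test')
    show "summable (\<lambda>k. (1 / 2 :: real) ^ k)" by (simp add: summable_geometric)
    show "norm (integral {0..1} (d k)) \<le> (1 / 2) ^ k" for k
      using d_le[of k] integral_nonneg[OF d_int[of k]] by (simp add: d_def)
  qed
  then obtain N1 R where N1: "negligible N1" and R: "R integrable_on {0..1}"
    "\<And>t. t \<in> {0..1} \<Longrightarrow> t \<notin> N1 \<Longrightarrow> (\<lambda>k. d k t) sums R t"
    using beppo_levi_sums[of d "\<lambda>k. integral {0..1} (d k)" 0 1] d_meas d_int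
    by (auto simp: d_def integrable_integral)
  obtain N2 where N2: "negligible N2"
    "\<And>t. t \<in> {0<..<1} \<Longrightarrow> t \<notin> N2 \<Longrightarrow> ((\<lambda>u. integral {0..u} R) has_vector_derivative R t) (at t within {0..1})"
    using integral_has_vector_derivative_ae[OF R(1)] by blast
  \<comment> \<open>Mesh points of all levels: off this countable set every \<open>g k\<close> and
    every \<open>d k\<close> is continuous.\<close>
  define N3 where "N3 = (\<Union>k. range (\<lambda>j::int. j / M k))"
  have N3: "negligible N3" unfolding N3_def by (intro negligible_countable) auto
  define P where "P = (\<lambda>k (t::real). \<Sum>i<k. d i t)"
  have P_int: "P k integrable_on {a..b}" for k a b
    unfolding P_def by (intro integrable_sum d_int) auto
  have P_le: "P n t - P k t \<le> R t - P k t" if "t \<in> {0..1}" "t \<notin> N1" for n k t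
    using sum_le_suminf[OF sums_summable[OF R(2)[OF that]], of "{..<n}"] sums_unique[OF R(2)[OF that]]
    by (simp add: P_def d_def)
  have g_le: "norm (g n t - g k t) \<le> P n t - P k t" if "k \<le> n" for n k t
    using that
  proof (induction n rule: dec_induct)
    case (step n)
    have "norm (g (Suc n) t - g k t) \<le> d n t + norm (g n t - g k t)"
      unfolding d_def using norm_triangle_ineq[of "g (Suc n) t - g n t" "g n t - g k t"] by simp
    then show ?case using step by (simp add: P_def)
  qed simp
  \<comment> \<open>Let \<open>n\<close> tend to infinity in \<open>|\<integral> (g n - g k)| \<le>
    \<integral> (P n - P k) \<le> \<integral> (R - P k)\<close>: the integrals of \<open>g n\<close>
    converge to the increments of \<open>f\<close>.\<close>
  have tail: "norm (f s - f t - (integral {0..s} (g k) - integral {0..t} (g k)))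
      \<le> \<bar>integral {0..s} (\<lambda>u. R u - P k u) - integral {0..t} (\<lambda>u. R u - P k u)\<bar>"
    if st: "s \<in> {0..1}" "t \<in> {0..1}" for s t k
  proof -
    have ordered: "norm (f s - f t - (integral {0..s} (g k) - integral {0..t} (g k)))
        \<le> \<bar>integral {0..s} (\<lambda>u. R u - P k u) - integral {0..t} (\<lambda>u. R u - P k u)\<bar>"
      if st: "0 \<le> t" "t \<le> s" "s \<le> 1" for s t
    proof -
      have RP: "(\<lambda>u. R u - P k u) integrable_on {0..s}"
        using st by (intro integrable_diff P_int integrable_subinterval_real[OF R(1)]) auto
      have g_lim: "(\<lambda>n. integral {t..s} (g n)) \<longlonglongrightarrow> f s - f t"
      proof -
        have "(\<lambda>n. integral {0..s} (g n) - integral {0..t} (g n)) \<longlonglongrightarrow> (f s - f 0) - (f t - f 0)"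
          unfolding g_def using st by (intro tendsto_diff integral_mesh_slope_tendsto[OF lip Minf M0(1)]) auto
        then show ?thesis using st by (simp add: integral_diff_Icc[OF _ _ g_int])
      qed
      have "norm (integral {t..s} (g n) - integral {t..s} (g k)) \<le> integral {t..s} (\<lambda>u. R u - P k u)"
        if "k \<le> n" for n
      proof -
        \<comment> \<open>The comparison of \<open>P n\<close> with \<open>R\<close> is known only
          off \<open>N1\<close>, so the integrand is altered there first.\<close>
        let ?Q = "\<lambda>u. if u \<in> N1 then R u - P k u else P n u - P k u"
        have RPts: "(\<lambda>u. R u - P k u) integrable_on {t..s}"
          using st by (intro integrable_subinterval_real[OF RP]) auto
        have "norm (integral {t..s} (\<lambda>u. g n u - g k u)) \<le> integral {t..s} (\<lambda>u. P n u - P k u)"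
          using g_le[OF that] by (intro integral_norm_bound_integral integrable_diff g_int P_int)
        also have "\<dots> = integral {t..s} ?Q"
          by (rule integral_spike[OF N1]) simp
        also have "\<dots> \<le> integral {t..s} (\<lambda>u. R u - P k u)"
        proof (rule integral_le[OF _ RPts])
          show "?Q integrable_on {t..s}"
            by (rule integrable_spike[OF integrable_diff[OF P_int P_int] N1]) simp
        qed (use P_le st in auto)
        finally show ?thesis by (simp add: integral_diff g_int)
      qed
      then have "norm (f s - f t - integral {t..s} (g k)) \<le> integral {t..s} (\<lambda>u. R u - P k u)"
        by (intro Lim_bounded[OF tendsto_norm[OF tendsto_diff[OF g_lim tendsto_const]], of k]) auto
      then show ?thesis
        using st by (simp add: integral_diff_Icc[OF _ _ g_int] integral_diff_Icc[OF _ _ RP])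
    qed
    show ?thesis
    proof (cases "t \<le> s")
      case True
      then show ?thesis using ordered[of t s] st by simp
    next
      case False
      then have "norm (f t - f s - (integral {0..t} (g k) - integral {0..s} (g k)))
        \<le> \<bar>integral {0..t} (\<lambda>u. R u - P k u) - integral {0..s} (\<lambda>u. R u - P k u)\<bar>"
        using ordered[of s t] st by simp
      moreover have "f s - f t - (integral {0..s} (g k) - integral {0..t} (g k))
          = - (f t - f s - (integral {0..t} (g k) - integral {0..s} (g k)))" by simp
      ultimately show ?thesis by (simp only: norm_minus_cancel abs_minus_commute)
    qed
  qed
  show ?thesis
  proof (rule that)
    show "negligible (N1 \<union> N2 \<union> N3)" using N1 N2(1) N3 by simp
    fix t assume t: "t \<in> {0<..<1}" "t \<notin> N1 \<union> N2 \<union> N3"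
    then have t01: "t \<in> {0..1}" "t \<notin> N1" "t \<notin> N2" by auto
    have not_Int: "real (M k) * t \<notin> \<int>" for k
    proof
      assume "real (M k) * t \<in> \<int>"
      then obtain j :: int where "real (M k) * t = j" by (auto simp: Ints_def)
      then have "t = j / M k" using M0(2)[of k] by (simp add: field_simps)
      then show False using t(2) by (auto simp: N3_def)
    qed
    have g_der: "((\<lambda>u. integral {0..u} (g k)) has_vector_derivative g k t) (at t within {0..1})" for k
    proof -
      have "continuous (at t within {0..1}) (g k)"
        unfolding g_def
        by (rule continuous_at_imp_continuous_at_within,
            rule isCont_step[where \<phi> = "mesh_slope f (real (M k))", OF not_Int])
      then show ?thesis
        using integral_has_vector_derivative_continuous_at[OF g_int _ finite.emptyI, of t 0 1 k] t01 by simp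
    qed
    have d_der: "((\<lambda>u. integral {0..u} (d k)) has_vector_derivative d k t) (at t within {0..1})" for k
    proof -
      obtain \<psi> where \<psi>: "d k = (\<lambda>t. \<psi> \<lfloor>real (M (Suc k)) * t\<rfloor>)" using d_step by blast
      have "continuous (at t within {0..1}) (d k)"
        unfolding \<psi>
        by (rule continuous_at_imp_continuous_at_within, rule isCont_step[where \<phi> = \<psi>, OF not_Int])
      then show ?thesis
        using integral_has_vector_derivative_continuous_at[OF d_int _ finite.emptyI, of t 0 1 k] t01 by simp
    qed
    \<comment> \<open>\<open>R\<close> is handled by Lebesgue differentiation and the finitely many
      \<open>d i\<close> by continuity at \<open>t\<close>, so one null set serves all
      \<open>k\<close>.\<close>
    have RP_der: "((\<lambda>u. integral {0..u} (\<lambda>u. R u - P k u)) has_vector_derivative (R t - P k t)) (at t within {0..1})" for k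
    proof (rule has_vector_derivative_transform)
      show "((\<lambda>u. integral {0..u} R - (\<Sum>i<k. integral {0..u} (d i))) has_vector_derivative (R t - P k t)) (at t within {0..1})"
        unfolding P_def using N2(2)[OF t(1) t01(3)]
        by (intro has_vector_derivative_diff has_vector_derivative_sum d_der)
      show "integral {0..u} (\<lambda>u. R u - P k u) = integral {0..u} R - (\<Sum>i<k. integral {0..u} (d i))"
        if "u \<in> {0..1}" for u
      proof -
        have "R integrable_on {0..u}" using that by (intro integrable_subinterval_real[OF R(1)]) auto
        then show ?thesis
          using P_int[of k 0 u] d_int by (simp add: integral_diff) (simp add: P_def integral_sum)
      qed
    qed (rule t01)
    have "(\<lambda>k. P k t) \<longlonglongrightarrow> R t" unfolding P_def using R(2)[OF t01(1,2)] by (simp add: sums_def)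
    then have RP_lim: "(\<lambda>k. R t - P k t) \<longlonglongrightarrow> 0"
      using tendsto_diff[OF tendsto_const[of "R t"]] by fastforce
    have gR: "norm (g n t - g k t) \<le> R t - P k t" if "k \<le> n" for n k
      using g_le[OF that, of t] P_le[OF t01(1,2), of n k] by linarith
    have "Cauchy (\<lambda>k. g k t)"
    proof (rule metric_CauchyI)
      fix e :: real assume "e > 0"
      then have "\<forall>\<^sub>F k in sequentially. R t - P k t < e / 2"
        by (intro order_tendstoD(2)[OF RP_lim]) simp
      then obtain k where k: "R t - P k t < e / 2" using eventually_happens by force
      have "dist (g i t) (g j t) < e" if "i \<ge> k" "j \<ge> k" for i j
        using gR[OF that(1)] gR[OF that(2)] k dist_triangle2[of "g i t" "g j t" "g k t"]
        by (simp add: dist_norm)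
      then show "\<exists>k. \<forall>i\<ge>k. \<forall>j\<ge>k. dist (g i t) (g j t) < e" by blast
    qed
    then obtain D where D: "(\<lambda>k. g k t) \<longlonglongrightarrow> D" using Cauchy_convergent convergent_def by blast
    have gD: "norm (D - g k t) \<le> R t - P k t" for k
      using gR by (intro Lim_bounded[OF tendsto_norm[OF tendsto_diff[OF D tendsto_const]], of k]) auto
    have "(f has_vector_derivative D) (at t within {0..1})"
      unfolding has_vector_derivative_iff_bound
    proof (intro allI impI)
      fix e :: real assume "e > 0"
      \<comment> \<open>Four equal errors: the difference quotient of the primitive of
        \<open>g k\<close>, that of the primitive of \<open>R - P k\<close>, the value
        \<open>R t - P k t\<close>, and the distance of \<open>g k t\<close> from
        \<open>D\<close>.\<close>
      then have e4: "e / 4 > 0" by simp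
      have "\<forall>\<^sub>F k in sequentially. R t - P k t < e / 4"
        using e4 by (rule order_tendstoD(2)[OF RP_lim])
      then obtain k where k: "R t - P k t < e / 4" using eventually_happens by force
      obtain d1 where d1: "d1 > 0" "\<And>s. s \<in> {0..1} \<Longrightarrow> \<bar>s - t\<bar> < d1 \<Longrightarrow>
          norm (integral {0..s} (g k) - integral {0..t} (g k) - (s - t) *\<^sub>R g k t) \<le> e / 4 * \<bar>s - t\<bar>"
        using g_der[of k, unfolded has_vector_derivative_iff_bound, rule_format, OF e4] by blast
      obtain d2 where d2: "d2 > 0" "\<And>s. s \<in> {0..1} \<Longrightarrow> \<bar>s - t\<bar> < d2 \<Longrightarrow>
          norm (integral {0..s} (\<lambda>u. R u - P k u) - integral {0..t} (\<lambda>u. R u - P k u) - (s - t) *\<^sub>R (R t - P k t)) \<le> e / 4 * \<bar>s - t\<bar>"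
        using RP_der[of k, unfolded has_vector_derivative_iff_bound, rule_format, OF e4] by blast
      show "\<exists>d>0. \<forall>s\<in>{0..1}. \<bar>s - t\<bar> < d \<longrightarrow> norm (f s - f t - (s - t) *\<^sub>R D) \<le> e * \<bar>s - t\<bar>"
      proof (intro exI[of _ "min d1 d2"] conjI ballI impI)
        show "min d1 d2 > 0" using d1 d2 by simp
        fix s :: real assume s: "s \<in> {0..1}" "\<bar>s - t\<bar> < min d1 d2"
        let ?X = "integral {0..s} (g k) - integral {0..t} (g k)"
        let ?U = "integral {0..s} (\<lambda>u. R u - P k u) - integral {0..t} (\<lambda>u. R u - P k u)"
        have "norm (?X - (s - t) *\<^sub>R g k t) \<le> e / 4 * \<bar>s - t\<bar>" using d1(2) s by simp
        moreover have "\<bar>?U\<bar> \<le> e / 4 * \<bar>s - t\<bar> + e / 4 * \<bar>s - t\<bar>"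
        proof -
          have "\<bar>?U - (s - t) * (R t - P k t)\<bar> \<le> e / 4 * \<bar>s - t\<bar>" using d2(2) s by simp
          moreover have "0 \<le> R t - P k t" using gR[of k k] by simp
          then have "\<bar>(s - t) * (R t - P k t)\<bar> \<le> e / 4 * \<bar>s - t\<bar>"
            using k unfolding abs_mult mult.commute[of "\<bar>s - t\<bar>"] by (intro mult_right_mono) auto
          ultimately show ?thesis by linarith
        qed
        moreover have "norm ((s - t) *\<^sub>R (g k t - D)) \<le> \<bar>s - t\<bar> * (e / 4)"
          using gD[of k] k unfolding norm_scaleR
          by (intro mult_mono) (auto simp: norm_minus_commute)
        moreover have "norm (f s - f t - ?X) \<le> \<bar>?U\<bar>" using tail s(1) t01(1) by blast
        moreover have "f s - f t - (s - t) *\<^sub>R D = (f s - f t - ?X) + ((?X - (s - t) *\<^sub>R g k t) + (s - t) *\<^sub>R (g k t - D))"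
          by (simp add: algebra_simps)
        moreover have "norm (x + (y + z)) \<le> norm x + (norm y + norm z)" for x y z :: 'b
          by (intro norm_triangle_le add_left_mono norm_triangle_ineq)
        moreover have "\<bar>s - t\<bar> * (e / 4) = e / 4 * \<bar>s - t\<bar>" by simp
        moreover have "4 * (e / 4 * \<bar>s - t\<bar>) = e * \<bar>s - t\<bar>" by simp
        ultimately show "norm (f s - f t - (s - t) *\<^sub>R D) \<le> e * \<bar>s - t\<bar>"
          by (smt (verit))
      qed
    qed
    then show "\<exists>D. (f has_vector_derivative D) (at t within {0..1})" by blast
  qed
qed

text \<open>Integer translates of the open unit interval cover the line up to the integers, which
  therefore join the exceptional set.\<close>

theorem lipschitz_differentiable_ae:
  fixes f :: "real \<Rightarrow> 'b::{real_inner,banach}"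
  assumes lip: "\<And>s t. norm (f s - f t) \<le> L * \<bar>s - t\<bar>"
  obtains N where "negligible N" "\<And>t. t \<notin> N \<Longrightarrow> \<exists>D. (f has_vector_derivative D) (at t)"
proof -
  have "\<exists>N. negligible N \<and> (\<forall>t. t \<in> {0<..<1} \<and> t \<notin> N \<longrightarrow>
      (\<exists>D. ((\<lambda>t. f (t + real_of_int i)) has_vector_derivative D) (at t within {0..1})))" for i
  proof -
    have "norm (f (s + real_of_int i) - f (t + real_of_int i)) \<le> L * \<bar>s - t\<bar>" for s t
      using lip[of "s + real_of_int i" "t + real_of_int i"] by simp
    from lipschitz_differentiable_ae_unit[OF this] show ?thesis by metis
  qed
  then obtain N where N: "\<And>i. negligible (N i)" "\<And>i t. t \<in> {0<..<1} \<Longrightarrow> t \<notin> N i \<Longrightarrow>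
      \<exists>D. ((\<lambda>t. f (t + real_of_int i)) has_vector_derivative D) (at t within {0..1})"
    by metis
  show ?thesis
  proof (rule that)
    show "negligible (\<int> \<union> (\<Union>i. (\<lambda>t. t + real_of_int i) ` N i))"
    proof (intro negligible_Un negligible_countable_Union)
      show "negligible (\<int> :: real set)" by (intro negligible_countable countable_int)
      show "negligible T" if "T \<in> range (\<lambda>i. (\<lambda>t. t + real_of_int i) ` N i)" for T
        using that N(1) negligible_translation[of "N i" "real_of_int i" for i] by (auto simp: add.commute)
    qed auto
    fix t assume t: "t \<notin> \<int> \<union> (\<Union>i. (\<lambda>t. t + real_of_int i) ` N i)"
    define u where "u = frac t"
    have tu: "t = u + real_of_int \<lfloor>t\<rfloor>" by (simp add: u_def frac_def)
    have u: "u \<in> {0<..<1}" using t frac_gt_0_iff[of t] frac_lt_1[of t] by (simp add: u_def)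
    moreover have "u \<notin> N \<lfloor>t\<rfloor>" using t tu by blast
    ultimately obtain D where "((\<lambda>r. f (r + real_of_int \<lfloor>t\<rfloor>)) has_vector_derivative D) (at u within {0..1})"
      using N(2) by blast
    then have "((\<lambda>r. f (r + real_of_int \<lfloor>t\<rfloor>)) has_vector_derivative D) (at u)"
      using at_within_interior[of u "{0..1}"] u by (simp add: interior_atLeastAtMost_real)
    then have "(((\<lambda>r. f (r + real_of_int \<lfloor>t\<rfloor>)) \<circ> (\<lambda>r. r - real_of_int \<lfloor>t\<rfloor>)) has_vector_derivative 1 *\<^sub>R D) (at t)"
      by (intro vector_diff_chain_at) (auto intro!: derivative_eq_intros simp: tu[symmetric] u_def frac_def
          simp flip: has_real_derivative_iff_has_vector_derivative)
    then show "\<exists>D. (f has_vector_derivative D) (at t)" by (auto simp: o_def)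
  qed
qed

section \<open>Differential equations with an integrable Lipschitz constant\<close>

lemma continuous_on_atLeast_from_Icc:
  fixes f :: "real \<Rightarrow> 'b::topological_space"
  assumes "\<And>b. continuous_on {a..b} f"
  shows "continuous_on {a..} f"
  unfolding continuous_on_eq_continuous_within
proof
  fix x assume x: "x \<in> {a..}"
  have "continuous (at x within {a..x + 1}) f"
    using assms[of "x + 1"] x by (simp add: continuous_on_eq_continuous_within)
  moreover have "at x within {a..x + 1} = at x within {a..}"
    by (rule at_within_nhd[of x "{..<x + 1}"]) auto
  ultimately show "continuous (at x within {a..}) f" by (simp only:)
qed

lemma has_vector_derivative_Icc_at:
  fixes f :: "real \<Rightarrow> 'b::real_normed_vector"
  assumes "(f has_vector_derivative D) (at t within {a..b})" "a < t" "t < b"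
  shows "(f has_vector_derivative D) (at t)"
  using assms at_within_interior[of t "{a..b}"] by (simp add: interior_atLeastAtMost_real)

text \<open>Freezing \<open>g\<close> at \<open>t\<close> costs at most its oscillation times the
  increment of the primitive of \<open>w\<close>. Thus Lebesgue differentiation is used only for the
  scalar weight, and a good point of \<open>w\<close> is good for every continuous
  \<open>g\<close>.\<close>

lemma integral_weighted_has_vector_derivative:
  fixes g :: "real \<Rightarrow> 'b::banach" and w :: "real \<Rightarrow> real"
  assumes w: "w integrable_on {a..b}" and pos: "\<And>s. s \<in> {a..b} \<Longrightarrow> 0 \<le> w s"
    and g: "continuous_on {a..b} g" and t: "t \<in> {a..b}"
    and der: "((\<lambda>u. integral {a..u} w) has_vector_derivative w t) (at t within {a..b})"
  shows "((\<lambda>u. integral {a..u} (\<lambda>s. w s *\<^sub>R g s)) has_vector_derivative w t *\<^sub>R g t) (at t within {a..b})"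
proof -
  let ?A = "\<lambda>u. integral {a..u} w" and ?I = "\<lambda>u. integral {a..u} (\<lambda>s. w s *\<^sub>R g s)"
  have wg: "(\<lambda>s. w s *\<^sub>R g s) integrable_on {a..b}"
    by (rule integrable_weighted_continuous[OF w pos g])
  have incr: "norm (?I v - ?I u - (?A v - ?A u) *\<^sub>R g t) \<le> c * \<bar>?A v - ?A u\<bar>"
    if uv: "a \<le> u" "u \<le> v" "v \<le> b" and c: "\<And>s. s \<in> {u..v} \<Longrightarrow> norm (g s - g t) \<le> c" for u v c
  proof -
    have sub: "{u..v} \<subseteq> {a..b}" "{a..v} \<subseteq> {a..b}" using uv by auto
    have wi: "w integrable_on {u..v}" "(\<lambda>s. w s *\<^sub>R g s) integrable_on {u..v}"
      using integrable_subinterval_real[OF w sub(1)] integrable_subinterval_real[OF wg sub(1)] by auto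
    have wc: "(\<lambda>s. w s *\<^sub>R g t) integrable_on {u..v}"
      using integrable_linear[OF wi(1) bounded_linear_scaleR_left] by (simp add: o_def)
    have A: "?A v - ?A u = integral {u..v} w" and I: "?I v - ?I u = integral {u..v} (\<lambda>s. w s *\<^sub>R g s)"
      using uv integrable_subinterval_real[OF w sub(2)] integrable_subinterval_real[OF wg sub(2)]
      by (intro integral_diff_Icc; simp)+
    have "(?A v - ?A u) *\<^sub>R g t = integral {u..v} (\<lambda>s. w s *\<^sub>R g t)"
      unfolding A using integral_linear[OF wi(1) bounded_linear_scaleR_left[of "g t"]] by (simp add: o_def)
    then have "?I v - ?I u - (?A v - ?A u) *\<^sub>R g t = integral {u..v} (\<lambda>s. w s *\<^sub>R g s - w s *\<^sub>R g t)"
      unfolding I by (simp add: integral_diff[OF wi(2) wc])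
    also have "norm \<dots> \<le> integral {u..v} (\<lambda>s. c * w s)"
    proof (rule integral_norm_bound_integral)
      show "(\<lambda>s. w s *\<^sub>R g s - w s *\<^sub>R g t) integrable_on {u..v}" by (rule integrable_diff[OF wi(2) wc])
      show "(\<lambda>s. c * w s) integrable_on {u..v}" by (rule integrable_on_mult_right[OF wi(1)])
      fix s assume s: "s \<in> {u..v}"
      then have "0 \<le> w s" using pos sub by blast
      then show "norm (w s *\<^sub>R g s - w s *\<^sub>R g t) \<le> c * w s"
        using mult_left_mono[OF c[OF s], of "w s"] by (simp add: mult.commute flip: scaleR_diff_right)
    qed
    also have "\<dots> = c * integral {u..v} w" by simp
    also have "integral {u..v} w = \<bar>?A v - ?A u\<bar>"
      unfolding A using integral_nonneg[OF wi(1)] pos sub by (simp add: subset_iff)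
    finally show ?thesis .
  qed
  show ?thesis
    unfolding has_vector_derivative_iff_bound
  proof (intro allI impI)
    fix e :: real assume e: "e > 0"
    \<comment> \<open>Near \<open>t\<close> the primitive of \<open>w\<close> grows at a rate of at
      most \<open>|w t| + 1\<close>, so this oscillation of \<open>g\<close> costs
      \<open>e / 2\<close>.\<close>
    define c where "c = e / (2 * (\<bar>w t\<bar> + 1))"
    have c: "c > 0" "c * (\<bar>w t\<bar> + 1) = e / 2"
      using e by (simp_all add: c_def add_pos_nonneg field_simps)
    define n where "n = norm (g t) + 1"
    have n: "n > 0" by (simp add: n_def add_nonneg_pos)
    define e1 where "e1 = min 1 (e / (2 * n))"
    have e1: "e1 > 0" "e1 \<le> 1" using e n by (simp_all add: e1_def)
    have "e1 * norm (g t) \<le> e / (2 * n) * n"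
      using e n e1 by (intro mult_mono) (auto simp: e1_def n_def)
    also have "\<dots> = e / 2" using n by simp
    finally have e1_le: "e1 * norm (g t) \<le> e / 2" .
    obtain d1 where d1: "d1 > 0" "\<And>s. s \<in> {a..b} \<Longrightarrow> dist s t < d1 \<Longrightarrow> dist (g s) (g t) < c"
      using g t c(1) unfolding continuous_on_iff by blast
    obtain d2 where d2: "d2 > 0" "\<And>s. s \<in> {a..b} \<Longrightarrow> \<bar>s - t\<bar> < d2 \<Longrightarrow>
        norm (?A s - ?A t - (s - t) *\<^sub>R w t) \<le> e1 * \<bar>s - t\<bar>"
      using der[unfolded has_vector_derivative_iff_bound, rule_format, OF e1(1)] by blast
    show "\<exists>d>0. \<forall>s\<in>{a..b}. \<bar>s - t\<bar> < d \<longrightarrow> norm (?I s - ?I t - (s - t) *\<^sub>R w t *\<^sub>R g t) \<le> e * \<bar>s - t\<bar>"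
    proof (intro exI[of _ "min d1 d2"] conjI ballI impI)
      show "min d1 d2 > 0" using d1 d2 by simp
      fix s assume s: "s \<in> {a..b}" "\<bar>s - t\<bar> < min d1 d2"
      have close: "norm (g r - g t) \<le> c" if "r \<in> {min s t..max s t}" for r
      proof -
        have "r \<in> {a..b}" "dist r t < d1" using that s t by (auto simp: dist_real_def)
        then show ?thesis using d1(2) by (simp add: dist_norm less_imp_le)
      qed
      have "norm (?I s - ?I t - (?A s - ?A t) *\<^sub>R g t) \<le> c * \<bar>?A s - ?A t\<bar>"
      proof (cases "t \<le> s")
        case True
        then show ?thesis using incr[of t s c] close s t by simp
      next
        case False
        then have "norm (?I t - ?I s - (?A t - ?A s) *\<^sub>R g t) \<le> c * \<bar>?A t - ?A s\<bar>"
          using incr[of s t c] close s t by simp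
        moreover have "?I s - ?I t - (?A s - ?A t) *\<^sub>R g t = - (?I t - ?I s - (?A t - ?A s) *\<^sub>R g t)"
          by (simp add: scaleR_diff_left)
        ultimately show ?thesis by (simp only: norm_minus_cancel abs_minus_commute)
      qed
      moreover have A: "\<bar>?A s - ?A t - (s - t) * w t\<bar> \<le> e1 * \<bar>s - t\<bar>" using d2(2) s by simp
      moreover have "c * \<bar>?A s - ?A t\<bar> \<le> e / 2 * \<bar>s - t\<bar>"
      proof -
        have "\<bar>?A s - ?A t\<bar> \<le> \<bar>s - t\<bar> * \<bar>w t\<bar> + e1 * \<bar>s - t\<bar>"
          using A abs_triangle_ineq[of "?A s - ?A t - (s - t) * w t" "(s - t) * w t"] by (simp add: abs_mult)
        also have "\<dots> \<le> \<bar>s - t\<bar> * \<bar>w t\<bar> + 1 * \<bar>s - t\<bar>"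
          using e1 by (intro add_left_mono mult_right_mono) auto
        finally have "c * \<bar>?A s - ?A t\<bar> \<le> c * ((\<bar>w t\<bar> + 1) * \<bar>s - t\<bar>)"
          using c by (intro mult_left_mono) (auto simp: algebra_simps)
        then show ?thesis using c(2) by (simp only: mult.assoc[symmetric])
      qed
      moreover have "norm ((?A s - ?A t - (s - t) * w t) *\<^sub>R g t) \<le> e / 2 * \<bar>s - t\<bar>"
      proof -
        have "norm ((?A s - ?A t - (s - t) * w t) *\<^sub>R g t) \<le> e1 * \<bar>s - t\<bar> * norm (g t)"
          using A by (simp add: mult_right_mono)
        also have "\<dots> = e1 * norm (g t) * \<bar>s - t\<bar>" by simp
        also have "\<dots> \<le> e / 2 * \<bar>s - t\<bar>" using e1_le by (intro mult_right_mono) auto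
        finally show ?thesis .
      qed
      moreover have "?I s - ?I t - (s - t) *\<^sub>R w t *\<^sub>R g t
          = (?I s - ?I t - (?A s - ?A t) *\<^sub>R g t) + (?A s - ?A t - (s - t) * w t) *\<^sub>R g t"
        by (simp add: scaleR_diff_left)
      ultimately show "norm (?I s - ?I t - (s - t) *\<^sub>R w t *\<^sub>R g t) \<le> e * \<bar>s - t\<bar>"
        using norm_triangle_ineq[of "?I s - ?I t - (?A s - ?A t) *\<^sub>R g t" "(?A s - ?A t - (s - t) * w t) *\<^sub>R g t"]
        by (smt (verit) field_sum_of_halves distrib_right)
    qed
  qed
qed

section \<open>The clock of an integrable weight and its exponential\<close>

locale integrable_weight =
  fixes w :: "real \<Rightarrow> real"
  assumes w_nonneg: "t \<ge> 0 \<Longrightarrow> 0 \<le> w t"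
    and w_integrable: "b \<ge> 0 \<Longrightarrow> w integrable_on {0..b}"
begin

text \<open>The summand \<open>t\<close> keeps the clock strictly increasing with a 1-Lipschitz
  inverse even where \<open>w\<close> vanishes, and it accounts for the part of the vector field
  that carries no weight.\<close>

definition clock :: "real \<Rightarrow> real" where
  "clock t = t + integral {0..t} w"

lemma w_integrable_Icc: "0 \<le> a \<Longrightarrow> w integrable_on {a..b}"
  using w_integrable[of "max a b"] by (rule integrable_subinterval_real) auto

lemma clock_0 [simp]: "clock 0 = 0"
  by (simp add: clock_def)

lemma integral_clock:
  assumes "0 \<le> s" "s \<le> t"
  shows "integral {s..t} (\<lambda>r. 1 + w r) = clock t - clock s"
proof -
  have "integral {s..t} (\<lambda>r. 1 + w r) = integral {s..t} (\<lambda>_. 1) + integral {s..t} w"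
    using w_integrable_Icc[OF assms(1)] by (intro integral_add) auto
  then show ?thesis
    using integral_diff_Icc[OF assms w_integrable_Icc] assms by (simp add: clock_def)
qed

lemma clock_integrable: "0 \<le> s \<Longrightarrow> (\<lambda>r. 1 + w r) integrable_on {s..t}"
  by (intro integrable_add integrable_continuous_real continuous_on_const w_integrable_Icc)

lemma clock_increase:
  assumes "0 \<le> s" "s \<le> t"
  shows "t - s \<le> clock t - clock s"
proof -
  have "0 \<le> integral {s..t} w"
    using w_nonneg assms by (intro integral_nonneg w_integrable_Icc) auto
  then show ?thesis
    using integral_diff_Icc[OF assms w_integrable_Icc] by (simp add: clock_def)
qed

lemma clock_mono: "0 \<le> s \<Longrightarrow> s \<le> t \<Longrightarrow> clock s \<le> clock t"
  using clock_increase[of s t] by simp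

lemma clock_nonneg: "0 \<le> t \<Longrightarrow> 0 \<le> clock t"
  using clock_mono[of 0 t] by simp

lemma abs_cont_clock: "abs_cont_on clock 0 b"
proof (cases "b \<ge> 0")
  case True
  have "abs_cont_on (\<lambda>t. integral {0..t} (\<lambda>r. 1 + w r)) 0 b"
    using w_nonneg by (intro abs_cont_on_integral clock_integrable) auto
  then show ?thesis
    by (rule abs_cont_on_dominated[where C = 1]) (simp_all add: integral_clock)
next
  \<comment> \<open>For \<open>b < 0\<close> no interval meets the side conditions, so only the
    empty family is left.\<close>
  case False
  show ?thesis
    unfolding abs_cont_on_def
  proof (intro allI impI exI[of _ 1] conjI)
    fix e :: real and n :: nat and s t :: "nat \<Rightarrow> real"
    assume e: "0 < e" and *: "(\<forall>k<n. 0 \<le> s k \<and> s k \<le> t k \<and> t k \<le> b) \<and>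
      (\<forall>i<n. \<forall>j<n. i \<noteq> j \<longrightarrow> t i \<le> s j \<or> t j \<le> s i) \<and> (\<Sum>k<n. t k - s k) < 1"
    have "n = 0"
    proof (rule ccontr)
      assume "n \<noteq> 0"
      then have "0 \<le> s 0" "s 0 \<le> t 0" "t 0 \<le> b" using * by auto
      then show False using False by simp
    qed
    then show "(\<Sum>k<n. norm (clock (t k) - clock (s k))) < e" using e by simp
  qed simp
qed

lemma continuous_on_clock: "continuous_on {0..} clock"
  by (intro continuous_on_atLeast_from_Icc abs_cont_on_imp_continuous_on abs_cont_clock)

lemma integral_weight_derivative_ae:
  obtains N where "negligible N"
    "\<And>t. 0 < t \<Longrightarrow> t \<notin> N \<Longrightarrow> ((\<lambda>u. integral {0..u} w) has_vector_derivative w t) (at t)"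
proof -
  have "\<exists>N. negligible N \<and> (\<forall>t. t \<in> {0<..<real n} \<and> t \<notin> N \<longrightarrow>
      ((\<lambda>u. integral {0..u} w) has_vector_derivative w t) (at t))" for n
  proof -
    obtain N where "negligible N" "\<And>t. t \<in> {0<..<real n} \<Longrightarrow> t \<notin> N \<Longrightarrow>
        ((\<lambda>u. integral {0..u} w) has_vector_derivative w t) (at t within {0..real n})"
      using integral_has_vector_derivative_ae[OF w_integrable[of "real n"]] by auto
    then show ?thesis
      using has_vector_derivative_Icc_at by (metis greaterThanLessThan_iff)
  qed
  then obtain N where N: "\<And>n. negligible (N n)" "\<And>n t. t \<in> {0<..<real n} \<Longrightarrow> t \<notin> N n \<Longrightarrow>
      ((\<lambda>u. integral {0..u} w) has_vector_derivative w t) (at t)"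
    by metis
  show ?thesis
  proof (rule that)
    show "negligible (\<Union>n. N n)"
      using N(1) by (intro negligible_countable_Union) auto
    fix t :: real assume "0 < t" "t \<notin> (\<Union>n. N n)"
    moreover obtain n where "t < real n" using reals_Archimedean2 by blast
    ultimately show "((\<lambda>u. integral {0..u} w) has_vector_derivative w t) (at t)"
      using N(2)[of t n] by auto
  qed
qed

lemma clock_derivative_ae:
  obtains N where "negligible N"
    "\<And>t. 0 < t \<Longrightarrow> t \<notin> N \<Longrightarrow> (clock has_vector_derivative 1 + w t) (at t)"
proof -
  obtain N where N: "negligible N"
    "\<And>t. 0 < t \<Longrightarrow> t \<notin> N \<Longrightarrow> ((\<lambda>u. integral {0..u} w) has_vector_derivative w t) (at t)"
    using integral_weight_derivative_ae by blast
  have "(clock has_vector_derivative 1 + w t) (at t)" if "0 < t" "t \<notin> N" for t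
    unfolding clock_def[abs_def]
    by (intro has_vector_derivative_add has_vector_derivative_id N(2) that)
  then show ?thesis using that N(1) by blast
qed

text \<open>The clock is only absolutely continuous, so the chain rule for
  \<open>exp (k * clock s) / k\<close> holds almost everywhere, and the fundamental theorem for
  absolutely continuous functions integrates it.\<close>

lemma has_integral_exp_clock:
  assumes t: "0 \<le> t" and k: "k > 0"
  shows "((\<lambda>s. (1 + w s) * exp (k * clock s)) has_integral (exp (k * clock t) - 1) / k) {0..t}"
proof -
  obtain N where N: "negligible N"
    "\<And>t. 0 < t \<Longrightarrow> t \<notin> N \<Longrightarrow> (clock has_vector_derivative 1 + w t) (at t)"
    using clock_derivative_ae by blast
  have "((\<lambda>s. (1 + w s) * exp (k * clock s)) has_integral exp (k * clock t) / k - exp (k * clock 0) / k) {0..t}"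
  proof (rule fundamental_theorem_of_calculus_abs_cont[OF t])
    show "negligible (N \<union> {0})" using N(1) by simp
    show "abs_cont_on (\<lambda>s. exp (k * clock s) / k) 0 t"
    proof (rule abs_cont_on_dominated[OF abs_cont_clock])
      fix r s assume rs: "0 \<le> r" "r \<le> s" "s \<le> t"
      have le: "clock r \<le> clock s" "clock s \<le> clock t" using rs clock_mono by auto
      \<comment> \<open>The tangent bound for \<open>exp\<close> becomes a Lipschitz estimate in
        terms of the clock, with constant \<open>exp (k * clock t)\<close> on
        \<open>{0..t}\<close>.\<close>
      have "1 + (k * clock r - k * clock s) \<le> exp (k * clock r - k * clock s)"
        by (rule exp_ge_add_one_self)
      then have "exp (k * clock s) * (1 + (k * clock r - k * clock s)) \<le> exp (k * clock s) * exp (k * clock r - k * clock s)"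
        by (intro mult_left_mono) auto
      then have "exp (k * clock s) - exp (k * clock r) \<le> exp (k * clock s) * (k * (clock s - clock r))"
        by (simp add: exp_diff algebra_simps)
      also have "\<dots> \<le> exp (k * clock t) * (k * (clock s - clock r))"
        using le k by (intro mult_right_mono) auto
      finally have "(exp (k * clock s) - exp (k * clock r)) / k \<le> exp (k * clock t) * (clock s - clock r)"
        using k by (simp add: field_simps)
      moreover have "exp (k * clock r) \<le> exp (k * clock s)" using le k by simp
      ultimately show "norm (exp (k * clock s) / k - exp (k * clock r) / k) \<le> exp (k * clock t) * norm (clock s - clock r)"
        using le k by (simp flip: diff_divide_distrib)
    qed simp
    fix s assume "s \<in> {0..t} - (N \<union> {0})"
    then have "(clock has_real_derivative 1 + w s) (at s)"
      using N(2)[of s] by (simp add: has_real_derivative_iff_has_vector_derivative)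
    then have "((\<lambda>s. exp (k * clock s) / k) has_real_derivative (1 + w s) * exp (k * clock s)) (at s)"
      using k by (auto intro!: derivative_eq_intros)
    then show "((\<lambda>s. exp (k * clock s) / k) has_vector_derivative (1 + w s) * exp (k * clock s)) (at s within {0..t})"
      by (simp add: has_real_derivative_iff_has_vector_derivative has_vector_derivative_at_within)
  qed
  then show ?thesis by (simp add: diff_divide_distrib)
qed

end

text \<open>Time enters only through the scalar factor \<open>w\<close>. Along a continuous curve
  the right-hand side is thus a continuous function plus \<open>w\<close> times a continuous one,
  which the results on scalar weights can integrate and differentiate.\<close>

locale weighted_lipschitz_ode = integrable_weight w for w :: "real \<Rightarrow> real" +
  fixes G K :: "'b::banach \<Rightarrow> 'b" and L :: real
  assumes L_pos: "L > 0"
    and G_lipschitz: "norm (G x - G y) \<le> L * norm (x - y)"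
    and K_lipschitz: "norm (K x - K y) \<le> L * norm (x - y)"
begin

definition field :: "(real \<Rightarrow> 'b) \<Rightarrow> real \<Rightarrow> 'b" where
  "field y s = G (y s) + w s *\<^sub>R K (y s)"

lemma continuous_on_G: "continuous_on A G" and continuous_on_K: "continuous_on A K"
  using L_pos G_lipschitz K_lipschitz
  by (intro lipschitz_on_continuous_on[of L] lipschitz_onI; simp add: dist_norm)+

lemma field_integrable:
  assumes "0 \<le> a" "continuous_on {a..b} y"
  shows "field y integrable_on {a..b}"
proof -
  have G: "continuous_on {a..b} (\<lambda>s. G (y s))" and K: "continuous_on {a..b} (\<lambda>s. K (y s))"
    by (rule continuous_on_compose2[OF continuous_on_G assms(2) subset_UNIV],
        rule continuous_on_compose2[OF continuous_on_K assms(2) subset_UNIV])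
  have "(\<lambda>s. w s *\<^sub>R K (y s)) integrable_on {a..b}"
    by (rule integrable_weighted_continuous[OF w_integrable_Icc[OF assms(1)] _ K])
      (use w_nonneg assms(1) in auto)
  with integrable_continuous_real[OF G]
  have "(\<lambda>s. G (y s) + w s *\<^sub>R K (y s)) integrable_on {a..b}"
    by (rule integrable_add)
  then show ?thesis by (simp add: field_def[abs_def])
qed

lemma field_diff_le:
  assumes "0 \<le> s"
  shows "norm (field y s - field z s) \<le> L * (1 + w s) * norm (y s - z s)"
proof -
  have "field y s - field z s = (G (y s) - G (z s)) + w s *\<^sub>R (K (y s) - K (z s))"
    by (simp add: field_def algebra_simps)
  also have "norm \<dots> \<le> L * norm (y s - z s) + w s * (L * norm (y s - z s))"
    using w_nonneg[OF assms] by (intro norm_triangle_le add_mono G_lipschitz)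
      (simp add: mult_left_mono[OF K_lipschitz])
  finally show ?thesis by (simp add: algebra_simps)
qed

lemma field_le:
  assumes "0 \<le> s"
  shows "norm (field y s) \<le> (norm (G 0) + norm (K 0) + L * norm (y s)) * (1 + w s)"
proof -
  have "norm (field y s) \<le> norm (field (\<lambda>_. 0) s) + L * (1 + w s) * norm (y s)"
    using field_diff_le[OF assms, of y "\<lambda>_. 0"] norm_triangle_sub[of "field y s" "field (\<lambda>_. 0) s"] by simp
  moreover have "norm (field (\<lambda>_. 0) s) \<le> norm (G 0) + w s * norm (K 0)"
    unfolding field_def using w_nonneg[OF assms] by (intro norm_triangle_le) simp
  moreover have "norm (G 0) + w s * norm (K 0) \<le> (norm (G 0) + norm (K 0)) * (1 + w s)"
    using w_nonneg[OF assms] by (simp add: algebra_simps)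
  ultimately show ?thesis by (simp add: algebra_simps)
qed

text \<open>In the Bielecki norm weighted by \<open>exp (2 L clock)\<close> the Picard map halves distances.\<close>

lemma picard_contraction:
  assumes t: "0 \<le> t" and y: "continuous_on {0..t} y" and z: "continuous_on {0..t} z"
    and M: "M \<ge> 0" and le: "\<And>s. s \<in> {0..t} \<Longrightarrow> norm (y s - z s) \<le> M * exp (2 * L * clock s)"
  shows "norm (integral {0..t} (field y) - integral {0..t} (field z)) \<le> M / 2 * exp (2 * L * clock t)"
proof -
  have k: "2 * L > 0" using L_pos by simp
  note exp_int = has_integral_mult_right[OF has_integral_exp_clock[OF t k], of "L * M"]
  have "norm (integral {0..t} (\<lambda>s. field y s - field z s))
      \<le> integral {0..t} (\<lambda>s. L * M * ((1 + w s) * exp (2 * L * clock s)))"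
  proof (rule integral_norm_bound_integral)
    show "(\<lambda>s. field y s - field z s) integrable_on {0..t}"
      using y z by (intro integrable_diff field_integrable) auto
    show "(\<lambda>s. L * M * ((1 + w s) * exp (2 * L * clock s))) integrable_on {0..t}"
      using exp_int by blast
    fix s assume s: "s \<in> {0..t}"
    have "norm (field y s - field z s) \<le> L * (1 + w s) * norm (y s - z s)"
      using s by (intro field_diff_le) auto
    also have "\<dots> \<le> L * (1 + w s) * (M * exp (2 * L * clock s))"
      using s L_pos w_nonneg[of s] by (intro mult_left_mono le) auto
    finally show "norm (field y s - field z s) \<le> L * M * ((1 + w s) * exp (2 * L * clock s))"
      by (simp add: mult_ac)
  qed
  \<comment> \<open>The rate \<open>2 * L\<close> of the exponential gives the factor one half:
    \<open>L * M / (2 * L) = M / 2\<close>.\<close>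
  also have "\<dots> = L * M * ((exp (2 * L * clock t) - 1) / (2 * L))"
    using exp_int by (rule integral_unique)
  also have "\<dots> \<le> M / 2 * exp (2 * L * clock t)"
    using L_pos M by (simp add: field_simps)
  finally show ?thesis
    using y z by (simp add: integral_diff field_integrable)
qed

text \<open>On \<open>{0..b}\<close> the weighted distance attains its maximum; the contraction
  bounds this maximum by half of itself.\<close>

lemma integral_solution_unique:
  assumes y: "continuous_on {0..} y" "\<And>t. 0 \<le> t \<Longrightarrow> y t = c + integral {0..t} (field y)"
    and z: "continuous_on {0..} z" "\<And>t. 0 \<le> t \<Longrightarrow> z t = c + integral {0..t} (field z)"
    and b: "0 \<le> b"
  shows "y b = z b"
proof -
  let ?q = "\<lambda>s. norm (y s - z s) / exp (2 * L * clock s)"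
  have sub: "{0..b} \<subseteq> {0..}" for b :: real by auto
  have "continuous_on {0..b} ?q"
    using continuous_on_subset[OF y(1) sub] continuous_on_subset[OF z(1) sub]
      continuous_on_subset[OF continuous_on_clock sub]
    by (intro continuous_intros) auto
  then obtain t where t: "t \<in> {0..b}" "\<And>s. s \<in> {0..b} \<Longrightarrow> ?q s \<le> ?q t"
    using continuous_attains_sup[of "{0..b}" ?q] b by auto
  have "norm (y t - z t) = norm (integral {0..t} (field y) - integral {0..t} (field z))"
    using t(1) y(2)[of t] z(2)[of t] by simp
  also have "\<dots> \<le> ?q t / 2 * exp (2 * L * clock t)"
  proof (rule picard_contraction)
    fix s assume "s \<in> {0..t}"
    then have "?q s \<le> ?q t" using t by auto
    then show "norm (y s - z s) \<le> ?q t * exp (2 * L * clock s)" by (simp add: field_simps)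
  qed (use t(1) continuous_on_subset[OF y(1) sub] continuous_on_subset[OF z(1) sub] in auto)
  finally have "?q t \<le> 0" by simp
  moreover have "?q b \<le> ?q t" using t(2) b by simp
  ultimately have "?q b \<le> 0" by simp
  then show ?thesis by (simp add: divide_le_0_iff)
qed

text \<open>Banach's fixed point theorem on bounded continuous functions. The unknown is
  \<open>u = exp (- 2 L clock) y\<close>, so the supremum norm of \<open>u\<close> is the weighted
  norm of \<open>y\<close>.\<close>

lemma integral_solution_exists:
  "\<exists>y. continuous_on {0..} y \<and> (\<forall>t\<ge>0. y t = c + integral {0..t} (field y))"
proof -
  let ?e = "\<lambda>t. exp (2 * L * clock t)"
  define curve where "curve = (\<lambda>(u :: real \<Rightarrow>\<^sub>C 'b) t. ?e t *\<^sub>R apply_bcontfun u t)"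
  \<comment> \<open>\<open>max 0 t\<close> prolongs the image constantly to negative times, so that
    \<open>T u\<close> is bounded and continuous on the whole line.\<close>
  define T where "T = (\<lambda>u t. (c + integral {0..max 0 t} (field (curve u))) /\<^sub>R ?e (max 0 t))"
  have cont: "continuous_on {0..} (curve u)" for u
    unfolding curve_def by (intro continuous_intros continuous_on_clock continuous_on_apply_bcontfun)
  have cont_Icc: "continuous_on {0..t} (curve u)" for u t
    by (rule continuous_on_subset[OF cont]) auto
  have T_cont: "T u \<in> bcontfun" for u
  proof (rule bcontfun_normI)
    have "continuous_on {0..} (\<lambda>t. integral {0..t} (field (curve u)))"
      by (intro continuous_on_atLeast_from_Icc indefinite_integral_continuous_1 field_integrable cont_Icc) simp
    then have "continuous_on {0..} (\<lambda>t. (c + integral {0..t} (field (curve u))) /\<^sub>R ?e t)"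
      by (intro continuous_intros continuous_on_clock) auto
    then have "continuous_on UNIV (\<lambda>t. (\<lambda>t. (c + integral {0..t} (field (curve u))) /\<^sub>R ?e t) (max 0 t))"
      by (rule continuous_on_compose2) (auto intro!: continuous_intros)
    then show "continuous_on UNIV (T u)" by (simp add: T_def)
    let ?C = "norm (G 0) + norm (K 0) + L * norm u"
    fix t :: real
    define r where "r = max 0 t"
    have r: "0 \<le> r" by (simp add: r_def)
    have k: "2 * L > 0" using L_pos by simp
    note exp_int = has_integral_mult_right[OF has_integral_exp_clock[OF r k], of ?C]
    \<comment> \<open>Absorbs terms without the exponential, such as \<open>norm c\<close> and
      \<open>norm (G 0)\<close>, into multiples of it.\<close>
    have e1: "1 \<le> ?e s" if "0 \<le> s" for s
      using clock_nonneg[OF that] L_pos by simp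
    have "norm (integral {0..r} (field (curve u))) \<le> integral {0..r} (\<lambda>s. ?C * ((1 + w s) * ?e s))"
    proof (rule integral_norm_bound_integral)
      show "field (curve u) integrable_on {0..r}" by (intro field_integrable cont_Icc) simp
      show "(\<lambda>s. ?C * ((1 + w s) * ?e s)) integrable_on {0..r}" using exp_int by blast
      fix s assume s: "s \<in> {0..r}"
      have "norm (curve u s) \<le> norm u * ?e s"
        unfolding curve_def using norm_bounded[of u s] by (simp add: mult.commute mult_right_mono)
      then have "norm (G 0) + norm (K 0) + L * norm (curve u s) \<le> (norm (G 0) + norm (K 0)) * ?e s + L * (norm u * ?e s)"
        using e1[of s] s L_pos mult_left_mono[of 1 "?e s" "norm (G 0) + norm (K 0)"]
        by (intro add_mono mult_left_mono) auto
      also have "\<dots> = ?C * ?e s" by (simp add: algebra_simps)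
      finally have "(norm (G 0) + norm (K 0) + L * norm (curve u s)) * (1 + w s) \<le> ?C * ?e s * (1 + w s)"
        using w_nonneg[of s] s by (intro mult_right_mono) auto
      then show "norm (field (curve u) s) \<le> ?C * ((1 + w s) * ?e s)"
        using field_le[of s "curve u"] s by (simp add: mult_ac)
    qed
    also have "\<dots> = ?C * ((?e r - 1) / (2 * L))" using exp_int by (rule integral_unique)
    also have "\<dots> \<le> ?C / (2 * L) * ?e r"
      using L_pos by (simp add: divide_right_mono mult_left_mono)
    finally have "norm (c + integral {0..r} (field (curve u))) \<le> norm c * ?e r + ?C / (2 * L) * ?e r"
      using mult_left_mono[OF e1[OF r], of "norm c"] by (intro norm_triangle_le add_mono) auto
    also have "\<dots> = (norm c + ?C / (2 * L)) * ?e r" by (simp only: distrib_right)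
    finally have "norm (c + integral {0..r} (field (curve u))) / ?e r \<le> norm c + ?C / (2 * L)"
      by (subst pos_divide_le_eq) simp_all
    then show "norm (T u t) \<le> norm c + ?C / (2 * L)"
      unfolding T_def r_def[symmetric] norm_scaleR by (simp add: field_simps)
  qed
  have "dist (Bcontfun (T u)) (Bcontfun (T v)) \<le> 1 / 2 * dist u v" for u v
  proof (rule dist_bound)
    fix t :: real
    define r where "r = max 0 t"
    have r: "0 \<le> r" by (simp add: r_def)
    have "norm (integral {0..r} (field (curve u)) - integral {0..r} (field (curve v))) \<le> dist u v / 2 * ?e r"
    proof (rule picard_contraction[OF r cont_Icc cont_Icc])
      fix s assume "s \<in> {0..r}"
      have "curve u s - curve v s = ?e s *\<^sub>R (u s - v s)"
        by (simp add: curve_def scaleR_diff_right)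
      then have "norm (curve u s - curve v s) = ?e s * dist (u s) (v s)" by (simp add: dist_norm)
      then show "norm (curve u s - curve v s) \<le> dist u v * ?e s"
        using dist_bounded[of u s v] by (simp add: mult.commute mult_right_mono)
    qed simp
    then have "norm (integral {0..r} (field (curve u)) - integral {0..r} (field (curve v))) / ?e r \<le> dist u v / 2"
      by (subst pos_divide_le_eq) simp_all
    moreover have eq: "T u t - T v t = (integral {0..r} (field (curve u)) - integral {0..r} (field (curve v))) /\<^sub>R ?e r"
      by (simp add: T_def r_def flip: scaleR_diff_right)
    ultimately show "dist (apply_bcontfun (Bcontfun (T u)) t) (apply_bcontfun (Bcontfun (T v)) t) \<le> 1 / 2 * dist u v"
      unfolding Bcontfun_inverse[OF T_cont] dist_norm[of "T u t"] eq norm_scaleR by (simp add: field_simps)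
  qed
  then obtain u where "Bcontfun (T u) = u"
    using banach_fix_type[of "1 / 2" "\<lambda>u. Bcontfun (T u)"] by auto
  then have u: "apply_bcontfun u = T u" using Bcontfun_inverse[OF T_cont, of u] by simp
  have "curve u t = c + integral {0..t} (field (curve u))" if "0 \<le> t" for t
  proof -
    have "curve u t = ?e t *\<^sub>R T u t" by (simp only: curve_def u)
    then show ?thesis using that by (simp add: T_def max_absorb2)
  qed
  then show ?thesis using cont by blast
qed

text \<open>A continuous curve is bounded on \<open>{0..b}\<close>, so the field along it is at most
  \<open>C * (1 + w)\<close>, and \<open>1 + w\<close> integrates to the clock.\<close>

lemma integral_solution_clock_lipschitz:
  assumes y: "continuous_on {0..} y" "\<And>t. 0 \<le> t \<Longrightarrow> y t = c + integral {0..t} (field y)"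
  shows "\<exists>C\<ge>0. \<forall>s t. 0 \<le> s \<and> s \<le> t \<and> t \<le> b \<longrightarrow> norm (y t - y s) \<le> C * (clock t - clock s)"
proof -
  have cont: "continuous_on {0..t} y" for t by (rule continuous_on_subset[OF y(1)]) auto
  have "bounded (y ` {0..b})"
    by (intro compact_imp_bounded compact_continuous_image cont compact_Icc)
  then obtain B where B: "B > 0" "\<And>s. s \<in> {0..b} \<Longrightarrow> norm (y s) \<le> B"
    by (auto simp: bounded_pos)
  define C where "C = norm (G 0) + norm (K 0) + L * B"
  have C: "C \<ge> 0" using B(1) L_pos by (simp add: C_def)
  have "norm (y t - y s) \<le> C * (clock t - clock s)" if st: "0 \<le> s" "s \<le> t" "t \<le> b" for s t
  proof -
    have int: "field y integrable_on {0..t}" by (intro field_integrable cont) simp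
    have "y t - y s = integral {s..t} (field y)"
      using integral_diff_Icc[OF st(1,2) int] y(2)[of s] y(2)[of t] st by simp
    also have "norm \<dots> \<le> integral {s..t} (\<lambda>r. C * (1 + w r))"
    proof (rule integral_norm_bound_integral)
      show "field y integrable_on {s..t}" using st by (intro integrable_subinterval_real[OF int]) auto
      show "(\<lambda>r. C * (1 + w r)) integrable_on {s..t}"
        using clock_integrable[OF st(1)] by (intro integrable_on_mult_right)
      fix r assume r: "r \<in> {s..t}"
      then have "norm (field y r) \<le> (norm (G 0) + norm (K 0) + L * norm (y r)) * (1 + w r)"
        using st by (intro field_le) auto
      also have "\<dots> \<le> C * (1 + w r)"
        unfolding C_def using B(2)[of r] r st w_nonneg[of r] L_pos
        by (intro mult_right_mono add_left_mono mult_left_mono) auto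
      finally show "norm (field y r) \<le> C * (1 + w r)" .
    qed
    also have "\<dots> = C * (clock t - clock s)" using integral_clock[OF st(1,2)] by simp
    finally show ?thesis .
  qed
  then show ?thesis using C by blast
qed

text \<open>The integral of \<open>G (y s)\<close> is differentiable everywhere, the weighted part
  wherever the primitive of \<open>w\<close> has derivative \<open>w t\<close>. The exceptional set
  thus comes from \<open>w\<close> alone.\<close>

lemma integral_solution_derivative_ae:
  assumes y: "continuous_on {0..} y" "\<And>t. 0 \<le> t \<Longrightarrow> y t = c + integral {0..t} (field y)"
  obtains N where "negligible N"
    "\<And>t. 0 < t \<Longrightarrow> t \<notin> N \<Longrightarrow> (y has_vector_derivative field y t) (at t)"
proof -
  obtain N where N: "negligible N"
    "\<And>t. 0 < t \<Longrightarrow> t \<notin> N \<Longrightarrow> ((\<lambda>u. integral {0..u} w) has_vector_derivative w t) (at t)"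
    using integral_weight_derivative_ae by blast
  have cont: "continuous_on {0..t} y" for t by (rule continuous_on_subset[OF y(1)]) auto
  have Gc: "continuous_on {0..b} (\<lambda>s. G (y s))" and Kc: "continuous_on {0..b} (\<lambda>s. K (y s))" for b
    using cont by (auto intro: continuous_on_compose2[OF continuous_on_G] continuous_on_compose2[OF continuous_on_K])
  have "(y has_vector_derivative field y t) (at t)" if t: "0 < t" "t \<notin> N" for t
  proof -
    let ?b = "t + 1"
    have tb: "t \<in> {0..?b}" using t by simp
    have G_der: "((\<lambda>u. integral {0..u} (\<lambda>s. G (y s))) has_vector_derivative G (y t)) (at t within {0..?b})"
      by (rule integral_has_vector_derivative[OF Gc tb])
    have wt: "((\<lambda>u. integral {0..u} w) has_vector_derivative w t) (at t within {0..?b})"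
      using N(2)[OF t] by (rule has_vector_derivative_at_within)
    have "((\<lambda>u. integral {0..u} (\<lambda>s. w s *\<^sub>R K (y s))) has_vector_derivative w t *\<^sub>R K (y t)) (at t within {0..?b})"
      by (rule integral_weighted_has_vector_derivative[OF _ _ Kc tb wt]) (use w_integrable w_nonneg t in auto)
    with G_der have "((\<lambda>u. integral {0..u} (\<lambda>s. G (y s)) + integral {0..u} (\<lambda>s. w s *\<^sub>R K (y s)))
        has_vector_derivative field y t) (at t within {0..?b})"
      unfolding field_def by (rule has_vector_derivative_add)
    then have "((\<lambda>u. c + (integral {0..u} (\<lambda>s. G (y s)) + integral {0..u} (\<lambda>s. w s *\<^sub>R K (y s))))
        has_vector_derivative 0 + field y t) (at t within {0..?b})"
      by (intro has_vector_derivative_add has_vector_derivative_const)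
    then have "(y has_vector_derivative 0 + field y t) (at t within {0..?b})"
    proof (rule has_vector_derivative_transform[OF tb, rotated])
      fix u assume u: "u \<in> {0..?b}"
      have "integral {0..u} (field y) = integral {0..u} (\<lambda>s. G (y s)) + integral {0..u} (\<lambda>s. w s *\<^sub>R K (y s))"
        unfolding field_def[abs_def]
        by (intro integral_add integrable_continuous_real Gc integrable_weighted_continuous Kc w_integrable_Icc)
          (auto simp: w_nonneg)
      then show "y u = c + (integral {0..u} (\<lambda>s. G (y s)) + integral {0..u} (\<lambda>s. w s *\<^sub>R K (y s)))"
        using y(2)[of u] u by simp
    qed
    then show ?thesis using has_vector_derivative_Icc_at[of y "field y t" t 0 ?b] t by simp
  qed
  then show ?thesis using that N(1) by blast
qed

text \<open>The way back to the integral equation, which reduces uniqueness of strong solutions to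
  \<open>integral_solution_unique\<close>. The point 0 joins the null set because the derivative is
  given only for positive times.\<close>

lemma abs_cont_solution_integral:
  assumes ac: "\<And>b. b > 0 \<Longrightarrow> abs_cont_on y 0 b" and N: "negligible N"
    and der: "\<And>t. 0 < t \<Longrightarrow> t \<notin> N \<Longrightarrow> (y has_vector_derivative field y t) (at t)" and t: "0 \<le> t"
  shows "y t = y 0 + integral {0..t} (field y)"
proof (cases "t = 0")
  case False
  have "(field y has_integral (y t - y 0)) {0..t}"
  proof (rule fundamental_theorem_of_calculus_abs_cont[OF t])
    show "abs_cont_on y 0 t" using ac False t by simp
    show "negligible (N \<union> {0})" using N by simp
    show "(y has_vector_derivative field y s) (at s within {0..t})" if "s \<in> {0..t} - (N \<union> {0})" for s
      by (rule has_vector_derivative_at_within[OF der]) (use that in auto)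
  qed
  then have "integral {0..t} (field y) = y t - y 0" by (rule integral_unique)
  then show ?thesis by simp
next
  case True
  show ?thesis unfolding True by (simp add: integral_refl)
qed

end

section \<open>Curves that are Lipschitz with respect to the clock\<close>

context integrable_weight
begin

text \<open>Stronger than absolute continuity and stable under Lipschitz maps, so it passes from
  \<open>y\<close> to \<open>x\<close> and \<open>v\<close>. The constant may depend on
  \<open>b\<close>, as the field is bounded in terms of \<open>y\<close> on bounded intervals
  only.\<close>

definition clock_lipschitz :: "(real \<Rightarrow> 'b::real_normed_vector) \<Rightarrow> bool" where
  "clock_lipschitz y \<longleftrightarrow> (\<forall>b. \<exists>C\<ge>0. \<forall>s t. 0 \<le> s \<and> s \<le> t \<and> t \<le> b \<longrightarrow>
      norm (y t - y s) \<le> C * (clock t - clock s))"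

lemma clock_lipschitz_imp_abs_cont:
  assumes "clock_lipschitz y"
  shows "abs_cont_on y 0 b"
proof -
  obtain C where C: "C \<ge> 0" "\<forall>s t. 0 \<le> s \<and> s \<le> t \<and> t \<le> b \<longrightarrow> norm (y t - y s) \<le> C * (clock t - clock s)"
    using assms unfolding clock_lipschitz_def by blast
  show ?thesis
  proof (rule abs_cont_on_dominated[OF abs_cont_clock C(1)])
    fix s t assume st: "0 \<le> s" "s \<le> t" "t \<le> b"
    then show "norm (y t - y s) \<le> C * norm (clock t - clock s)"
      using C(2) clock_mono[of s t] by simp
  qed
qed

lemma clock_lipschitz_dominated:
  assumes "clock_lipschitz y" and c: "c \<ge> 0" and le: "\<And>s t. norm (x t - x s) \<le> c * norm (y t - y s)"
  shows "clock_lipschitz x"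
  unfolding clock_lipschitz_def
proof
  fix b
  obtain C where C: "C \<ge> 0" "\<forall>s t. 0 \<le> s \<and> s \<le> t \<and> t \<le> b \<longrightarrow> norm (y t - y s) \<le> C * (clock t - clock s)"
    using assms(1) unfolding clock_lipschitz_def by blast
  have "norm (x t - x s) \<le> c * C * (clock t - clock s)" if "0 \<le> s" "s \<le> t" "t \<le> b" for s t
    using order_trans[OF le mult_left_mono[OF C(2)[rule_format] c]] that by (simp add: mult.assoc)
  then show "\<exists>C\<ge>0. \<forall>s t. 0 \<le> s \<and> s \<le> t \<and> t \<le> b \<longrightarrow> norm (x t - x s) \<le> C * (clock t - clock s)"
    using C(1) c by (intro exI[of _ "c * C"]) simp
qed

text \<open>Reparametrizing by the clock makes the curve Lipschitz; the inverse of the clock is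
  1-Lipschitz and hence preserves null sets.\<close>

lemma clock_lipschitz_differentiable_Icc:
  fixes x :: "real \<Rightarrow> 'b::{real_inner,banach}"
  assumes b: "b > 0" and C: "C \<ge> 0"
    and le: "\<And>s t. 0 \<le> s \<Longrightarrow> s \<le> t \<Longrightarrow> t \<le> b \<Longrightarrow> norm (x t - x s) \<le> C * (clock t - clock s)"
  shows "\<exists>N. negligible N \<and> (\<forall>t. t \<in> {0<..<b} \<and> t \<notin> N \<longrightarrow> (\<exists>D. (x has_vector_derivative D) (at t)))"
proof -
  \<comment> \<open>The clock is continuous and starts at 0, so the intermediate value theorem
    provides an inverse on \<open>{0..clock b}\<close>.\<close>
  have "\<exists>t. 0 \<le> t \<and> t \<le> b \<and> clock t = r" if "r \<in> {0..clock b}" for r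
    using that b continuous_on_subset[OF continuous_on_clock, of "{0..b}"]
    by (intro IVT') auto
  then obtain inv where inv: "\<And>r. r \<in> {0..clock b} \<Longrightarrow> 0 \<le> inv r \<and> inv r \<le> b \<and> clock (inv r) = r"
    by metis
  have clock_le: "\<bar>s - t\<bar> \<le> \<bar>clock s - clock t\<bar>" if "0 \<le> s" "0 \<le> t" for s t
    using clock_increase[of s t] clock_increase[of t s] that by linarith
  have inv_clock: "inv (clock t) = t" if "t \<in> {0..b}" for t
  proof -
    have "clock t \<in> {0..clock b}" using that clock_mono[of 0 t] clock_mono[of t b] by auto
    then show ?thesis using inv[of "clock t"] clock_le[of "inv (clock t)" t] that by auto
  qed
  have x_le: "norm (x s - x t) \<le> C * \<bar>clock s - clock t\<bar>" if "s \<in> {0..b}" "t \<in> {0..b}" for s t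
    using le[of s t] le[of t s] clock_mono[of s t] clock_mono[of t s] that
    by (cases "s \<le> t") (auto simp: norm_minus_commute abs_minus_commute)
  \<comment> \<open>Clamping extends the reparametrized curve to the whole line with the same
    Lipschitz constant, as the differentiability theorem requires.\<close>
  define clamp where "clamp r = max 0 (min (clock b) r)" for r
  have clock_b: "0 \<le> clock b" using clock_nonneg b by simp
  have clamp: "clamp r \<in> {0..clock b}" for r using clock_b by (auto simp: clamp_def)
  define z where "z r = x (inv (clamp r))" for r
  have "norm (z r - z q) \<le> C * \<bar>r - q\<bar>" for r q
  proof -
    have "norm (z r - z q) \<le> C * \<bar>clock (inv (clamp r)) - clock (inv (clamp q))\<bar>"
      unfolding z_def using inv[OF clamp] by (intro x_le) auto
    also have "\<dots> = C * \<bar>clamp r - clamp q\<bar>" using inv[OF clamp] by simp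
    also have "\<dots> \<le> C * \<bar>r - q\<bar>"
      using C by (intro mult_left_mono) (auto simp: clamp_def max_def min_def)
    finally show ?thesis .
  qed
  then obtain N1 where N1: "negligible N1" "\<And>r. r \<notin> N1 \<Longrightarrow> \<exists>D. (z has_vector_derivative D) (at r)"
    using lipschitz_differentiable_ae[of z C] by blast
  obtain N2 where N2: "negligible N2"
    "\<And>t. 0 < t \<Longrightarrow> t \<notin> N2 \<Longrightarrow> (clock has_vector_derivative 1 + w t) (at t)"
    using clock_derivative_ae by blast
  have "negligible (inv ` (N1 \<inter> {0..clock b}))"
  proof (rule negligible_locally_Lipschitz_image)
    show "negligible (N1 \<inter> {0..clock b})" by (rule negligible_subset[OF N1(1)]) auto
    fix r assume r: "r \<in> N1 \<inter> {0..clock b}"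
    have "norm (inv q - inv r) \<le> 1 * norm (q - r)" if "q \<in> N1 \<inter> {0..clock b}" for q
      using clock_le[of "inv q" "inv r"] inv[of q] inv[of r] that r by simp
    then show "\<exists>T B. open T \<and> r \<in> T \<and> (\<forall>q\<in>N1 \<inter> {0..clock b} \<inter> T. norm (inv q - inv r) \<le> B * norm (q - r))"
      by (intro exI[of _ UNIV] exI[of _ 1]) auto
  qed simp
  moreover have "\<exists>D. (x has_vector_derivative D) (at t)"
    if t: "t \<in> {0<..<b}" "t \<notin> inv ` (N1 \<inter> {0..clock b})" "t \<notin> N2" for t
  proof -
    have range: "clock t \<in> {0..clock b}" using t clock_mono[of 0 t] clock_mono[of t b] by auto
    have "clock t \<notin> N1"
    proof
      assume "clock t \<in> N1"
      then have "inv (clock t) \<in> inv ` (N1 \<inter> {0..clock b})" using range by blast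
      then show False using t(1,2) inv_clock[of t] by simp
    qed
    then obtain D where "(z has_vector_derivative D) (at (clock t))" using N1(2) by blast
    \<comment> \<open>Chain rule: off the exceptional sets the clock is differentiable at
      \<open>t\<close> and \<open>z\<close> is differentiable at \<open>clock t\<close>.\<close>
    then have "((z \<circ> clock) has_vector_derivative (1 + w t) *\<^sub>R D) (at t)"
      using N2(2)[of t] t by (intro vector_diff_chain_at) auto
    moreover have "(z \<circ> clock) s = x s" if "s \<in> {0<..<b}" for s
    proof -
      have "clock s \<in> {0..clock b}" using that clock_mono[of 0 s] clock_mono[of s b] by auto
      then have "clamp (clock s) = clock s" by (simp add: clamp_def)
      then show ?thesis using inv_clock[of s] that by (simp add: z_def)
    qed
    ultimately have "(x has_vector_derivative (1 + w t) *\<^sub>R D) (at t)"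
      using has_vector_derivative_transform_within_open[of "z \<circ> clock" _ t "{0<..<b}" x] t by auto
    then show ?thesis by blast
  qed
  ultimately show ?thesis
    using N2(1) by (intro exI[of _ "inv ` (N1 \<inter> {0..clock b}) \<union> N2"]) auto
qed

lemma clock_lipschitz_differentiable_banach:
  fixes x :: "real \<Rightarrow> 'b::{real_inner,banach}"
  assumes "clock_lipschitz x"
  shows "\<exists>N. negligible N \<and> (\<forall>t. 0 < t \<and> t \<notin> N \<longrightarrow> (\<exists>D. (x has_vector_derivative D) (at t)))"
proof -
  \<comment> \<open>\<open>Suc n\<close> guarantees a positive right endpoint.\<close>
  have "\<exists>N. negligible N \<and> (\<forall>t. t \<in> {0<..<real (Suc n)} \<and> t \<notin> N \<longrightarrow> (\<exists>D. (x has_vector_derivative D) (at t)))" for n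
  proof -
    obtain C where "C \<ge> 0" "\<forall>s t. 0 \<le> s \<and> s \<le> t \<and> t \<le> real (Suc n) \<longrightarrow> norm (x t - x s) \<le> C * (clock t - clock s)"
      using assms unfolding clock_lipschitz_def by blast
    then show ?thesis
      by (intro clock_lipschitz_differentiable_Icc[where C = C]) auto
  qed
  then obtain N where N: "\<And>n. negligible (N n)"
    "\<And>n t. t \<in> {0<..<real (Suc n)} \<Longrightarrow> t \<notin> N n \<Longrightarrow> \<exists>D. (x has_vector_derivative D) (at t)"
    by metis
  have "negligible (\<Union>n. N n)"
    using N(1) by (intro negligible_countable_Union) auto
  moreover have "\<exists>D. (x has_vector_derivative D) (at t)" if "0 < t" "t \<notin> (\<Union>n. N n)" for t
  proof -
    obtain n where "t < real n" using reals_Archimedean2 by blast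
    then show ?thesis using N(2)[of t n] that by auto
  qed
  ultimately show ?thesis by blast
qed

end

section \<open>Transfer to sort \<open>{real_inner, complete_space}\<close>\<close>

text \<open>The sort \<open>{real_inner, complete_space}\<close> is not a subsort of \<open>banach\<close>, so the
  Henstock--Kurzweil integral of the library does not apply to it. An isometric copy of the
  space is declared to be an instance of \<open>banach\<close> instead.\<close>

typedef (overloaded) ('a::"{real_inner,complete_space}") hilbert_copy = "UNIV :: 'a set"
  morphisms of_copy to_copy
  by simp

setup_lifting type_definition_hilbert_copy

instantiation hilbert_copy :: ("{real_inner,complete_space}") real_inner
begin

lift_definition zero_hilbert_copy :: "'a hilbert_copy" is 0 .
lift_definition plus_hilbert_copy :: "'a hilbert_copy \<Rightarrow> 'a hilbert_copy \<Rightarrow> 'a hilbert_copy" is "(+)" .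
lift_definition minus_hilbert_copy :: "'a hilbert_copy \<Rightarrow> 'a hilbert_copy \<Rightarrow> 'a hilbert_copy" is "(-)" .
lift_definition uminus_hilbert_copy :: "'a hilbert_copy \<Rightarrow> 'a hilbert_copy" is uminus .
lift_definition scaleR_hilbert_copy :: "real \<Rightarrow> 'a hilbert_copy \<Rightarrow> 'a hilbert_copy" is scaleR .
lift_definition inner_hilbert_copy :: "'a hilbert_copy \<Rightarrow> 'a hilbert_copy \<Rightarrow> real" is inner .
lift_definition norm_hilbert_copy :: "'a hilbert_copy \<Rightarrow> real" is norm .
lift_definition dist_hilbert_copy :: "'a hilbert_copy \<Rightarrow> 'a hilbert_copy \<Rightarrow> real" is dist .
lift_definition sgn_hilbert_copy :: "'a hilbert_copy \<Rightarrow> 'a hilbert_copy" is sgn .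

definition uniformity_hilbert_copy :: "('a hilbert_copy \<times> 'a hilbert_copy) filter" where
  "uniformity_hilbert_copy = (INF e\<in>{0<..}. principal {(x, y). dist x y < e})"

definition open_hilbert_copy :: "'a hilbert_copy set \<Rightarrow> bool" where
  "open_hilbert_copy U \<longleftrightarrow> (\<forall>x\<in>U. \<forall>\<^sub>F (x', y) in uniformity. x' = x \<longrightarrow> y \<in> U)"

instance
proof
  fix x y z :: "'a hilbert_copy" and a b :: real and U :: "'a hilbert_copy set"
  show "x + y + z = x + (y + z)" by transfer (rule add.assoc)
  show "x + y = y + x" by transfer (rule add.commute)
  show "0 + x = x" by transfer simp
  show "- x + x = 0" by transfer simp
  show "x - y = x + - y" by transfer simp
  show "a *\<^sub>R (x + y) = a *\<^sub>R x + a *\<^sub>R y" by transfer (rule scaleR_add_right)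
  show "(a + b) *\<^sub>R x = a *\<^sub>R x + b *\<^sub>R x" by transfer (rule scaleR_add_left)
  show "a *\<^sub>R b *\<^sub>R x = (a * b) *\<^sub>R x" by transfer simp
  show "1 *\<^sub>R x = x" by transfer simp
  show "dist x y = norm (x - y)" by transfer (rule dist_norm)
  show "sgn x = scaleR (inverse (norm x)) x" by transfer (rule sgn_div_norm)
  show "uniformity = (INF e\<in>{0<..}. principal {(x, y :: 'a hilbert_copy). dist x y < e})"
    by (rule uniformity_hilbert_copy_def)
  show "open U \<longleftrightarrow> (\<forall>x\<in>U. \<forall>\<^sub>F (x', y) in uniformity. x' = x \<longrightarrow> y \<in> U)"
    by (rule open_hilbert_copy_def)
  show "inner x y = inner y x" by transfer (rule inner_commute)
  show "inner (x + y) z = inner x z + inner y z" by transfer (rule inner_add_left)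
  show "inner (a *\<^sub>R x) y = a * inner x y" by transfer (rule inner_scaleR_left)
  show "0 \<le> inner x x" by transfer simp
  show "inner x x = 0 \<longleftrightarrow> x = 0" by transfer simp
  show "norm x = sqrt (inner x x)" by transfer (rule norm_eq_sqrt_inner)
qed

end

instance hilbert_copy :: ("{real_inner,complete_space}") banach
proof
  fix X :: "nat \<Rightarrow> 'a hilbert_copy"
  assume "Cauchy X"
  then have "Cauchy (\<lambda>n. of_copy (X n))"
    unfolding Cauchy_def by (simp add: dist_hilbert_copy.rep_eq)
  then obtain l where "(\<lambda>n. of_copy (X n)) \<longlonglongrightarrow> l"
    using Cauchy_convergent convergent_def by blast
  then have "X \<longlonglongrightarrow> to_copy l"
    unfolding tendsto_iff by (simp add: dist_hilbert_copy.rep_eq to_copy_inverse)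
  then show "convergent X" by (rule convergentI)
qed

lemma norm_of_copy: "norm (of_copy x) = norm x"
  by (simp add: norm_hilbert_copy.rep_eq)

lemma norm_to_copy: "norm (to_copy x) = norm x"
  by (simp add: norm_hilbert_copy.rep_eq to_copy_inverse)

lemma to_copy_diff: "to_copy x - to_copy y = to_copy (x - y)"
  and to_copy_add: "to_copy x + to_copy y = to_copy (x + y)"
  and to_copy_scaleR: "a *\<^sub>R to_copy x = to_copy (a *\<^sub>R x)"
  by (simp_all add: minus_hilbert_copy.abs_eq plus_hilbert_copy.abs_eq scaleR_hilbert_copy.abs_eq)

lemma of_copy_diff: "of_copy x - of_copy y = of_copy (x - y)"
  by (simp add: minus_hilbert_copy.rep_eq)

lemma has_vector_derivative_to_copy:
  "((\<lambda>t. to_copy (f t)) has_vector_derivative to_copy D) (at t within S) \<longleftrightarrow>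
    (f has_vector_derivative D) (at t within S)"
  unfolding has_vector_derivative_iff_bound by (simp add: to_copy_diff to_copy_scaleR norm_to_copy)

section \<open>Differentiability and the weighted equation in the original space\<close>

context integrable_weight
begin

lemma clock_lipschitz_differentiable_ae:
  fixes x :: "real \<Rightarrow> 'a::{real_inner,complete_space}"
  assumes "clock_lipschitz x"
  obtains N where "negligible N" "\<And>t. 0 < t \<Longrightarrow> t \<notin> N \<Longrightarrow> \<exists>D. (x has_vector_derivative D) (at t)"
proof -
  have lip: "clock_lipschitz (\<lambda>t. to_copy (x t))"
    using assms by (rule clock_lipschitz_dominated[where c = 1]) (simp_all add: to_copy_diff norm_to_copy)
  obtain N where N: "negligible N"
    "\<forall>t. 0 < t \<and> t \<notin> N \<longrightarrow> (\<exists>D. ((\<lambda>t. to_copy (x t)) has_vector_derivative D) (at t))"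
    using clock_lipschitz_differentiable_banach[OF lip] by blast
  have "\<exists>D. (x has_vector_derivative D) (at t)" if t: "0 < t" "t \<notin> N" for t
  proof -
    obtain D where "((\<lambda>t. to_copy (x t)) has_vector_derivative D) (at t)" using N(2) t by blast
    then have "((\<lambda>t. to_copy (x t)) has_vector_derivative to_copy (of_copy D)) (at t)"
      by (simp add: of_copy_inverse)
    then show ?thesis unfolding has_vector_derivative_to_copy by blast
  qed
  then show ?thesis using that N(1) by blast
qed

text \<open>Both statements share the interpretation of the locale in the isometric copy, hence the
  joint proof. In the uniqueness part each curve has its own exceptional set, as two solutions
  arrive with unrelated null sets.\<close>

lemma
  fixes G K :: "'a::{real_inner,complete_space} \<Rightarrow> 'a"
  assumes L: "L > 0" and G: "\<And>x y. norm (G x - G y) \<le> L * norm (x - y)"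
    and K: "\<And>x y. norm (K x - K y) \<le> L * norm (x - y)"
  shows weighted_ode_solvable:
    "\<exists>y N. y 0 = c \<and> clock_lipschitz y \<and> negligible N \<and>
      (\<forall>t. 0 < t \<and> t \<notin> N \<longrightarrow> (y has_vector_derivative G (y t) + w t *\<^sub>R K (y t)) (at t))"
  and weighted_ode_unique:
    "\<lbrakk>\<And>b. b > 0 \<Longrightarrow> abs_cont_on y 0 b; \<And>b. b > 0 \<Longrightarrow> abs_cont_on z 0 b; y 0 = z 0;
      negligible M; negligible N;
      \<And>t. 0 < t \<Longrightarrow> t \<notin> M \<Longrightarrow> (y has_vector_derivative G (y t) + w t *\<^sub>R K (y t)) (at t);
      \<And>t. 0 < t \<Longrightarrow> t \<notin> N \<Longrightarrow> (z has_vector_derivative G (z t) + w t *\<^sub>R K (z t)) (at t);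
      0 \<le> t\<rbrakk> \<Longrightarrow> y t = z t"
proof -
  define G' where "G' x = to_copy (G (of_copy x))" for x
  define K' where "K' x = to_copy (K (of_copy x))" for x
  have "norm (G' x - G' y) \<le> L * norm (x - y)" "norm (K' x - K' y) \<le> L * norm (x - y)" for x y
    using G[of "of_copy x" "of_copy y"] K[of "of_copy x" "of_copy y"]
    unfolding G'_def K'_def to_copy_diff norm_to_copy of_copy_diff norm_of_copy .
  with L interpret ode: weighted_lipschitz_ode w G' K' L
    by unfold_locales
  have field: "ode.field (\<lambda>t. to_copy (u t)) t = to_copy (G (u t) + w t *\<^sub>R K (u t))" for u t
    by (simp add: ode.field_def G'_def K'_def to_copy_inverse to_copy_scaleR to_copy_add)
  show "\<exists>y N. y 0 = c \<and> clock_lipschitz y \<and> negligible N \<and>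
      (\<forall>t. 0 < t \<and> t \<notin> N \<longrightarrow> (y has_vector_derivative G (y t) + w t *\<^sub>R K (y t)) (at t))"
  proof -
    obtain y where y: "continuous_on {0..} y" "\<And>t. 0 \<le> t \<Longrightarrow> y t = to_copy c + integral {0..t} (ode.field y)"
      using ode.integral_solution_exists[of "to_copy c"] by blast
    obtain N where N: "negligible N" "\<And>t. 0 < t \<Longrightarrow> t \<notin> N \<Longrightarrow> (y has_vector_derivative ode.field y t) (at t)"
      using ode.integral_solution_derivative_ae[OF y] by blast
    define u where "u t = of_copy (y t)" for t
    have yu: "y = (\<lambda>t. to_copy (u t))" by (simp add: u_def of_copy_inverse)
    have "clock_lipschitz y"
      unfolding clock_lipschitz_def using ode.integral_solution_clock_lipschitz[OF y] by blast
    then have "clock_lipschitz u"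
      by (rule clock_lipschitz_dominated[where c = 1]) (simp_all add: u_def of_copy_diff norm_of_copy)
    moreover have "u 0 = c" using y(2)[of 0] by (simp add: u_def integral_refl to_copy_inverse)
    moreover have "(u has_vector_derivative G (u t) + w t *\<^sub>R K (u t)) (at t)" if "0 < t" "t \<notin> N" for t
      using N(2)[OF that] unfolding yu field has_vector_derivative_to_copy .
    ultimately show ?thesis using N(1) by blast
  qed
  assume ac: "\<And>b. b > 0 \<Longrightarrow> abs_cont_on y 0 b" "\<And>b. b > 0 \<Longrightarrow> abs_cont_on z 0 b" and init: "y 0 = z 0"
    and null: "negligible M" "negligible N"
    and y': "\<And>t. 0 < t \<Longrightarrow> t \<notin> M \<Longrightarrow> (y has_vector_derivative G (y t) + w t *\<^sub>R K (y t)) (at t)"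
    and z': "\<And>t. 0 < t \<Longrightarrow> t \<notin> N \<Longrightarrow> (z has_vector_derivative G (z t) + w t *\<^sub>R K (z t)) (at t)"
    and t: "0 \<le> t"
  \<comment> \<open>Strong solutions, transported to the copy, satisfy the integral equation;
    applied once to \<open>y\<close> and once to \<open>z\<close>.\<close>
  have sol: "continuous_on {0..} (\<lambda>t. to_copy (u t))"
      "0 \<le> t \<Longrightarrow> to_copy (u t) = to_copy (u 0) + integral {0..t} (ode.field (\<lambda>t. to_copy (u t)))"
    if u: "\<And>b. b > 0 \<Longrightarrow> abs_cont_on u 0 b" and S: "negligible S"
      and u': "\<And>t. 0 < t \<Longrightarrow> t \<notin> S \<Longrightarrow> (u has_vector_derivative G (u t) + w t *\<^sub>R K (u t)) (at t)"
    for u S t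
  proof -
    have uc: "abs_cont_on (\<lambda>t. to_copy (u t)) 0 b" if "b > 0" for b
      using u[OF that] by (rule abs_cont_on_dominated[where C = 1]) (simp_all add: to_copy_diff norm_to_copy)
    have "continuous_on {0..b} (\<lambda>t. to_copy (u t))" for b
    proof (rule continuous_on_subset)
      show "continuous_on {0..max b 1} (\<lambda>t. to_copy (u t))"
        by (rule abs_cont_on_imp_continuous_on[OF uc]) simp
    qed auto
    then show "continuous_on {0..} (\<lambda>t. to_copy (u t))" by (rule continuous_on_atLeast_from_Icc)
    assume "0 \<le> t"
    then show "to_copy (u t) = to_copy (u 0) + integral {0..t} (ode.field (\<lambda>t. to_copy (u t)))"
      by (intro ode.abs_cont_solution_integral[OF uc S])
        (simp_all add: field has_vector_derivative_to_copy u')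
  qed
  have "to_copy (y t) = to_copy (z t)"
  proof (rule ode.integral_solution_unique[where c = "to_copy (y 0)"])
    show "continuous_on {0..} (\<lambda>t. to_copy (y t))" by (rule sol(1)[OF ac(1) null(1) y'])
    show "continuous_on {0..} (\<lambda>t. to_copy (z t))" by (rule sol(1)[OF ac(2) null(2) z'])
    show "to_copy (y t) = to_copy (y 0) + integral {0..t} (ode.field (\<lambda>t. to_copy (y t)))" if "0 \<le> t" for t
      using that by (rule sol(2)[OF ac(1) null(1) y', rotated -1])
    show "to_copy (z t) = to_copy (y 0) + integral {0..t} (ode.field (\<lambda>t. to_copy (z t)))" if "0 \<le> t" for t
      unfolding init using that by (rule sol(2)[OF ac(2) null(2) z', rotated -1])
  qed (rule t)
  then show "y t = z t" by (simp add: to_copy_inject)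
qed

end

section \<open>Existence, uniqueness and representation of the solution pair\<close>

lemma at_within_atLeast:
  fixes t :: real
  assumes "a < t"
  shows "at t within {a..} = at t"
  using assms by (intro at_within_interior) (simp add: interior_real_atLeast)

theorem theorem2p1:
  fixes \<Phi> :: "'a::{real_inner,complete_space} \<Rightarrow> ereal"
    and lam mu :: real
    and \<epsilon> :: "real \<Rightarrow> real"
    and x0 v0 :: 'a
  assumes "proper_fun \<Phi>" and "convex_fun \<Phi>" and "lsc_fun \<Phi>"
    and "lam > 0" and "mu = 1 / lam"
    and "\<forall>t\<ge>0. \<epsilon> t \<ge> 0"
    and "\<forall>b\<ge>0. \<epsilon> integrable_on {0..b}"
    and "v0 \<in> subdiff \<Phi> x0"
  shows "\<exists>x v. strong_sol_xv \<Phi> lam \<epsilon> x0 v0 x v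
           \<and> (\<forall>x' v'. strong_sol_xv \<Phi> lam \<epsilon> x0 v0 x' v' \<longrightarrow>
                 (\<forall>t\<ge>0. x' t = x t \<and> v' t = v t))
           \<and> (\<exists>y. strong_sol_y \<Phi> mu \<epsilon> (x0 + mu *\<^sub>R v0) y
                 \<and> (\<forall>y'. strong_sol_y \<Phi> mu \<epsilon> (x0 + mu *\<^sub>R v0) y' \<longrightarrow>
                       (\<forall>t\<ge>0. y' t = y t))
                 \<and> (\<forall>t\<ge>0. x t = prox mu \<Phi> (y t) \<and> v t = moreau_grad mu \<Phi> (y t)))"
proof -
  have mu: "mu > 0" and lam_mu: "lam * mu = 1" "lam = 1 / mu" using assms(4,5) by auto
  interpret integrable_weight \<epsilon> using assms(6,7) by unfold_locales auto
  note hyps = assms(1-3) mu assms(8)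
  let ?J = "prox mu \<Phi>" and ?A = "moreau_grad mu \<Phi>"
  \<comment> \<open>The unweighted part \<open>G\<close> has Lipschitz constant 1, the part
    \<open>K\<close> weighted by \<open>\<epsilon>\<close> has \<open>mu\<close>;
    \<open>1 + mu\<close> serves for both.\<close>
  define G where "G z = ?J z - z" for z
  define K where "K z = - (mu *\<^sub>R ?J z)" for z
  have L: "1 + mu > 0" using mu by simp
  have G: "norm (G x - G y) \<le> (1 + mu) * norm (x - y)" for x y
  proof -
    have "norm (G x - G y) = norm ((x - ?J x) - (y - ?J y))"
      by (simp add: G_def norm_minus_commute algebra_simps)
    also have "\<dots> \<le> 1 * norm (x - y)" using prox_nonexpansive(2)[OF hyps] by simp
    also have "\<dots> \<le> (1 + mu) * norm (x - y)" using mu by (intro mult_right_mono) auto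
    finally show ?thesis .
  qed
  have K: "norm (K x - K y) \<le> (1 + mu) * norm (x - y)" for x y
  proof -
    have "K x - K y = mu *\<^sub>R (?J y - ?J x)" by (simp add: K_def algebra_simps)
    then have "norm (K x - K y) = mu * norm (?J x - ?J y)" using mu by (simp add: norm_minus_commute)
    also have "\<dots> \<le> (1 + mu) * norm (x - y)"
      using mu prox_nonexpansive(1)[OF hyps] by (intro mult_mono) auto
    finally show ?thesis .
  qed
  have mu_A: "mu *\<^sub>R ?A z = z - ?J z" for z using mu by (simp add: moreau_grad_def)
  have rhs: "D + mu *\<^sub>R ?A z + (mu * \<epsilon> t) *\<^sub>R ?J z = 0 \<longleftrightarrow> D = G z + \<epsilon> t *\<^sub>R K z" for D z t
    by (simp add: mu_A G_def K_def mult.commute add_eq_0_iff algebra_simps eq_neg_iff_add_eq_0)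
  \<comment> \<open>One-sided derivatives within \<open>{0..}\<close> become two-sided ones because
    the point 0, where alone they differ, can be put into the null set.\<close>
  have sol_y_iff: "strong_sol_y \<Phi> mu \<epsilon> c y \<longleftrightarrow> (\<forall>b>0. abs_cont_on y 0 b) \<and> y 0 = c \<and>
      (\<exists>N. negligible N \<and> (\<forall>t. 0 < t \<and> t \<notin> N \<longrightarrow> (y has_vector_derivative G (y t) + \<epsilon> t *\<^sub>R K (y t)) (at t)))"
    (is "_ \<longleftrightarrow> _ \<and> _ \<and> ?ae") for c y
  proof -
    have "(AE t in lborel. 0 \<le> t \<longrightarrow> (\<exists>y'. (y has_vector_derivative y') (at t within {0..}) \<and>
        y' + mu *\<^sub>R ?A (y t) + (mu * \<epsilon> t) *\<^sub>R ?J (y t) = 0)) \<longleftrightarrow> ?ae"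
      unfolding rhs
    proof
      assume ae: "AE t in lborel. 0 \<le> t \<longrightarrow> (\<exists>y'. (y has_vector_derivative y') (at t within {0..}) \<and> y' = G (y t) + \<epsilon> t *\<^sub>R K (y t))"
      obtain N where N: "negligible N" "\<And>t. t \<notin> N \<Longrightarrow> 0 \<le> t \<longrightarrow>
          (\<exists>y'. (y has_vector_derivative y') (at t within {0..}) \<and> y' = G (y t) + \<epsilon> t *\<^sub>R K (y t))"
        using AE_lborel_obtain_negligible[OF ae] by blast
      have "(y has_vector_derivative G (y t) + \<epsilon> t *\<^sub>R K (y t)) (at t)" if "0 < t" "t \<notin> N" for t
        using N(2)[OF that(2)] that(1) by (simp add: at_within_atLeast)
      then show ?ae using N(1) by blast
    next
      assume ?ae
      then obtain N where N: "negligible N" "\<And>t. 0 < t \<Longrightarrow> t \<notin> N \<Longrightarrow> (y has_vector_derivative G (y t) + \<epsilon> t *\<^sub>R K (y t)) (at t)"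
        by blast
      show "AE t in lborel. 0 \<le> t \<longrightarrow> (\<exists>y'. (y has_vector_derivative y') (at t within {0..}) \<and> y' = G (y t) + \<epsilon> t *\<^sub>R K (y t))"
      proof (rule negligible_imp_AE_lborel)
        show "negligible (insert 0 N)" using N(1) by simp
        show "0 \<le> t \<longrightarrow> (\<exists>y'. (y has_vector_derivative y') (at t within {0..}) \<and> y' = G (y t) + \<epsilon> t *\<^sub>R K (y t))"
          if "t \<notin> insert 0 N" for t
          using N(2)[of t] that by (auto intro: has_vector_derivative_at_within)
      qed
    qed
    then show ?thesis unfolding strong_sol_y_def by blast
  qed
  let ?c = "x0 + mu *\<^sub>R v0"
  obtain y N where y0: "y 0 = ?c" and yL: "clock_lipschitz y" and N: "negligible N"
    and y': "\<And>t. 0 < t \<Longrightarrow> t \<notin> N \<Longrightarrow> (y has_vector_derivative G (y t) + \<epsilon> t *\<^sub>R K (y t)) (at t)"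
    using weighted_ode_solvable[OF L G K, of ?c] by blast
  have y_sol: "strong_sol_y \<Phi> mu \<epsilon> ?c y"
    unfolding sol_y_iff using y0 clock_lipschitz_imp_abs_cont[OF yL] N y' by blast
  have y_unique: "z t = y t" if z: "strong_sol_y \<Phi> mu \<epsilon> ?c z" and t: "0 \<le> t" for z t
  proof -
    obtain M where M: "negligible M"
      "\<And>t. 0 < t \<Longrightarrow> t \<notin> M \<Longrightarrow> (z has_vector_derivative G (z t) + \<epsilon> t *\<^sub>R K (z t)) (at t)"
      using z unfolding sol_y_iff by blast
    have z0: "z 0 = ?c" and zac: "\<And>b. b > 0 \<Longrightarrow> abs_cont_on z 0 b"
      using z unfolding sol_y_iff by blast+
    show ?thesis
      by (rule weighted_ode_unique[OF L G K zac clock_lipschitz_imp_abs_cont[OF yL] _ M(1) N M(2) y' t])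
        (simp_all add: z0 y0)
  qed
  define x where "x t = ?J (y t)" for t
  define v where "v t = ?A (y t)" for t
  have v_eq: "v t = (1 / mu) *\<^sub>R (y t - x t)" for t by (simp add: v_def x_def moreau_grad_def)
  have xL: "clock_lipschitz x"
    by (rule clock_lipschitz_dominated[OF yL, of 1]) (simp_all add: x_def prox_nonexpansive(1)[OF hyps])
  have vL: "clock_lipschitz v"
  \<comment> \<open>\<open>v\<close> is \<open>(I - J) y / mu\<close>, so the nonexpansiveness of
    \<open>I - J\<close> gives the constant \<open>1 / mu\<close>.\<close>
  proof (rule clock_lipschitz_dominated[OF yL, of "1 / mu"])
    fix s t
    have "v t - v s = (1 / mu) *\<^sub>R ((y t - ?J (y t)) - (y s - ?J (y s)))"
      by (simp only: v_eq x_def scaleR_diff_right)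
    then show "norm (v t - v s) \<le> 1 / mu * norm (y t - y s)"
      using mu prox_nonexpansive(2)[OF hyps, of "y t" "y s"] by (simp add: divide_right_mono)
  qed (use mu in simp)
  have xv_sol: "strong_sol_xv \<Phi> lam \<epsilon> x0 v0 x v"
    unfolding strong_sol_xv_def
  proof (intro conjI allI impI)
    show "abs_cont_on x 0 b" "abs_cont_on v 0 b" for b
      by (rule clock_lipschitz_imp_abs_cont[OF xL], rule clock_lipschitz_imp_abs_cont[OF vL])
    show "v t \<in> subdiff \<Phi> (x t)" for t unfolding v_def x_def by (rule prox_subdiff[OF hyps])
    show "x 0 = x0" "v 0 = v0" unfolding x_def v_def y0 using prox_eqI[OF mu assms(8)] by auto
    obtain M where M: "negligible M" "\<And>t. 0 < t \<Longrightarrow> t \<notin> M \<Longrightarrow> \<exists>D. (x has_vector_derivative D) (at t)"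
      using clock_lipschitz_differentiable_ae[OF xL] by blast
    show "AE t in lborel. 0 \<le> t \<longrightarrow> (\<exists>x' v'. (x has_vector_derivative x') (at t within {0..}) \<and>
        (v has_vector_derivative v') (at t within {0..}) \<and> lam *\<^sub>R x' + v' + v t + \<epsilon> t *\<^sub>R x t = 0)"
    proof (rule negligible_imp_AE_lborel)
      show "negligible (insert 0 (M \<union> N))" using M(1) N by simp
      fix t assume t: "t \<notin> insert 0 (M \<union> N)"
      show "0 \<le> t \<longrightarrow> (\<exists>x' v'. (x has_vector_derivative x') (at t within {0..}) \<and>
        (v has_vector_derivative v') (at t within {0..}) \<and> lam *\<^sub>R x' + v' + v t + \<epsilon> t *\<^sub>R x t = 0)"
      proof
        assume "0 \<le> t"
        then have t0: "0 < t" using t by simp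
        let ?D = "G (y t) + \<epsilon> t *\<^sub>R K (y t)"
        obtain D where D: "(x has_vector_derivative D) (at t)" using M(2) t t0 by blast
        have yD: "(y has_vector_derivative ?D) (at t)" using y' t t0 by blast
        \<comment> \<open>Once \<open>x\<close> and \<open>y\<close> are differentiable at
          \<open>t\<close>, so is \<open>v = (y - x) / mu\<close>; the almost-everywhere theorem is
          applied to \<open>x\<close> only.\<close>
        have vD: "(v has_vector_derivative (1 / mu) *\<^sub>R (?D - D)) (at t)"
          unfolding v_eq[abs_def]
          by (rule bounded_linear.has_vector_derivative[OF bounded_linear_scaleR_right
                has_vector_derivative_diff[OF yD D]])
        have "?D + mu *\<^sub>R v t + (mu * \<epsilon> t) *\<^sub>R x t = 0"
          using rhs[of ?D "y t" t] by (simp add: v_def x_def)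
        \<comment> \<open>Since \<open>lam * mu = 1\<close>, the equation for \<open>y\<close> times
          \<open>lam\<close> is the equation for the pair, with \<open>lam y'\<close> in place of
          \<open>lam x' + v'\<close>.\<close>
        then have "lam *\<^sub>R (?D + mu *\<^sub>R v t + (mu * \<epsilon> t) *\<^sub>R x t) = 0" by simp
        then have "lam *\<^sub>R ?D + v t + \<epsilon> t *\<^sub>R x t = 0"
          by (simp only: scaleR_add_right scaleR_scaleR mult.assoc[symmetric] lam_mu(1)) simp
        moreover have "lam *\<^sub>R D + (1 / mu) *\<^sub>R (?D - D) = lam *\<^sub>R ?D"
          unfolding lam_mu(2) by (simp add: scaleR_diff_right)
        ultimately have "lam *\<^sub>R D + (1 / mu) *\<^sub>R (?D - D) + v t + \<epsilon> t *\<^sub>R x t = 0" by simp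
        then show "\<exists>x' v'. (x has_vector_derivative x') (at t within {0..}) \<and>
            (v has_vector_derivative v') (at t within {0..}) \<and> lam *\<^sub>R x' + v' + v t + \<epsilon> t *\<^sub>R x t = 0"
          using D vD has_vector_derivative_at_within by blast
      qed
    qed
  qed
  have xv_unique: "x' t = x t \<and> v' t = v t"
    if sol: "strong_sol_xv \<Phi> lam \<epsilon> x0 v0 x' v'" and t: "0 \<le> t" for x' v' t
  proof -
    \<comment> \<open>\<open>prox\<close> and \<open>moreau_grad\<close> recover the pair from this
      curve, so uniqueness for the \<open>y\<close> equation carries over.\<close>
    define z where "z t = x' t + mu *\<^sub>R v' t" for t
    have sub: "v' t \<in> subdiff \<Phi> (x' t)" if "0 \<le> t" for t
      using sol that unfolding strong_sol_xv_def by blast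
    have Jz: "?J (z t) = x' t" "?A (z t) = v' t" if "0 \<le> t" for t
      unfolding z_def using prox_eqI[OF mu sub[OF that]] by auto
    have "strong_sol_y \<Phi> mu \<epsilon> ?c z"
      unfolding strong_sol_y_def
    proof (intro conjI allI impI)
      fix b :: real assume "b > 0"
      then have ac: "abs_cont_on x' 0 b" "abs_cont_on v' 0 b"
        using sol unfolding strong_sol_xv_def by blast+
      have "abs_cont_on (\<lambda>t. mu *\<^sub>R v' t) 0 b"
        by (rule abs_cont_on_dominated[OF ac(2), of mu]) (use mu in \<open>simp_all flip: scaleR_diff_right\<close>)
      then show "abs_cont_on z 0 b"
        unfolding z_def[abs_def] by (rule abs_cont_on_add[OF ac(1)])
    next
      have "AE t in lborel. 0 \<le> t \<longrightarrow> (\<exists>p q. (x' has_vector_derivative p) (at t within {0..}) \<and>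
          (v' has_vector_derivative q) (at t within {0..}) \<and> lam *\<^sub>R p + q + v' t + \<epsilon> t *\<^sub>R x' t = 0)"
        using sol unfolding strong_sol_xv_def by blast
      then show "AE t in lborel. 0 \<le> t \<longrightarrow> (\<exists>y'. (z has_vector_derivative y') (at t within {0..}) \<and>
          y' + mu *\<^sub>R ?A (z t) + (mu * \<epsilon> t) *\<^sub>R ?J (z t) = 0)"
      proof (rule AE_mp, intro AE_I2 impI)
        fix t :: real
        assume "0 \<le> t \<longrightarrow> (\<exists>p q. (x' has_vector_derivative p) (at t within {0..}) \<and>
          (v' has_vector_derivative q) (at t within {0..}) \<and> lam *\<^sub>R p + q + v' t + \<epsilon> t *\<^sub>R x' t = 0)"
          and t: "0 \<le> t"
        then obtain p q where p: "(x' has_vector_derivative p) (at t within {0..})"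
          and q: "(v' has_vector_derivative q) (at t within {0..})"
          and eq: "lam *\<^sub>R p + q + v' t + \<epsilon> t *\<^sub>R x' t = 0" by blast
        have "(z has_vector_derivative p + mu *\<^sub>R q) (at t within {0..})"
          unfolding z_def[abs_def]
          by (rule has_vector_derivative_add[OF p bounded_linear.has_vector_derivative[OF bounded_linear_scaleR_right q]])
        \<comment> \<open>The reverse rescaling: the equation of the pair times \<open>mu\<close> is
          the equation for \<open>z\<close>.\<close>
        moreover have "mu *\<^sub>R (lam *\<^sub>R p + q + v' t + \<epsilon> t *\<^sub>R x' t) = 0" using eq by simp
        then have "p + mu *\<^sub>R q + mu *\<^sub>R ?A (z t) + (mu * \<epsilon> t) *\<^sub>R ?J (z t) = 0"
          using lam_mu(1) unfolding Jz[OF t] by (simp add: scaleR_add_right mult.commute)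
        ultimately show "\<exists>y'. (z has_vector_derivative y') (at t within {0..}) \<and>
          y' + mu *\<^sub>R ?A (z t) + (mu * \<epsilon> t) *\<^sub>R ?J (z t) = 0" by blast
      qed
    next
      show "z 0 = ?c" using sol unfolding strong_sol_xv_def z_def by simp
    qed
    then have "z t = y t" using t by (rule y_unique)
    then show ?thesis using Jz[OF t] by (simp add: x_def v_def)
  qed
  show ?thesis
  proof (intro exI conjI allI impI)
    show "strong_sol_xv \<Phi> lam \<epsilon> x0 v0 x v" by (rule xv_sol)
    show "strong_sol_y \<Phi> mu \<epsilon> ?c y" by (rule y_sol)
    show "z t = y t" if "strong_sol_y \<Phi> mu \<epsilon> ?c z" "0 \<le> t" for z t
      using that by (rule y_unique)
    show "x' t = x t" "v' t = v t" if "strong_sol_xv \<Phi> lam \<epsilon> x0 v0 x' v'" "0 \<le> t" for x' v' t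
      using xv_unique[OF that] by simp_all
    show "x t = ?J (y t)" "v t = ?A (y t)" for t
      by (simp_all add: x_def v_def)
  qed
qed

end
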